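(* For an integer $m>0$, let $\mathcal L_m$ be the expansion of the language of ordered groups $\{<,+\}$ by $m$ unary predicates $U_1,\ldots,U_m$. Let $T_m$ be the $\mathcal L_m$-theory consisting of: (i) the axioms of ordered divisible Abelian groups; (ii) axioms saying that $U_m$ is a nontrivial convex subgroup of the universe; (iii) axioms saying that $U_{k-1}$ is a nontrivial convex subgroup of $U_k$ for each $1<k\le m$ (each $U_i$ being identified with its set of realizations). Then $T_m$ is a consistent weakly o-minimal theory, that is, it is consistent and every model of $T_m$ is weakly o-minimal, and the equality $\mathfrak n_{\dim}(\mathcal M)=m+1$ holds for every model $\mathcal M$ of $T_m$.
   Context: A convex subgroup is *nontrivial* here if it is neither $\{0\}$ nor the whole ambient group. "Definable" means definable in the structure with parameters; $\mathbb N$ is the set of nonnegative integers. Let $\mathcal M=(M,\ldots)$ be a structure, $\mathrm{Def}_n(\mathcal M)$ the collection of definable subsets of $M^n$, and $\mathrm{Def}(\mathcal M)=\bigcup_{n>0}\mathrm{Def}_n(\mathcal M)$. Let $\Pi:M^n\to M^{n-1}$ be the projection forgetting the last coordinate, and for $X\subseteq M^n$, $x\in\Pi(X)$, put $X_x^{\Pi}=\{y\in M: (x,y)\in X\}$. Convention: $-\infty+i=-\infty$. A *dimension function* on $\mathcal M$ is a function $\dim:\mathrm{Def}(\mathcal M)\to\mathbb N\cup\{-\infty\}$ such that for every $n>0$: (1) $\dim(\emptyset)=-\infty$, $\dim(\{a\})=0$ for each $a\in M$, and $\dim(M)=1$; $(2)_n$ $\dim(X\cup Y)=\max\{\dim X,\dim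 Y\}$ for $X,Y\in\mathrm{Def}_n(\mathcal M)$; $(3)_n$ $\dim X=\dim X^{\sigma}$ for each $X\in\mathrm{Def}_n(\mathcal M)$ and each permutation $\sigma$ of $\{1,\dots,n\}$, where $X^\sigma=\{(x_{\sigma(1)},\dots,x_{\sigma(n)}):(x_1,\dots,x_n)\in X\}$; $(4)_n$ if $n>1$ and $X\in\mathrm{Def}_n(\mathcal M)$, then for $i=0,1$ the set $X(i)=\{x\in\Pi(X):\dim X_x^{\Pi}=i\}$ belongs to $\mathrm{Def}_{n-1}(\mathcal M)$ and $\dim(X\cap\Pi^{-1}(X(i)))=\dim(X(i))+i$. $\mathfrak n_{\dim}(\mathcal M)$ is the cardinality of the set of dimension functions on $\mathcal M$. A structure $\mathcal M=(M,<,\ldots)$ expanding a dense linear order without endpoints is *weakly o-minimal* if every definable subset of $M$ is a union of finitely many convex sets. *)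

theory Defs
  imports
    Complex_Main
    "HOL-Library.FuncSet"
    "HOL-Library.Option_ord"
    "HOL-Combinatorics.Permutations"
begin

section \<open>First-order languages, formulas and structures\<close>

text \<open>A language is given by its function and relation symbols, each listed with its arity.\<close>

record ('f, 'r) language =
  funs :: "('f \<times> nat) set"
  rels :: "('r \<times> nat) set"

datatype 'f tm = Var nat | Fn 'f "'f tm list"

datatype ('f, 'r) fm =
    Eq "'f tm" "'f tm"
  | Rel 'r "'f tm list"
  | Neg "('f, 'r) fm"
  | Conj "('f, 'r) fm" "('f, 'r) fm"
  | Exists nat "('f, 'r) fm"

abbreviation Imp :: "('f, 'r) fm \<Rightarrow> ('f, 'r) fm \<Rightarrow> ('f, 'r) fm" where
  "Imp \<phi> \<psi> \<equiv> Neg (Conj \<phi> (Neg \<psi>))"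

abbreviation Disj :: "('f, 'r) fm \<Rightarrow> ('f, 'r) fm \<Rightarrow> ('f, 'r) fm" where
  "Disj \<phi> \<psi> \<equiv> Neg (Conj (Neg \<phi>) (Neg \<psi>))"

abbreviation Forall :: "nat \<Rightarrow> ('f, 'r) fm \<Rightarrow> ('f, 'r) fm" where
  "Forall x \<phi> \<equiv> Neg (Exists x (Neg \<phi>))"

fun wf_tm :: "('f, 'r) language \<Rightarrow> 'f tm \<Rightarrow> bool" where
  "wf_tm L (Var i) \<longleftrightarrow> True"
| "wf_tm L (Fn f ts) \<longleftrightarrow> (f, length ts) \<in> funs L \<and> (\<forall>t\<in>set ts. wf_tm L t)"

fun wf_fm :: "('f, 'r) language \<Rightarrow> ('f, 'r) fm \<Rightarrow> bool" where
  "wf_fm L (Eq s t) \<longleftrightarrow> wf_tm L s \<and> wf_tm L t"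
| "wf_fm L (Rel r ts) \<longleftrightarrow> (r, length ts) \<in> rels L \<and> (\<forall>t\<in>set ts. wf_tm L t)"
| "wf_fm L (Neg \<phi>) \<longleftrightarrow> wf_fm L \<phi>"
| "wf_fm L (Conj \<phi> \<psi>) \<longleftrightarrow> wf_fm L \<phi> \<and> wf_fm L \<psi>"
| "wf_fm L (Exists x \<phi>) \<longleftrightarrow> wf_fm L \<phi>"

record ('f, 'r, 'a) fo_struct =
  univ :: "'a set"
  ifun :: "'f \<Rightarrow> 'a list \<Rightarrow> 'a"
  irel :: "'r \<Rightarrow> 'a list \<Rightarrow> bool"

definition tuples :: "('f, 'r, 'a) fo_struct \<Rightarrow> nat \<Rightarrow> 'a list set" where
  "tuples M n = {xs. length xs = n \<and> set xs \<subseteq> univ M}"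

definition is_struct :: "('f, 'r) language \<Rightarrow> ('f, 'r, 'a) fo_struct \<Rightarrow> bool" where
  "is_struct L M \<longleftrightarrow> univ M \<noteq> {} \<and>
     (\<forall>(f, n)\<in>funs L. \<forall>xs\<in>tuples M n. ifun M f xs \<in> univ M)"

fun eval_tm :: "('f, 'r, 'a) fo_struct \<Rightarrow> (nat \<Rightarrow> 'a) \<Rightarrow> 'f tm \<Rightarrow> 'a" where
  "eval_tm M e (Var i) = e i"
| "eval_tm M e (Fn f ts) = ifun M f (map (eval_tm M e) ts)"

fun sat :: "('f, 'r, 'a) fo_struct \<Rightarrow> (nat \<Rightarrow> 'a) \<Rightarrow> ('f, 'r) fm \<Rightarrow> bool" where
  "sat M e (Eq s t) \<longleftrightarrow> eval_tm M e s = eval_tm M e t"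
| "sat M e (Rel r ts) \<longleftrightarrow> irel M r (map (eval_tm M e) ts)"
| "sat M e (Neg \<phi>) \<longleftrightarrow> \<not> sat M e \<phi>"
| "sat M e (Conj \<phi> \<psi>) \<longleftrightarrow> sat M e \<phi> \<and> sat M e \<psi>"
| "sat M e (Exists x \<phi>) \<longleftrightarrow> (\<exists>a\<in>univ M. sat M (e(x := a)) \<phi>)"

definition is_model ::
    "('f, 'r) language \<Rightarrow> ('f, 'r) fm set \<Rightarrow> ('f, 'r, 'a) fo_struct \<Rightarrow> bool" where
  "is_model L T M \<longleftrightarrow> is_struct L M \<and>
     (\<forall>\<phi>\<in>T. \<forall>e. range e \<subseteq> univ M \<longrightarrow> sat M e \<phi>)"

text \<open>Consistency is the existence of a model. HOL cannot quantify existentially over types, so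
  the model is required to have its universe inside the natural numbers; by the downward
  Loewenheim-Skolem theorem this is no restriction for a countable language.\<close>

definition consistent :: "('f, 'r) language \<Rightarrow> ('f, 'r) fm set \<Rightarrow> bool" where
  "consistent L T \<longleftrightarrow> (\<exists>M :: ('f, 'r, nat) fo_struct. is_model L T M)"


section \<open>Definable sets and weak o-minimality\<close>

text \<open>\<open>M\<^sup>n\<close> consists of the lists of length \<open>n\<close> over the universe; in particular \<open>M\<close> itself is
  identified with the set of singleton lists. The variables below \<open>n\<close> range over the coordinates,
  the values of the remaining free variables are the parameters.\<close>

definition definable_by ::
    "('f, 'r, 'a) fo_struct \<Rightarrow> nat \<Rightarrow> ('f, 'r) fm \<Rightarrow> (nat \<Rightarrow> 'a) \<Rightarrow> 'a list set" where
  "definable_by M n \<phi> e = {xs \<in> tuples M n. sat M (\<lambda>i. if i < n then xs ! i else e i) \<phi>}"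

definition Def_n ::
    "('f, 'r) language \<Rightarrow> ('f, 'r, 'a) fo_struct \<Rightarrow> nat \<Rightarrow> 'a list set set" where
  "Def_n L M n = {definable_by M n \<phi> e | \<phi> e. wf_fm L \<phi> \<and> range e \<subseteq> univ M}"

definition Def :: "('f, 'r) language \<Rightarrow> ('f, 'r, 'a) fo_struct \<Rightarrow> 'a list set set" where
  "Def L M = (\<Union>n\<in>{0<..}. Def_n L M n)"

definition dense_linear_order_without_endpoints :: "'a set \<Rightarrow> ('a \<Rightarrow> 'a \<Rightarrow> bool) \<Rightarrow> bool" where
  "dense_linear_order_without_endpoints A lt \<longleftrightarrow>
     (\<forall>x\<in>A. \<not> lt x x) \<and>
     (\<forall>x\<in>A. \<forall>y\<in>A. \<forall>z\<in>A. lt x y \<longrightarrow> lt y z \<longrightarrow> lt x z) \<and>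
     (\<forall>x\<in>A. \<forall>y\<in>A. lt x y \<or> x = y \<or> lt y x) \<and>
     (\<forall>x\<in>A. \<forall>y\<in>A. lt x y \<longrightarrow> (\<exists>z\<in>A. lt x z \<and> lt z y)) \<and>
     (\<forall>x\<in>A. (\<exists>y\<in>A. lt y x) \<and> (\<exists>y\<in>A. lt x y))"

definition order_convex :: "'a set \<Rightarrow> ('a \<Rightarrow> 'a \<Rightarrow> bool) \<Rightarrow> 'a set \<Rightarrow> bool" where
  "order_convex A lt C \<longleftrightarrow> C \<subseteq> A \<and>
     (\<forall>x\<in>C. \<forall>z\<in>C. \<forall>y\<in>A. lt x y \<longrightarrow> lt y z \<longrightarrow> y \<in> C)"

text \<open>The argument \<open>r\<close> is the relation symbol interpreted by the order.\<close>

definition weakly_o_minimal ::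
    "('f, 'r) language \<Rightarrow> 'r \<Rightarrow> ('f, 'r, 'a) fo_struct \<Rightarrow> bool" where
  "weakly_o_minimal L r M \<longleftrightarrow>
     (let lt = (\<lambda>x y. irel M r [x, y]) in
       is_struct L M \<and> (r, 2) \<in> rels L \<and>
       dense_linear_order_without_endpoints (univ M) lt \<and>
       (\<forall>X\<in>Def_n L M 1. \<exists>\<C>. finite \<C> \<and> (\<forall>C\<in>\<C>. order_convex (univ M) lt C) \<and>
          {a. [a] \<in> X} = \<Union>\<C>))"


section \<open>Dimension functions\<close>

text \<open>The set of natural numbers with minus infinity is \<^typ>\<open>nat option\<close> with the order of
  \<^theory>\<open>HOL-Library.Option_ord\<close>, where \<^term>\<open>None\<close> is the least element and stands for minus
  infinity. Hence \<^term>\<open>map_option (\<lambda>j. j + i)\<close> is addition of \<open>i\<close>.\<close>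

definition fibre :: "'a list set \<Rightarrow> 'a list \<Rightarrow> 'a list set" where
  "fibre X xs = {[y] | y. xs @ [y] \<in> X}"

definition fibre_dim_set ::
    "('a list set \<Rightarrow> nat option) \<Rightarrow> 'a list set \<Rightarrow> nat \<Rightarrow> 'a list set" where
  "fibre_dim_set d X i = {xs \<in> butlast ` X. d (fibre X xs) = Some i}"

text \<open>Dimension functions have domain \<^term>\<open>Def L M\<close>; as HOL functions are total, extensionality
  is required so that functions with this domain are counted without repetition.\<close>

definition dimension_function ::
    "('f, 'r) language \<Rightarrow> ('f, 'r, 'a) fo_struct \<Rightarrow> ('a list set \<Rightarrow> nat option) \<Rightarrow> bool" where
  "dimension_function L M d \<longleftrightarrow>
     d \<in> extensional (Def L M) \<and>
     d {} = None \<and>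
     (\<forall>a\<in>univ M. d {[a]} = Some 0) \<and>
     d (tuples M 1) = Some 1 \<and>
     (\<forall>n>0.
        (\<forall>X\<in>Def_n L M n. \<forall>Y\<in>Def_n L M n. d (X \<union> Y) = max (d X) (d Y)) \<and>
        (\<forall>X\<in>Def_n L M n. \<forall>\<sigma>. \<sigma> permutes {..<n} \<longrightarrow> d (permute_list \<sigma> ` X) = d X) \<and>
        (n > 1 \<longrightarrow> (\<forall>X\<in>Def_n L M n. \<forall>i\<in>{0, 1}.
            fibre_dim_set d X i \<in> Def_n L M (n - 1) \<and>
            d {xs \<in> X. butlast xs \<in> fibre_dim_set d X i} =
              map_option (\<lambda>j. j + i) (d (fibre_dim_set d X i)))))"

text \<open>Beware that \<^const>\<open>card\<close> yields 0 on infinite sets; a positive value of \<open>n_dim\<close> is the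
  actual cardinality.\<close>

definition n_dim :: "('f, 'r) language \<Rightarrow> ('f, 'r, 'a) fo_struct \<Rightarrow> nat" where
  "n_dim L M = card {d. dimension_function L M d}"


section \<open>Ordered divisible Abelian groups with a chain of convex subgroups\<close>

datatype og_fun = Add

datatype og_rel = Less | U nat

definition lang :: "nat \<Rightarrow> (og_fun, og_rel) language" where
  "lang m = \<lparr>funs = {(Add, 2)}, rels = {(Less, 2)} \<union> {(U k, 1) | k. 1 \<le> k \<and> k \<le> m}\<rparr>"

type_synonym og_fm = "(og_fun, og_rel) fm"

abbreviation add :: "og_fun tm \<Rightarrow> og_fun tm \<Rightarrow> og_fun tm" where
  "add s t \<equiv> Fn Add [s, t]"

abbreviation lt_fm :: "og_fun tm \<Rightarrow> og_fun tm \<Rightarrow> og_fm" where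
  "lt_fm s t \<equiv> Rel Less [s, t]"

text \<open>The language has no constant for 0; in a group, 0 is the only element with \<open>x + x = x\<close>.\<close>

definition is_zero :: "og_fun tm \<Rightarrow> og_fm" where
  "is_zero t = Eq (add t t) t"

text \<open>\<open>mult_tm n t\<close> is the \<open>(n + 1)\<close>-fold sum of \<open>t\<close>.\<close>

primrec mult_tm :: "nat \<Rightarrow> og_fun tm \<Rightarrow> og_fun tm" where
  "mult_tm 0 t = t"
| "mult_tm (Suc n) t = add (mult_tm n t) t"

definition abelian_group_axioms :: "og_fm set" where
  "abelian_group_axioms =
    {Forall 0 (Forall 1 (Forall 2 (Eq (add (add (Var 0) (Var 1)) (Var 2))
       (add (Var 0) (add (Var 1) (Var 2)))))),
     Forall 0 (Forall 1 (Eq (add (Var 0) (Var 1)) (add (Var 1) (Var 0)))),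
     Exists 0 (Conj (Forall 1 (Eq (add (Var 1) (Var 0)) (Var 1)))
                (Forall 1 (Exists 2 (Eq (add (Var 1) (Var 2)) (Var 0)))))}"

definition divisibility_axioms :: "og_fm set" where
  "divisibility_axioms = {Forall 0 (Exists 1 (Eq (mult_tm n (Var 1)) (Var 0))) | n. True}"

definition order_axioms :: "og_fm set" where
  "order_axioms =
    {Forall 0 (Neg (lt_fm (Var 0) (Var 0))),
     Forall 0 (Forall 1 (Forall 2 (Imp (Conj (lt_fm (Var 0) (Var 1)) (lt_fm (Var 1) (Var 2)))
       (lt_fm (Var 0) (Var 2))))),
     Forall 0 (Forall 1 (Disj (lt_fm (Var 0) (Var 1)) (Disj (Eq (Var 0) (Var 1)) (lt_fm (Var 1) (Var 0))))),
     Forall 0 (Forall 1 (Forall 2 (Imp (lt_fm (Var 0) (Var 1))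
       (lt_fm (add (Var 0) (Var 2)) (add (Var 1) (Var 2))))))}"

text \<open>\<open>H\<close> and \<open>G\<close> give the formulas defining two subsets of the universe. Granted that \<open>G\<close> is a
  subgroup, the axioms say that \<open>H\<close> is a convex subgroup of \<open>G\<close> which is neither \<open>{0}\<close> nor \<open>G\<close>.\<close>

definition nontrivial_convex_subgroup_axioms ::
    "(og_fun tm \<Rightarrow> og_fm) \<Rightarrow> (og_fun tm \<Rightarrow> og_fm) \<Rightarrow> og_fm set" where
  "nontrivial_convex_subgroup_axioms H G =
    {Forall 0 (Imp (H (Var 0)) (G (Var 0))),
     Forall 0 (Imp (is_zero (Var 0)) (H (Var 0))),
     Forall 0 (Forall 1 (Imp (Conj (H (Var 0)) (H (Var 1))) (H (add (Var 0) (Var 1))))),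
     Forall 0 (Forall 1 (Imp (Conj (H (Var 0)) (is_zero (add (Var 0) (Var 1)))) (H (Var 1)))),
     Forall 0 (Forall 1 (Forall 2 (Imp (Conj (Conj (H (Var 0)) (H (Var 2)))
       (Conj (G (Var 1)) (Conj (lt_fm (Var 0) (Var 1)) (lt_fm (Var 1) (Var 2)))))
       (H (Var 1))))),
     Exists 0 (Conj (H (Var 0)) (Neg (is_zero (Var 0)))),
     Exists 0 (Conj (G (Var 0)) (Neg (H (Var 0))))}"

abbreviation whole :: "og_fun tm \<Rightarrow> og_fm" where
  "whole t \<equiv> Eq t t"

abbreviation in_U :: "nat \<Rightarrow> og_fun tm \<Rightarrow> og_fm" where
  "in_U k t \<equiv> Rel (U k) [t]"

definition theory_T :: "nat \<Rightarrow> og_fm set" where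
  "theory_T m =
     abelian_group_axioms \<union> divisibility_axioms \<union> order_axioms \<union>
     nontrivial_convex_subgroup_axioms (in_U m) whole \<union>
     (\<Union>k\<in>{1<..m}. nontrivial_convex_subgroup_axioms (in_U (k - 1)) (in_U k))"

end

theory Submission
  imports Defs "HOL-Algebra.Free_Abelian_Groups" "HOL-Computational_Algebra.Polynomial"
    "HOL-Library.Countable"
begin

text \<open>Put \<open>U\<^sub>0 = {0}\<close>. The truth of a formula at a tuple is determined by the positions (above, inside,
  below) of finitely many \<open>\<rat>\<close>-affine forms relative to \<open>U\<^sub>0, \<dots>, U\<^sub>m\<close>; since a one-variable position
  class is convex, models are weakly o-minimal.

  For \<open>k \<le> m\<close> call a subset of \<open>M\<close> small if it is covered by finitely many cosets of \<open>U\<^sub>k\<close>. For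
  definable sets this is a definable condition on the fibres, so fibrewise recursion defines a
  candidate dimension; the only nontrivial axiom is invariance under permutations, which reduces to
  exchanging the last two coordinates, hence to plane sets. There it holds because a plane set cut
  out by positions of affine forms contains with suitable points a segment or a box larger than
  \<open>U\<^sub>k\<close>.

  Conversely, a dimension function is determined by its values on unary sets. The \<open>b > 0\<close> for which
  \<open>(0, b)\<close> has dimension 0 are the positive elements of a definable convex subgroup \<open>H\<close>, and the
  definable convex subgroups are \<open>U\<^sub>0, \<dots>, U\<^sub>m, M\<close>. Slicing the triangle \<open>0 < x < y\<close> in both
  directions shows \<open>dim H = 0\<close>, so \<open>H = U\<^sub>k\<close> for some \<open>k \<le> m\<close>, and this \<open>k\<close> yields the
  dimension function.\<close>

section \<open>Rational vector spaces with a chain of convex subspaces\<close>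

text \<open>A model lives on a carrier set, whereas subtraction, halving and rational combinations
  are wanted as total operations on a type. Hence the geometry takes place in a vector space above
  the model, and congruence modulo U_0 replaces equality; parameters lift to constants of affine
  forms.

  Being covered by finitely many cosets is not a first-order condition as it stands, because the
  number of cosets is unbounded. It becomes one since a definable subset of the line that is not
  covered contains an interval longer than U_k.

  In the plane, exchanging coordinates must preserve two properties: having a large projection or a
  large fibre, and having a large set of large fibres. Both are settled by a pigeonhole over the
  finitely many positions, which yields points in the same position for all forms: two such points
  span a segment, three span a triangle whose centroid has a box around it.

  Convex subgroups strictly between U_k and U_{k+1} may exist but cannot be definable: closure under
  addition yields two points on either side of the cut that no finite set of parameters
  distinguishes.\<close>

text \<open>Think of \<open>P j v\<close> as \<open>v > U\<^sub>j\<close> in a chain \<open>0 = U\<^sub>0 \<subset> \<dots> \<subset> U\<^sub>m\<^sub>+\<^sub>1\<close> of convex subspaces, the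
  last one being the whole space. The space is only preordered by \<open>P 0\<close>: later it is a free
  \<open>\<rat>\<close>-vector space mapping onto the model, and \<open>U\<^sub>0\<close> is the kernel.\<close>

locale convex_chain = vector_space scale
  for scale :: "rat \<Rightarrow> 'v::ab_group_add \<Rightarrow> 'v" (infixr \<open>*s\<close> 75) +
  fixes m :: nat and P :: "nat \<Rightarrow> 'v \<Rightarrow> bool"
  assumes P_asym: "P j v \<Longrightarrow> \<not> P j (- v)"
    and P_add: "P j v \<Longrightarrow> \<not> P j (- w) \<Longrightarrow> P j (v + w)"
    and P_mono: "i \<le> j \<Longrightarrow> P j v \<Longrightarrow> P i v"
    and P_gap: "i < j \<Longrightarrow> j \<le> Suc m \<Longrightarrow> \<exists>v. P i v \<and> \<not> P j v"
    and P_top: "\<not> P (Suc m) v"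
begin

section \<open>Arithmetic of positions and of the induced preorder\<close>

lemma not_P_0 [simp]: "\<not> P j 0"
  using P_asym[of j 0] by auto

lemma P_beyond: "m < j \<Longrightarrow> \<not> P j v"
  using P_mono[of "Suc m" j v] P_top by auto

lemma not_P_add: "\<not> P j v \<Longrightarrow> \<not> P j w \<Longrightarrow> \<not> P j (v + w)"
  using P_add[of j "v + w" "- w"] by auto

lemma P_add_pos: "P j v \<Longrightarrow> P j w \<Longrightarrow> P j (v + w)"
  using P_add P_asym by blast

lemma not_P_of_nat: "\<not> P j v \<Longrightarrow> \<not> P j (of_nat n *s v)"
  by (induction n) (auto simp: scale_left_distrib not_P_add)

lemma P_of_nat: "P j v \<Longrightarrow> 0 < n \<Longrightarrow> P j (of_nat n *s v)"
proof (induction n)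
  case (Suc n)
  then show ?case
    by (cases "n = 0") (auto simp: scale_left_distrib P_add_pos)
qed simp

text \<open>Write q = a/b with positive integers a and b. Then b(qv) = av, and positive integer
  multiples neither create nor destroy the property of lying above U_j.\<close>

lemma P_scale:
  assumes "q > 0"
  shows "P j (q *s v) \<longleftrightarrow> P j v"
proof -
  obtain a b where ab: "quotient_of q = (a, b)" by fastforce
  have b: "b > 0" and q: "q = of_int a / of_int b"
    using quotient_of_denom_pos[OF ab] quotient_of_div[OF ab] by auto
  with assms have a: "a > 0"
    by (simp add: zero_less_divide_iff)
  have "of_nat (nat b) *s q *s v = of_nat (nat a) *s v"
    using a b q by simp
  moreover have "P j (of_nat (nat a) *s v) \<longleftrightarrow> P j v"
    using P_of_nat not_P_of_nat a by (metis zero_less_nat_eq)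
  moreover have "P j (of_nat (nat b) *s q *s v) \<longleftrightarrow> P j (q *s v)"
    using P_of_nat not_P_of_nat b by (metis zero_less_nat_eq)
  ultimately show ?thesis by metis
qed

text \<open>Position relative to U_j. For j > m it is constantly 0 (\<open>sg_beyond\<close>), so
  that only the levels up to m carry information although j ranges over all numbers.\<close>

definition sg :: "nat \<Rightarrow> 'v \<Rightarrow> int" where
  "sg j v = (if P j v then 1 else if P j (- v) then - 1 else 0)"

definition le :: "'v \<Rightarrow> 'v \<Rightarrow> bool" where
  "le v w \<longleftrightarrow> \<not> P 0 (v - w)"

lemma sg_minus: "sg j (- v) = - sg j v"
  using P_asym by (auto simp: sg_def)

lemma sg_eq_1: "sg j v = 1 \<longleftrightarrow> P j v"
  and sg_eq_m1: "sg j v = - 1 \<longleftrightarrow> P j (- v)"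
  and sg_eq_0: "sg j v = 0 \<longleftrightarrow> \<not> P j v \<and> \<not> P j (- v)"
  using P_asym by (auto simp: sg_def)

lemma sg_zero [simp]: "sg j 0 = 0"
  by (simp add: sg_def)

lemma sg_cases: "sg j v = 1 \<or> sg j v = 0 \<or> sg j v = - 1"
  by (auto simp: sg_def)

lemma sg_beyond: "m < j \<Longrightarrow> sg j v = 0"
  by (simp add: sg_def P_beyond)

lemma sg_scale_pos: "q > 0 \<Longrightarrow> sg j (q *s v) = sg j v"
  using P_scale[of q j v] P_scale[of q j "- v"] by (simp add: sg_def)

lemma sg_scale_neg: "q < 0 \<Longrightarrow> sg j (q *s v) = - sg j v"
  using sg_scale_pos[of "- q" j v] sg_minus[of j "q *s v"] by simp

lemma sg0_scale: "sg j v = 0 \<Longrightarrow> sg j (q *s v) = 0"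
  using sg_scale_pos[of q j v] sg_scale_neg[of q j v] by (cases q "0 :: rat" rule: linorder_cases) auto

lemma sg0_scale_iff: "q \<noteq> 0 \<Longrightarrow> sg j (q *s v) = 0 \<longleftrightarrow> sg j v = 0"
  using sg_scale_pos[of q j v] sg_scale_neg[of q j v] by (cases q "0 :: rat" rule: linorder_cases) auto

text \<open>A position relative to U_j depends only on the coset modulo U_j, so congruent
  representatives may be exchanged.\<close>

lemma sg_add_null: "sg j w = 0 \<Longrightarrow> sg j (v + w) = sg j v"
  using P_add[of j v w] P_add[of j "- v" "- w"] P_add[of j "v + w" "- w"] P_add[of j "- v - w" w]
  by (auto simp: sg_def algebra_simps split: if_splits)

lemma sg0_add: "sg j v = 0 \<Longrightarrow> sg j w = 0 \<Longrightarrow> sg j (v + w) = 0"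
  by (simp add: sg_add_null)

lemma sg0_diff: "sg j v = 0 \<Longrightarrow> sg j w = 0 \<Longrightarrow> sg j (v - w) = 0"
  using sg0_add[of j v "- w"] by (simp add: sg_minus)

lemma sg0_mono: "i \<le> j \<Longrightarrow> sg i v = 0 \<Longrightarrow> sg j v = 0"
  using P_mono by (auto simp: sg_eq_0)

lemma P_diff_le: "P j v \<Longrightarrow> le v w \<Longrightarrow> P j w"
  using P_add[of j v "w - v"] P_mono[of 0 j] by (auto simp: le_def)

lemma le_refl [simp]: "le v v"
  by (simp add: le_def)

lemma le_total: "le v w \<or> le w v"
  using P_asym[of 0 "v - w"] by (auto simp: le_def)

lemma le_trans: "le u v \<Longrightarrow> le v w \<Longrightarrow> le u w"
  using not_P_add[of 0 "u - v" "v - w"] by (simp add: le_def)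

lemma le_add: "le v w \<Longrightarrow> le (v + x) (w + x)"
  by (simp add: le_def)

lemma le_minus: "le v w \<Longrightarrow> le (- w) (- v)"
  by (simp add: le_def)

lemma le_diff: "le v w \<Longrightarrow> le (v - x) (w - x)"
  by (simp add: le_def)

lemma sg_mono: "le v w \<Longrightarrow> sg j v \<le> sg j w"
  using P_diff_le[of j v w] P_diff_le[of j "- w" "- v"] le_minus[of v w] P_asym[of j]
  by (auto simp: sg_def)

lemma sg_convex: "le x y \<Longrightarrow> le y z \<Longrightarrow> sg j (x - t) = s \<Longrightarrow> sg j (z - t) = s \<Longrightarrow> sg j (y - t) = s"
  using sg_mono[of "x - t" "y - t" j] sg_mono[of "y - t" "z - t" j] le_diff by force

lemma le_extremal:
  assumes "finite A" "A \<noteq> {}"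
  shows "\<exists>a\<in>A. \<forall>b\<in>A. le (f b) (f a)" and "\<exists>a\<in>A. \<forall>b\<in>A. le (f a) (f b)"
proof -
  have "(\<exists>a\<in>A. \<forall>b\<in>A. le (f b) (f a)) \<and> (\<exists>a\<in>A. \<forall>b\<in>A. le (f a) (f b))"
    using assms
  proof (induction A rule: finite_ne_induct)
    case (insert x F)
    then obtain a b where "a \<in> F" "\<forall>c\<in>F. le (f c) (f a)" "b \<in> F" "\<forall>c\<in>F. le (f b) (f c)"
      by blast
    have "\<exists>c\<in>insert x F. \<forall>b\<in>insert x F. le (f b) (f c)"
      using le_total[of "f x" "f a"] \<open>a \<in> F\<close> \<open>\<forall>c\<in>F. le (f c) (f a)\<close> le_trans[of _ "f a" "f x"]
      by auto
    moreover have "\<exists>c\<in>insert x F. \<forall>b\<in>insert x F. le (f c) (f b)"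
      using le_total[of "f x" "f b"] \<open>b \<in> F\<close> \<open>\<forall>c\<in>F. le (f b) (f c)\<close> le_trans[of "f x" "f b"]
      by auto
    ultimately show ?case by blast
  qed auto
  then show "\<exists>a\<in>A. \<forall>b\<in>A. le (f b) (f a)" and "\<exists>a\<in>A. \<forall>b\<in>A. le (f a) (f b)"
    by auto
qed

text \<open>Convex sets on a line have Helly number 2, so realizing finitely many positions at once
  reduces to realizing two of them.\<close>

lemma helly:
  assumes I: "finite I" "I \<noteq> {}"
    and convex: "\<And>i x y z. i \<in> I \<Longrightarrow> x \<in> C i \<Longrightarrow> z \<in> C i \<Longrightarrow> le x y \<Longrightarrow> le y z \<Longrightarrow> y \<in> C i"
    and meet: "\<And>i j. i \<in> I \<Longrightarrow> j \<in> I \<Longrightarrow> C i \<inter> C j \<noteq> {}"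
  shows "\<exists>p. \<forall>i\<in>I. p \<in> C i"
proof -
  have "\<forall>i j. \<exists>p. i \<in> I \<longrightarrow> j \<in> I \<longrightarrow> p \<in> C i \<inter> C j"
    using meet by blast
  then obtain p where p: "\<And>i j. i \<in> I \<Longrightarrow> j \<in> I \<Longrightarrow> p i j \<in> C i \<and> p i j \<in> C j"
    by (metis IntE)
  have "\<forall>i. \<exists>j\<in>I. \<forall>k\<in>I. le (p i j) (p i k)"
    using le_extremal(2)[OF I] by blast
  then obtain j where j: "\<And>i. j i \<in> I" "\<And>i k. k \<in> I \<Longrightarrow> le (p i (j i)) (p i k)"
    by metis
  obtain i0 where i0: "i0 \<in> I" "\<And>i. i \<in> I \<Longrightarrow> le (p i (j i)) (p i0 (j i0))"
    using le_extremal(1)[OF I, of "\<lambda>i. p i (j i)"] by blast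
  \<comment> \<open>The chosen point lies between \<open>p i (j i)\<close> and
    \<open>p i0 i\<close>, which both belong to \<open>C i\<close>.\<close>
  have "p i0 (j i0) \<in> C i" if "i \<in> I" for i
    using convex[OF that] p[OF that j(1)] p[OF i0(1) that] i0(2)[OF that] j(2)[OF that] by blast
  then show ?thesis by blast
qed

section \<open>Complete positions and the extension step of the back-and-forth argument\<close>

definition tc :: "'v \<Rightarrow> nat \<Rightarrow> int" where
  "tc v = (\<lambda>j. sg j v)"

lemma tc_eq_iff: "tc v = tc w \<longleftrightarrow> (\<forall>j. sg j v = sg j w)"
  by (simp add: tc_def fun_eq_iff)

lemma finite_range_tc: "finite (range tc)"
proof (rule finite_subset)
  show "range tc \<subseteq> {f. \<forall>j. (j \<in> {..m} \<longrightarrow> f j \<in> {- 1, 0, 1}) \<and> (j \<notin> {..m} \<longrightarrow> f j = 0)}"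
    using sg_cases by (auto simp: tc_def sg_beyond)
qed (rule finite_set_of_finite_funs, auto)

lemma tc_scale_cong: "tc v = tc w \<Longrightarrow> tc (q *s v) = tc (q *s w)"
  by (cases q "0 :: rat" rule: linorder_cases) (simp_all add: tc_eq_iff sg_scale_neg sg_scale_pos)

lemma tc_minus_cong: "tc v = tc w \<Longrightarrow> tc (- v) = tc (- w)"
  by (simp add: tc_eq_iff sg_minus)

lemma exists_beyond: "\<exists>w. P m w"
  using P_gap[of m "Suc m"] by auto

lemma P_cong: "tc v = tc w \<Longrightarrow> P j v \<longleftrightarrow> P j w"
  by (simp add: tc_eq_iff flip: sg_eq_1)

text \<open>Level j is the coarser one, so a is congruent to t modulo U_j as well, and u itself is a
  witness.\<close>

lemma sg_realize_zero:
  assumes eq: "tc (t - t') = tc (u - u')" and "i \<le> j" "sg i (a - t) = 0"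
  shows "\<exists>b. sg i (b - u) = sg i (a - t) \<and> sg j (b - u') = sg j (a - t')"
proof -
  have "sg j (a - t') = sg j (t - t')"
    using sg_add_null[of j "a - t" "t - t'"] sg0_mono[OF assms(2,3)] by (simp add: algebra_simps)
  then show ?thesis
    using eq assms(3) by (intro exI[of _ u]) (simp add: tc_eq_iff)
qed

text \<open>The witness has to stay in u + U_i and yet exceed u' by more than the smaller U_j. If t
  - t' is above U_i, u works; if it is inside U_i, shift u' by an element of U_i above U_j; below
  U_i is impossible. For i > m the coset is everything and a shift beyond U_m suffices.\<close>

lemma sg_realize_zero_pos:
  assumes eq: "tc (t - t') = tc (u - u')" and "j < i" "sg i (a - t) = 0" "P j (a - t')"
  shows "\<exists>b. sg i (b - u) = 0 \<and> P j (b - u')"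
proof (cases "i \<le> m")
  case True
  consider "P i (t - t')" | "sg i (t - t') = 0" | "P i (t' - t)"
    using sg_cases[of i "t - t'"] by (auto simp: sg_eq_1 sg_eq_m1)
  then show ?thesis
  proof cases
    case 1
    then have "P i (u - u')"
      using eq P_cong by blast
    then show ?thesis
      using P_mono[of j i] assms(2) by (intro exI[of _ u]) auto
  next
    case 2
    obtain w where w: "P j w" "\<not> P i w"
      using P_gap[of j i] True assms(2) by auto
    then have "sg i w = 0"
      using P_mono[of j i "- w"] P_asym assms(2) by (auto simp: sg_eq_0)
    moreover have "sg i (u - u') = 0"
      using 2 eq by (simp add: tc_eq_iff)
    ultimately have "sg i (w - (u - u')) = 0"
      by (rule sg0_diff)
    then show ?thesis
      using w by (intro exI[of _ "u' + w"]) (simp add: algebra_simps)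
  next
    case 3
    have "P i (- (a - t'))"
      using P_add[of i "t' - t" "t - a"] 3 assms(3) by (auto simp: sg_eq_0 algebra_simps)
    then show ?thesis
      using assms(2,4) P_mono[of j i] P_asym[of j] by force
  qed
next
  case False
  obtain w where "P m w" using exists_beyond by blast
  with False assms(2,4) P_beyond[of j] P_mono[of j m] show ?thesis
    by (intro exI[of _ "u' + w"]) (auto simp: sg_beyond not_less, meson not_less)
qed

lemma sg_realize_zero_any:
  assumes eq: "tc (t - t') = tc (u - u')" and "sg i (a - t) = 0"
  shows "\<exists>b. sg i (b - u) = sg i (a - t) \<and> sg j (b - u') = sg j (a - t')"
proof -
  have eq': "tc (- t - - t') = tc (- u - - u')"
    using tc_minus_cong[OF eq] by simp
  consider "i \<le> j" | "j < i" "sg j (a - t') = 0" | "j < i" "P j (a - t')" | "j < i" "P j (t' - a)"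
    using sg_cases[of j "a - t'"] le_less_linear[of i j] by (auto simp: sg_eq_1 sg_eq_m1)
  then show ?thesis
  proof cases
    case 1
    then show ?thesis using sg_realize_zero[OF eq] assms(2) by blast
  next
    case 2
    then show ?thesis using sg_realize_zero[of t' t u' u j i a] tc_minus_cong[OF eq] by auto
  next
    case 3
    then show ?thesis
      using sg_realize_zero_pos[OF eq 3(1) assms(2)] assms(2) by (auto simp flip: sg_eq_1)
  next
    case 4
    have "sg i (- a - - t) = 0"
      using assms(2) sg_minus[of i "a - t"] by simp
    then obtain b where b: "sg i (b - - u) = 0" "P j (b - - u')"
      using sg_realize_zero_pos[OF eq' 4(1), of "- a"] 4(2) by auto
    then have "sg i (- b - u) = 0" "sg j (- b - u') = - 1"
      using sg_minus[of i "b + u"] by (auto simp: sg_eq_m1 add.commute)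
    moreover have "sg j (a - t') = - 1"
      using 4 by (simp add: sg_eq_m1)
    ultimately show ?thesis
      using assms(2) by metis
  qed
qed

lemma sg_realize_pos_pos:
  "\<exists>b. P i (b - u) \<and> P j (b - u')" if "i \<le> m" "j \<le> m"
proof -
  obtain w where w: "P m w" using exists_beyond by blast
  have w': "P k w" if "k \<le> m" for k using P_mono[OF that w] .
  consider "le u u'" | "le u' u" using le_total by blast
  then show ?thesis
  proof cases
    case 1
    then have "le w (u' + w - u)" by (simp add: le_def)
    then show ?thesis
      using P_diff_le w' that by (intro exI[of _ "u' + w"]) auto
  next
    case 2
    then have "le w (u + w - u')" by (simp add: le_def)
    then show ?thesis
      using P_diff_le w' that by (intro exI[of _ "u + w"]) auto
  qed
qed

text \<open>A point squeezed between t and t' with margins U_i and U_j forces t' - t to exceed both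
  subgroups. So does u' - u, and the midpoint of u and u' has both margins because halving preserves
  positions.\<close>

lemma sg_realize_pos_neg:
  assumes eq: "tc (t - t') = tc (u - u')" and pos: "P i (a - t)" and neg: "P j (t' - a)"
  shows "\<exists>b. P i (b - u) \<and> P j (u' - b)"
proof -
  have "P i (t' - t)" "P j (t' - t)"
    using P_add[OF pos, of "t' - a"] P_add[OF neg, of "a - t"] P_mono[OF le0 pos]
      P_mono[OF le0 neg] P_asym[of 0] P_mono[of 0] by (auto simp: algebra_simps)
       (metis P_asym P_mono le0 minus_diff_eq)+
  then have *: "P i (u' - u)" "P j (u' - u)"
    using P_cong[OF tc_minus_cong[OF eq]] by auto
  let ?b = "(1/2) *s (u + u')"
  have "?b - u = (1/2) *s (u' - u)" "u' - ?b = (1/2) *s (u' - u)"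
    using scale_left_distrib[of "1/2" "1/2" u] scale_left_distrib[of "1/2" "1/2" u']
    by (simp_all add: scale_right_distrib scale_right_diff_distrib algebra_simps)
  then show ?thesis
    using * by (intro exI[of _ ?b]) (simp add: P_scale)
qed

text \<open>Two constraints at a time, as the Helly argument demands. Up to negation and exchange of
  the two centres, either one position is inside, or both are above, or one is above and the other
  below.\<close>

lemma sg_realize:
  assumes eq: "tc (t - t') = tc (u - u')"
  shows "\<exists>b. sg i (b - u) = sg i (a - t) \<and> sg j (b - u') = sg j (a - t')"
proof -
  have eq': "tc (t' - t) = tc (u' - u)"
    using tc_minus_cong[OF eq] by simp
  consider (z1) "sg i (a - t) = 0" | (z2) "sg j (a - t') = 0"
    | (pp) "P i (a - t)" "P j (a - t')" | (nn) "P i (t - a)" "P j (t' - a)"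
    | (pn) "P i (a - t)" "P j (t' - a)" | (np) "P i (t - a)" "P j (a - t')"
    using sg_cases[of i "a - t"] sg_cases[of j "a - t'"] by (auto simp: sg_eq_1 sg_eq_m1)
  then show ?thesis
  proof cases
    case z1
    then show ?thesis using sg_realize_zero_any[OF eq] by blast
  next
    case z2
    then show ?thesis using sg_realize_zero_any[OF eq'] by blast
  next
    case pp
    then have "i \<le> m" "j \<le> m" using P_beyond not_less by blast+
    then obtain b where "P i (b - u)" "P j (b - u')" using sg_realize_pos_pos by blast
    with pp show ?thesis by (metis sg_eq_1)
  next
    case nn
    then have "i \<le> m" "j \<le> m" using P_beyond not_less by blast+
    then obtain b where "P i (b - - u)" "P j (b - - u')" using sg_realize_pos_pos by blast
    with nn have "sg i (- b - u) = - 1" "sg j (- b - u') = - 1" "sg i (a - t) = - 1" "sg j (a - t') = - 1"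
      by (auto simp: sg_eq_m1 add.commute)
    then show ?thesis by metis
  next
    case pn
    then obtain b where "P i (b - u)" "P j (u' - b)" using sg_realize_pos_neg[OF eq] by blast
    with pn have "sg i (b - u) = 1" "sg j (b - u') = - 1" "sg i (a - t) = 1" "sg j (a - t') = - 1"
      by (auto simp: sg_eq_m1 sg_eq_1)
    then show ?thesis by metis
  next
    case np
    then obtain b where "P j (b - u')" "P i (u - b)" using sg_realize_pos_neg[OF eq'] by blast
    with np have "sg j (b - u') = 1" "sg i (b - u) = - 1" "sg j (a - t') = 1" "sg i (a - t) = - 1"
      by (auto simp: sg_eq_m1 sg_eq_1)
    then show ?thesis by metis
  qed
qed

text \<open>The position of a over finitely many centres is copied to new centres whose mutual
  differences have the same positions. Each pair of a centre and a level gives a convex constraint,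
  so it is enough to satisfy any two of them.\<close>

lemma tc_extend:
  assumes fin: "finite I"
    and eq: "\<And>i k. i \<in> I \<Longrightarrow> k \<in> I \<Longrightarrow> tc (t i - t k) = tc (u i - u k)"
  shows "\<exists>b. \<forall>i\<in>I. tc (b - u i) = tc (a - t i)"
proof (cases "I = {}")
  case False
  define C where "C = (\<lambda>(i, j). {b. sg j (b - u i) = sg j (a - t i)})"
  have "\<exists>b. \<forall>p \<in> I \<times> {..m}. b \<in> C p"
  proof (rule helly)
    show "C p \<inter> C p' \<noteq> {}" if "p \<in> I \<times> {..m}" "p' \<in> I \<times> {..m}" for p p'
      using that sg_realize[OF eq, of "fst p" "fst p'" "snd p" a "snd p'"] 
      by (auto simp: C_def)
  qed (use fin False in \<open>auto simp: C_def intro: sg_convex\<close>)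
  then obtain b where b: "\<And>i j. i \<in> I \<Longrightarrow> j \<le> m \<Longrightarrow> sg j (b - u i) = sg j (a - t i)"
    by (auto simp: C_def)
  have "tc (b - u i) = tc (a - t i)" if "i \<in> I" for i
    using b[OF that] by (auto simp: tc_eq_iff) (metis not_le sg_beyond)
  then show ?thesis by blast
qed auto

section \<open>Quantifier elimination\<close>

text \<open>Coefficients are rational but constants are arbitrary vectors; this is how parameters
  are absorbed.\<close>

inductive_set Aff :: "((nat \<Rightarrow> 'v) \<Rightarrow> 'v) set" where
  proj: "(\<lambda>e. e i) \<in> Aff"
| const: "(\<lambda>e. c) \<in> Aff"
| add: "F \<in> Aff \<Longrightarrow> G \<in> Aff \<Longrightarrow> (\<lambda>e. F e + G e) \<in> Aff"
| scale: "F \<in> Aff \<Longrightarrow> (\<lambda>e. q *s F e) \<in> Aff"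

lemma Aff_diff:
  assumes "F \<in> Aff" "G \<in> Aff"
  shows "(\<lambda>e. F e - G e) \<in> Aff"
  using Aff.add[OF assms(1) Aff.scale[OF assms(2), of "- 1"]] by simp

lemma Aff_split:
  assumes "F \<in> Aff"
  shows "\<exists>q. \<exists>G\<in>Aff. \<forall>e a. F (e(x := a)) = q *s a + G e"
  using assms
proof induction
  case (proj i)
  show ?case
  proof (cases "i = x")
    case True
    then show ?thesis
      by (intro exI[of _ 1] bexI[of _ "\<lambda>e. 0"]) (auto intro: Aff.const)
  next
    case False
    then show ?thesis
      by (intro exI[of _ 0] bexI[of _ "\<lambda>e. e i"]) (auto intro: Aff.proj)
  qed
next
  case (const c)
  then show ?case
    by (intro exI[of _ 0] bexI[of _ "\<lambda>e. c"]) (auto intro: Aff.const)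
next
  case (add F G)
  then obtain p q F' G' where "F' \<in> Aff" "G' \<in> Aff"
    "\<forall>e a. F (e(x := a)) = p *s a + F' e" "\<forall>e a. G (e(x := a)) = q *s a + G' e"
    by blast
  then show ?case
    by (intro exI[of _ "p + q"] bexI[of _ "\<lambda>e. F' e + G' e"])
       (auto intro: Aff.add simp: scale_left_distrib simp del: fun_upd_apply)
next
  case (scale F r)
  then obtain q F' where "F' \<in> Aff" "\<forall>e a. F (e(x := a)) = q *s a + F' e"
    by blast
  then show ?case
    by (intro exI[of _ "r * q"] bexI[of _ "\<lambda>e. r *s F' e"])
       (auto intro: Aff.scale simp: scale_right_distrib simp del: fun_upd_apply)
qed

text \<open>The semantic counterpart of equivalence to a quantifier-free formula; closure under
  projection (\<open>determined_exists\<close>) is quantifier elimination by a back-and-forth step.\<close>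

definition determined :: "((nat \<Rightarrow> 'v) \<Rightarrow> bool) \<Rightarrow> bool" where
  "determined D \<longleftrightarrow> (\<exists>\<F>. finite \<F> \<and> \<F> \<subseteq> Aff \<and>
     (\<forall>e e'. (\<forall>F\<in>\<F>. tc (F e) = tc (F e')) \<longrightarrow> D e = D e'))"

lemma determined_atom:
  assumes "F \<in> Aff" and "\<And>e e'. tc (F e) = tc (F e') \<Longrightarrow> D e = D e'"
  shows "determined D"
proof -
  have "finite {F} \<and> {F} \<subseteq> Aff \<and> (\<forall>e e'. (\<forall>F\<in>{F}. tc (F e) = tc (F e')) \<longrightarrow> D e = D e')"
    using assms by (metis empty_iff empty_subsetI finite.emptyI finite_insert insert_iff insert_subset)
  then show ?thesis
    unfolding determined_def by blast
qed

lemma determined_not: "determined D \<Longrightarrow> determined (\<lambda>e. \<not> D e)"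
  unfolding determined_def by metis

lemma determined_conj:
  assumes "determined D" "determined E"
  shows "determined (\<lambda>e. D e \<and> E e)"
proof -
  obtain \<F> \<G> where "finite \<F>" "\<F> \<subseteq> Aff" "\<forall>e e'. (\<forall>F\<in>\<F>. tc (F e) = tc (F e')) \<longrightarrow> D e = D e'"
    "finite \<G>" "\<G> \<subseteq> Aff" "\<forall>e e'. (\<forall>F\<in>\<G>. tc (F e) = tc (F e')) \<longrightarrow> E e = E e'"
    using assms by (auto simp: determined_def)
  then show ?thesis
    unfolding determined_def by (intro exI[of _ "\<F> \<union> \<G>"]) (auto, blast+)
qed

lemma determined_exists:
  assumes "determined D"
  shows "determined (\<lambda>e. \<exists>a. D (e(x := a)))"
proof -
  obtain \<F> where fin: "finite \<F>" "\<F> \<subseteq> Aff"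
    and D: "\<And>e e'. (\<And>F. F \<in> \<F> \<Longrightarrow> tc (F e) = tc (F e')) \<Longrightarrow> D e = D e'"
    using assms by (auto simp: determined_def)
  have "\<forall>F\<in>\<F>. \<exists>q G. G \<in> Aff \<and> (\<forall>e a. F (e(x := a)) = q *s a + G e)"
    using Aff_split fin by blast
  then obtain q G where G: "\<And>F. F \<in> \<F> \<Longrightarrow> G F \<in> Aff"
    and F: "\<And>F e a. F \<in> \<F> \<Longrightarrow> F (e(x := a)) = q F *s a + G F e"
    by metis
  \<comment> \<open>The root of F in the variable x: up to the factor \<open>q F\<close>, the form
    is the difference \<open>a - t F e\<close>.\<close>
  define t where "t F e = (- 1 / q F) *s G F e" for F e
  define \<F>1 where "\<F>1 = {F \<in> \<F>. q F \<noteq> 0}"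
  \<comment> \<open>What remains after eliminating x: the parts of the forms without x, and the
    differences of two roots, as required by \<open>tc_extend\<close>.\<close>
  define \<G> where "\<G> = G ` \<F> \<union> (\<lambda>(F, F') e. t F e - t F' e) ` (\<F>1 \<times> \<F>1)"
  have Ft: "F (e(x := a)) = q F *s (a - t F e)" if "F \<in> \<F>1" for F e a
    using that by (simp add: \<F>1_def F t_def scale_right_diff_distrib scale_right_distrib)
  have fin1: "finite \<F>1" using fin by (simp add: \<F>1_def)
  have step: "\<exists>b. D (e'(x := b))"
    if "D (e(x := a))" and eq: "\<forall>F\<in>\<G>. tc (F e) = tc (F e')" for e e' a
  proof -
    have "tc (t F e - t F' e) = tc (t F e' - t F' e')" if "F \<in> \<F>1" "F' \<in> \<F>1" for F F'
    proof -
      have "(\<lambda>e. t F e - t F' e) \<in> \<G>"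
        using that by (force simp: \<G>_def)
      from bspec[OF eq this] show ?thesis by simp
    qed
    then obtain b where b: "\<And>F. F \<in> \<F>1 \<Longrightarrow> tc (b - t F e') = tc (a - t F e)"
      using tc_extend[OF fin1, of "\<lambda>F. t F e" "\<lambda>F. t F e'" a] by blast
    have "tc (F (e(x := a))) = tc (F (e'(x := b)))" if "F \<in> \<F>" for F
    proof (cases "q F = 0")
      case True
      moreover have "tc (G F e) = tc (G F e')"
        using eq that by (auto simp: \<G>_def)
      ultimately show ?thesis using F[OF that] by simp
    next
      case False
      then have "F \<in> \<F>1" using that by (simp add: \<F>1_def)
      show ?thesis
        unfolding Ft[OF \<open>F \<in> \<F>1\<close>] by (rule tc_scale_cong, rule b[OF \<open>F \<in> \<F>1\<close>, symmetric])
    qed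
    then show ?thesis using D that(1) by blast
  qed
  have "\<G> \<subseteq> Aff"
    using G by (auto simp: \<G>_def \<F>1_def t_def intro!: Aff_diff Aff.scale simp del: scale_minus_left)
  moreover have "finite \<G>"
    using fin fin1 by (simp add: \<G>_def)
  moreover have "(\<exists>a. D (e(x := a))) = (\<exists>a. D (e'(x := a)))"
    if "\<forall>F\<in>\<G>. tc (F e) = tc (F e')" for e e'
    using step[of e _ e'] step[of e' _ e] that by metis
  ultimately show ?thesis
    unfolding determined_def by blast
qed

section \<open>Determined sets on the line and in the plane\<close>

lemma determined_unary:
  assumes "determined D"
  shows "\<exists>T. finite T \<and> (\<forall>a b. (\<forall>t\<in>T. tc (a - t) = tc (b - t)) \<longrightarrow> D (e(i := a)) = D (e(i := b)))"
proof -
  obtain \<F> where fin: "finite \<F>" "\<F> \<subseteq> Aff"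
    and D: "\<And>e e'. (\<And>F. F \<in> \<F> \<Longrightarrow> tc (F e) = tc (F e')) \<Longrightarrow> D e = D e'"
    using assms by (auto simp: determined_def)
  have "\<forall>F\<in>\<F>. \<exists>q c. \<forall>a. F (e(i := a)) = q *s a + c"
    using Aff_split fin by blast
  then obtain q c where F: "\<And>F a. F \<in> \<F> \<Longrightarrow> F (e(i := a)) = q F *s a + c F"
    by metis
  \<comment> \<open>The root of F in the variable i; a form constant in i contributes the harmless
    point 0, by division by zero.\<close>
  define t where "t F = (- 1 / q F) *s c F" for F
  have "D (e(i := a)) = D (e(i := b))" if eq: "\<forall>t\<in>t ` \<F>. tc (a - t) = tc (b - t)" for a b
  proof (rule D)
    fix F assume "F \<in> \<F>"
    have Ft: "F (e(i := a)) = q F *s (a - t F)" if "q F \<noteq> 0" for a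
      using that \<open>F \<in> \<F>\<close> by (simp add: F t_def scale_right_diff_distrib scale_right_distrib)
    have "tc (a - t F) = tc (b - t F)"
      using eq \<open>F \<in> \<F>\<close> by blast
    then show "tc (F (e(i := a))) = tc (F (e(i := b)))"
      using tc_scale_cong[of "a - t F" "b - t F" "q F"] Ft F[OF \<open>F \<in> \<F>\<close>]
      by (cases "q F = 0") (auto simp del: fun_upd_apply)
  qed
  then show ?thesis
    using fin by blast
qed

text \<open>Forms are listed by two coefficients and a constant, so that later arguments can
  distinguish whether a form depends on y or on z.\<close>

definition planar :: "('v \<Rightarrow> 'v \<Rightarrow> bool) \<Rightarrow> bool" where
  "planar Y \<longleftrightarrow> (\<exists>A :: (rat \<times> rat \<times> 'v) set. finite A \<and>
     (\<forall>y z y' z'. (\<forall>\<alpha> \<beta> c. (\<alpha>, \<beta>, c) \<in> A \<longrightarrow>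
        tc (\<alpha> *s y + \<beta> *s z + c) = tc (\<alpha> *s y' + \<beta> *s z' + c)) \<longrightarrow> Y y z = Y y' z'))"

lemma planarE:
  assumes "planar Y"
  obtains A :: "(rat \<times> rat \<times> 'v) set" where "finite A" and "\<And>y z y' z'.
      (\<And>\<alpha> \<beta> c. (\<alpha>, \<beta>, c) \<in> A \<Longrightarrow> tc (\<alpha> *s y + \<beta> *s z + c) = tc (\<alpha> *s y' + \<beta> *s z' + c)) \<Longrightarrow>
        Y y z = Y y' z'"
  using assms unfolding planar_def by (elim exE conjE) (erule that, iprover)

lemma determined_binary:
  assumes "determined D" "i \<noteq> j"
  shows "planar (\<lambda>y z. D (e(i := y, j := z)))"
proof -
  obtain \<F> where fin: "finite \<F>" "\<F> \<subseteq> Aff"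
    and D: "\<And>e e'. (\<And>F. F \<in> \<F> \<Longrightarrow> tc (F e) = tc (F e')) \<Longrightarrow> D e = D e'"
    using assms by (auto simp: determined_def)
  have "\<exists>\<alpha> \<beta> c. \<forall>y z. F (e(i := y, j := z)) = \<alpha> *s y + \<beta> *s z + c" if "F \<in> \<F>" for F
  proof -
    obtain \<beta> G where G: "G \<in> Aff" "\<And>e z. F (e(j := z)) = \<beta> *s z + G e"
      using Aff_split fin \<open>F \<in> \<F>\<close> by blast
    obtain \<alpha> H where H: "\<And>e y. G (e(i := y)) = \<alpha> *s y + H e"
      using Aff_split[OF G(1)] by blast
    show ?thesis
      using G H by (intro exI[of _ \<alpha>] exI[of _ \<beta>] exI[of _ "H e"]) (simp add: algebra_simps)
  qed
  then obtain \<alpha> \<beta> c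
    where F: "\<And>F y z. F \<in> \<F> \<Longrightarrow> F (e(i := y, j := z)) = \<alpha> F *s y + \<beta> F *s z + c F"
    by metis
  show ?thesis
    unfolding planar_def
  proof (intro exI[of _ "(\<lambda>F. (\<alpha> F, \<beta> F, c F)) ` \<F>"] conjI allI impI)
    fix y z y' z'
    assume "\<forall>\<alpha>' \<beta>' c'. (\<alpha>', \<beta>', c') \<in> (\<lambda>F. (\<alpha> F, \<beta> F, c F)) ` \<F> \<longrightarrow>
      tc (\<alpha>' *s y + \<beta>' *s z + c') = tc (\<alpha>' *s y' + \<beta>' *s z' + c')"
    then have "tc (\<alpha> F *s y + \<beta> F *s z + c F) = tc (\<alpha> F *s y' + \<beta> F *s z' + c F)" if "F \<in> \<F>" for F
      using that by blast
    then show "D (e(i := y, j := z)) = D (e(i := y', j := z'))"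
      by (intro D) (metis F)
  qed (use fin in auto)
qed


section \<open>Large subsets of the line and of the plane\<close>

text \<open>The negation of being small: no finite union of cosets of U_k covers S. The centres need
  not belong to S.\<close>

definition big :: "nat \<Rightarrow> 'v set \<Rightarrow> bool" where
  "big k S \<longleftrightarrow> \<not> (\<exists>T. finite T \<and> (\<forall>s\<in>S. \<exists>t\<in>T. sg k (s - t) = 0))"

lemma big_Un: "big k (S \<union> S') \<longleftrightarrow> big k S \<or> big k S'"
proof -
  have "\<not> big k (S \<union> S')" if "\<not> big k S" "\<not> big k S'"
  proof -
    from that(1) obtain T where "finite T" "\<forall>s\<in>S. \<exists>t\<in>T. sg k (s - t) = 0"
      unfolding big_def not_not by (elim exE conjE) (erule that)
    moreover from that(2) obtain T' where "finite T'" "\<forall>s\<in>S'. \<exists>t\<in>T'. sg k (s - t) = 0"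
      unfolding big_def not_not by (elim exE conjE) (erule that)
    ultimately
    show ?thesis
      unfolding big_def by (auto intro!: exI[of _ "T \<union> T'"])
  qed
  then show ?thesis
    unfolding big_def by blast
qed

lemma big_mono: "S \<subseteq> S' \<Longrightarrow> big k S \<Longrightarrow> big k S'"
  using big_Un[of k S S'] by (simp add: Un_absorb1)

lemma not_big_empty [simp]: "\<not> big k {}"
  unfolding big_def by blast

text \<open>Otherwise one representative for each value of g would give finitely many cosets that
  cover S.\<close>

lemma big_pigeonhole:
  assumes "big k S" "finite (g ` S)"
  shows "\<exists>s\<in>S. \<exists>s'\<in>S. g s = g s' \<and> sg k (s - s') \<noteq> 0"
proof (rule ccontr)
  assume *: "\<not> ?thesis"
  define r where "r c = (SOME s. s \<in> S \<and> g s = c)" for c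
  have r: "r (g s) \<in> S \<and> g (r (g s)) = g s" if "s \<in> S" for s
    unfolding r_def by (rule someI[of _ s]) (simp add: that)
  then have "\<forall>s\<in>S. \<exists>t\<in>r ` g ` S. sg k (s - t) = 0"
    using * by (metis imageI)
  then show False
    using assms unfolding big_def by blast
qed

text \<open>Finitely many cosets would receive infinitely many rational parameters; two parameters
  in the same coset put a nonzero multiple of w into U_k.\<close>

lemma big_segment:
  assumes w: "sg k w \<noteq> 0" and S: "\<And>q. 0 \<le> q \<Longrightarrow> q \<le> 1 \<Longrightarrow> v + q *s w \<in> S"
  shows "big k S"
  unfolding big_def
proof
  assume "\<exists>T. finite T \<and> (\<forall>s\<in>S. \<exists>t\<in>T. sg k (s - t) = 0)"
  then obtain T where T: "finite T" "\<forall>s\<in>S. \<exists>t\<in>T. sg k (s - t) = 0" by blast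
  then have "\<forall>q\<in>{0..1}. \<exists>t\<in>T. sg k (v + q *s w - t) = 0"
    using S by auto
  then obtain t where t: "\<And>q. q \<in> {0..1} \<Longrightarrow> t q \<in> T \<and> sg k (v + q *s w - t q) = 0"
    by metis
  have "infinite {0..1::rat}" by (simp add: infinite_Icc)
  moreover have "finite (t ` {0..1})"
    by (rule finite_subset[OF _ T(1)]) (use t in auto)
  ultimately obtain q where q: "q \<in> {0..1}" "infinite {p \<in> {0..1}. t p = t q}"
    using pigeonhole_infinite by blast
  then have "\<not> {p \<in> {0..1}. t p = t q} \<subseteq> {q}"
    using finite_subset by blast
  then obtain p where p: "p \<in> {0..1}" "t p = t q" "p \<noteq> q" by blast
  have "sg k ((v + p *s w - t p) - (v + q *s w - t q)) = 0"
    using sg0_diff[OF conjunct2[OF t[OF p(1)]] conjunct2[OF t[OF q(1)]]] .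
  then have "sg k ((p - q) *s w) = 0"
    using p(2) by (simp add: scale_left_diff_distrib)
  then show False
    using sg0_scale_iff[of "p - q" k w] p(3) w by simp
qed

lemma sg_between:
  assumes "sg j v = s" "sg j w = s" "0 \<le> q" "q \<le> 1"
  shows "sg j (v + q *s (w - v)) = s"
proof -
  have *: "\<not> P 0 (r *s u)" if "0 \<le> r" "\<not> P 0 u" for r u
    using that P_scale[of r 0 u] by (cases "r = 0") auto
  have 1: "v - (v + q *s (w - v)) = q *s (v - w)" "v + q *s (w - v) - v = q *s (w - v)"
    "v + q *s (w - v) - w = (1 - q) *s (v - w)" "w - (v + q *s (w - v)) = (1 - q) *s (w - v)"
    by (simp_all add: scale_right_diff_distrib scale_left_diff_distrib)
  have "le v (v + q *s (w - v)) \<and> le (v + q *s (w - v)) w \<or>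
    le w (v + q *s (w - v)) \<and> le (v + q *s (w - v)) v"
    using le_total[of v w] assms(3,4) * unfolding le_def 1 by auto
  then show ?thesis
    using sg_convex[of _ _ _ j 0 s] assms(1,2) by auto
qed

lemma tc_between: "tc v = tc w \<Longrightarrow> 0 \<le> q \<Longrightarrow> q \<le> 1 \<Longrightarrow> tc (v + q *s (w - v)) = tc v"
  using sg_between by (simp add: tc_eq_iff)

text \<open>If \<open>v\<close> and \<open>w\<close> differ by more than \<open>U\<^sub>k\<close>, points strictly between them inherit a margin larger
  than \<open>U\<^sub>k\<close>.\<close>

lemma sg_perturb:
  assumes "sg j v = s" "sg j w = s" "0 < q" "q < 1" "sg k (v - w) \<noteq> 0" "sg k u = 0"
  shows "sg j (v + q *s (w - v) + u) = s"
proof (cases "k \<le> j")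
  case True
  then have "sg j u = 0"
    using assms sg0_mono by blast
  then show ?thesis
    using sg_between[of j v s w q] assms by (simp add: sg_add_null)
next
  case False
  \<comment> \<open>As v - w is not in U_k, one of v and w is above U_k. So is every convex
    combination with positive weights, and adding u from U_k does no harm.\<close>
  have pos: "P j (v + q *s (w - v) + u)"
    if vw: "P j v" "P j w" "sg k (v - w) \<noteq> 0" and u: "sg k u = 0" for v w u
  proof -
    have "\<not> (sg k v = 0 \<and> sg k w = 0)"
      using vw sg0_diff by blast
    then have "P k v \<or> P k w"
      using vw sg_cases[of k v] sg_cases[of k w] P_mono[of j k] False P_asym[of j v] P_asym[of j w]
      by (auto simp: sg_eq_1 sg_eq_m1)
    moreover have "\<not> P k (- ((1 - q) *s v))" "\<not> P k (- (q *s w))"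
      using vw False P_mono[of j k] P_asym[of j] assms(3,4)
        P_scale[of "1 - q" j v] P_scale[of q j w] by auto
    ultimately have "P k ((1 - q) *s v + q *s w)"
      using P_add[of k "(1 - q) *s v" "q *s w"] P_add[of k "q *s w" "(1 - q) *s v"]
        P_scale[of "1 - q" k v] P_scale[of q k w] assms(3,4) by (auto simp: add.commute)
    then have "P k (v + q *s (w - v))"
      by (simp add: scale_right_diff_distrib scale_left_diff_distrib algebra_simps)
    then show ?thesis
      using sg_add_null[OF u, of "v + q *s (w - v)"] P_mono[of j k] False by (metis nle_le sg_eq_1)
  qed
  consider "s = 0" | "s = 1" | "s = - 1"
    using assms(1) sg_cases[of j v] by auto
  then show ?thesis
  proof cases
    case 1
    then show ?thesis
      using assms False sg0_diff[of j v w] sg0_mono[of j k] by auto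
  next
    case 2
    then show ?thesis
      using pos[of v w u] assms by (simp add: sg_eq_1)
  next
    case 3
    have "P j (- v + q *s (- w - - v) + - u)"
      using pos[of "- v" "- w" "- u"] 3 assms sg_minus[of k "v - w"] sg_minus[of k u]
      by (auto simp: sg_eq_m1)
    moreover have "- v + q *s (- w - - v) + - u = - (v + q *s (w - v) + u)"
      by (simp add: scale_right_diff_distrib)
    ultimately have "P j (- (v + q *s (w - v) + u))"
      by metis
    then show ?thesis
      unfolding 3 sg_eq_m1 .
  qed
qed

section \<open>Positions that are stable under perturbation\<close>

lemma sg_down: "sg j v \<noteq> 0 \<Longrightarrow> i \<le> j \<Longrightarrow> sg i v = sg j v"
  using P_mono[of i j v] P_mono[of i j "- v"] P_asym[of i v] by (auto simp: sg_def split: if_splits)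

text \<open>The centroid of three positive vectors is at least f/3. A perturbation by at most f/6
  leaves at least f/6, which is still above U_j.\<close>

lemma sg_robust_pos:
  assumes "P j f" "P k f" "P 0 g" "P 0 h"
  shows "\<exists>d. P k d \<and> (\<forall>w. le (- d) w \<longrightarrow> le w d \<longrightarrow> P j ((1/3) *s (f + g + h) + w))"
proof (intro exI[of _ "(1/6) *s f"] conjI allI impI)
  let ?d = "(1/6) *s f"
  show "P k ?d"
    using assms by (simp add: P_scale)
  fix w assume "le (- ?d) w"
  have "(1/3) *s f = ?d + ?d"
    by (simp flip: scale_left_distrib)
  then have "(1/3) *s (f + g + h) + w - ?d = ((1/3) *s g + (1/3) *s h) + (w - - ?d)"
    by (simp add: scale_right_distrib)
  moreover have "\<not> P 0 (- ((1/3) *s g + (1/3) *s h))"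
    using assms P_add_pos[of 0 "(1/3) *s g" "(1/3) *s h"]
    by (intro P_asym) (simp add: P_scale)
  ultimately have "le ?d ((1/3) *s (f + g + h) + w)"
    using \<open>le (- ?d) w\<close> not_P_add[of 0 "- ((1/3) *s g + (1/3) *s h)" "- (w - - ?d)"]
    unfolding le_def by (metis minus_add_distrib minus_diff_eq)
  then show "P j ((1/3) *s (f + g + h) + w)"
    using P_diff_le[of j ?d] assms by (simp add: P_scale)
qed

text \<open>For signs 1 and -1, one of the three vectors is beyond U_k and
  \<open>sg_robust_pos\<close> applies to it, after a negation if need be. For sign 0 at a level j
  \<le> m all three lie in U_j but not in one coset of U_k, so k < j and any element of U_j above
  U_k is a radius.\<close>

lemma sg_robust:
  assumes f: "sg j f = s" "sg j g = s" "sg j h = s" and ne: "sg k (f - g) \<noteq> 0 \<or> sg k (f - h) \<noteq> 0"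
  shows "\<exists>d. P k d \<and> (\<forall>w. le (- d) w \<longrightarrow> le w d \<longrightarrow> sg j ((1/3) *s (f + g + h) + w) = s)"
proof -
  have km: "k \<le> m" using ne sg_beyond not_less by blast
  have pos: "\<exists>d. P k d \<and> (\<forall>w. le (- d) w \<longrightarrow> le w d \<longrightarrow> P j ((1/3) *s (f + g + h) + w))"
    if P: "P j f" "P j g" "P j h" and ne: "sg k (f - g) \<noteq> 0 \<or> sg k (f - h) \<noteq> 0" for f g h
  proof -
    have P0: "P 0 f" "P 0 g" "P 0 h"
      using P P_mono[of 0 j] by auto
    have "\<not> (sg k f = 0 \<and> sg k g = 0 \<and> sg k h = 0)"
      using ne sg0_diff by blast
    moreover have "sg k x \<noteq> 0 \<Longrightarrow> P k x" if "P 0 x" for x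
      using that P_asym P_mono[of 0 k] by (auto simp: sg_def split: if_splits)
    ultimately consider "P k f" | "P k g" | "P k h"
      using P0 by blast
    then show ?thesis
    proof cases
      case 1
      then show ?thesis using sg_robust_pos[OF P(1) 1 P0(2,3)] by blast
    next
      case 2
      then show ?thesis using sg_robust_pos[OF P(2) 2 P0(1,3)] by (simp add: add.commute)
    next
      case 3
      then show ?thesis using sg_robust_pos[OF P(3) 3 P0(1,2)] by (simp add: ac_simps)
    qed
  qed
  consider "s = 0" "j \<le> m" | "s = 0" "m < j" | "s = 1" | "s = - 1"
    using f(1) sg_cases[of j f] not_less by auto
  then show ?thesis
  proof cases
    case 1
    have "k < j"
    proof (rule ccontr)
      assume "\<not> k < j"
      then have "sg k x = 0" if "sg j x = 0" for x
        using sg0_mono[of j k] that by simp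
      moreover have "sg j (f - g) = 0" "sg j (f - h) = 0"
        using f 1(1) sg0_diff by simp_all
      ultimately show False
        using ne by simp
    qed
    then obtain d where d: "P k d" "\<not> P j d"
      using P_gap 1 by force
    then have "sg j d = 0"
      using P_asym[of k d] P_mono[of k j "- d"] \<open>k < j\<close> by (auto simp: sg_eq_0)
    then have "sg j w = 0" if "le (- d) w" "le w d" for w
      using sg_convex[OF that, of j 0 0] by (simp add: sg_minus)
    moreover have "sg j ((1/3) *s (f + g + h)) = 0"
      using f 1 by (simp add: sg0_scale sg0_add)
    ultimately show ?thesis
      using d 1 sg0_add by blast
  next
    case 2
    then show ?thesis
      using exists_beyond P_mono[OF km] sg_beyond by blast
  next
    case 3
    then show ?thesis using pos[of f g h] f ne by (simp add: sg_eq_1)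
  next
    case 4
    have "sg k (- f - - g) \<noteq> 0 \<or> sg k (- f - - h) \<noteq> 0"
      using ne sg_minus[of k "f - g"] sg_minus[of k "f - h"] by auto
    then obtain d where d: "P k d"
      "\<And>w. le (- d) w \<Longrightarrow> le w d \<Longrightarrow> P j ((1/3) *s (- f + - g + - h) + w)"
      using pos[of "- f" "- g" "- h"] f 4 by (auto simp: sg_eq_m1)
    have "sg j ((1/3) *s (f + g + h) + w) = - 1" if "le (- d) w" "le w d" for w
    proof -
      have "P j ((1/3) *s (- f + - g + - h) + - w)"
        using d(2)[of "- w"] le_minus[OF that(1)] le_minus[OF that(2)] by simp
      moreover have "(1/3) *s (- f + - g + - h) + - w = - ((1/3) *s (f + g + h) + w)"
        by (simp add: scale_right_diff_distrib scale_right_distrib)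
      ultimately show ?thesis by (simp add: sg_eq_m1)
    qed
    then show ?thesis using d(1) 4 by blast
  qed
qed

lemma uniform_radius:
  assumes "finite I" "k \<le> m" and "\<And>i. i \<in> I \<Longrightarrow> \<exists>d. P k d \<and> Q i d"
    and anti: "\<And>i c d. i \<in> I \<Longrightarrow> Q i d \<Longrightarrow> le c d \<Longrightarrow> Q i c"
  shows "\<exists>d. P k d \<and> (\<forall>i\<in>I. Q i d)"
proof (cases "I = {}")
  case True
  then show ?thesis using exists_beyond P_mono[OF assms(2)] by blast
next
  case False
  obtain d where d: "\<And>i. i \<in> I \<Longrightarrow> P k (d i) \<and> Q i (d i)"
    using assms(3) by metis
  obtain i where "i \<in> I" "\<forall>j\<in>I. le (d i) (d j)"
    using le_extremal(2)[OF assms(1) False] by blast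
  then show ?thesis
    using d anti by blast
qed

lemma tc_robust:
  assumes "tc f = tc g" "tc f = tc h" "sg k (f - g) \<noteq> 0 \<or> sg k (f - h) \<noteq> 0"
  shows "\<exists>d. P k d \<and> (\<forall>w. le (- d) w \<longrightarrow> le w d \<longrightarrow> tc ((1/3) *s (f + g + h) + w) = tc f)"
proof -
  have km: "k \<le> m" using assms(3) sg_beyond not_less by blast
  have "\<exists>d. P k d \<and> (\<forall>j\<in>{..m}. \<forall>w. le (- d) w \<longrightarrow> le w d \<longrightarrow>
      sg j ((1/3) *s (f + g + h) + w) = sg j f)"
  proof (rule uniform_radius)
    show "\<exists>d. P k d \<and> (\<forall>w. le (- d) w \<longrightarrow> le w d \<longrightarrow> sg j ((1/3) *s (f + g + h) + w) = sg j f)" for j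
      using assms by (intro sg_robust) (auto simp: tc_eq_iff)
    show "\<forall>w. le (- c) w \<longrightarrow> le w c \<longrightarrow> sg j ((1/3) *s (f + g + h) + w) = sg j f"
      if "\<forall>w. le (- d) w \<longrightarrow> le w d \<longrightarrow> sg j ((1/3) *s (f + g + h) + w) = sg j f" "le c d" for j c d
      using that le_trans le_minus by blast
  qed (use km in auto)
  then obtain d where d: "P k d" "\<And>j w. j \<le> m \<Longrightarrow> le (- d) w \<Longrightarrow> le w d \<Longrightarrow>
      sg j ((1/3) *s (f + g + h) + w) = sg j f"
    by auto
  have "tc ((1/3) *s (f + g + h) + w) = tc f" if "le (- d) w" "le w d" for w
    unfolding tc_eq_iff
  proof
    fix j show "sg j ((1/3) *s (f + g + h) + w) = sg j f"
      using d(2)[OF _ that, of j] by (cases "j \<le> m") (simp_all add: sg_beyond)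
  qed
  then show ?thesis
    using d(1) by blast
qed

section \<open>Plane sets: segments, boxes and the exchange of coordinates\<close>

lemma finite_tc_image: "finite A \<Longrightarrow> finite ((\<lambda>x. \<lambda>p\<in>A. tc (h p x)) ` S)"
  by (rule finite_subset[of _ "PiE A (\<lambda>_. range tc)"]) (auto intro: finite_PiE finite_range_tc)

lemma restrict_eq_iff: "(\<lambda>p\<in>A. f p) = (\<lambda>p\<in>A. g p) \<longleftrightarrow> (\<forall>p\<in>A. f p = g p)"
  by (metis restrict_apply' restrict_ext)

lemma affine_between:
  "\<alpha> *s (y + q *s (y' - y)) + \<beta> *s (z + q *s (z' - z)) + c =
   (\<alpha> *s y + \<beta> *s z + c) + q *s ((\<alpha> *s y' + \<beta> *s z' + c) - (\<alpha> *s y + \<beta> *s z + c))"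
  by (simp add: scale_right_diff_distrib scale_right_distrib algebra_simps)

text \<open>Choose a height over each y. By pigeonhole two of the chosen points are in the same
  position for every form and have first coordinates incongruent modulo U_k. The segment joining
  them stays in Y. It has a large projection to the second axis unless the two heights are
  congruent, and then it can be straightened into a horizontal segment.\<close>

lemma planar_big_projection:
  assumes "planar Y" and big: "big k {y. \<exists>z. Y y z}"
  shows "big k {z. \<exists>y. Y y z} \<or> (\<exists>z. big k {y. Y y z})"
proof -
  obtain A :: "(rat \<times> rat \<times> 'v) set" where A: "finite A" "\<And>y z y' z'.
      (\<And>\<alpha> \<beta> c. (\<alpha>, \<beta>, c) \<in> A \<Longrightarrow> tc (\<alpha> *s y + \<beta> *s z + c) = tc (\<alpha> *s y' + \<beta> *s z' + c)) \<Longrightarrow>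
        Y y z = Y y' z'"
    using planarE[OF assms(1)] by metis
  define f where "f y z p = fst p *s y + fst (snd p) *s z + snd (snd p)"
    for y z and p :: "rat \<times> rat \<times> 'v"
  define z where "z y = (SOME z. Y y z)" for y
  have z: "Y y (z y)" if "y \<in> {y. \<exists>z. Y y z}" for y
    using that unfolding z_def by (auto intro: someI)
  obtain y1 y2 where y: "y1 \<in> {y. \<exists>z. Y y z}" "y2 \<in> {y. \<exists>z. Y y z}" "sg k (y1 - y2) \<noteq> 0"
    "(\<lambda>p\<in>A. tc (f y1 (z y1) p)) = (\<lambda>p\<in>A. tc (f y2 (z y2) p))"
    using big_pigeonhole[OF big finite_tc_image[OF A(1), of "\<lambda>p y. f y (z y) p"]] by blast
  define z1 z2 where "z1 = z y1" and "z2 = z y2"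
  have same: "tc (\<alpha> *s y1 + \<beta> *s z1 + c) = tc (\<alpha> *s y2 + \<beta> *s z2 + c)" if "(\<alpha>, \<beta>, c) \<in> A" for \<alpha> \<beta> c
    using y(4) that by (auto simp: restrict_eq_iff f_def z1_def z2_def)
  have Y1: "Y y1 z1"
    using z y(1) by (simp add: z1_def)
  show ?thesis
  proof (cases "sg k (z2 - z1) = 0")
    case False
    have "Y (y1 + q *s (y2 - y1)) (z1 + q *s (z2 - z1))" if "0 \<le> q" "q \<le> 1" for q
      using A(2)[of "y1 + q *s (y2 - y1)" "z1 + q *s (z2 - z1)" y1 z1] Y1
        tc_between[OF same that] by (simp only: affine_between) 
    then have "big k {z. \<exists>y. Y y z}"
      using False by (intro big_segment[of k "z2 - z1" z1]) auto
    then show ?thesis ..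
  next
    case True
    \<comment> \<open>Replacing the sloping height by the constant height of the midpoint changes it
      by an element of U_k. Forms with \<alpha> = 0 do not see y; the others take incongruent values
      at the two endpoints, so that \<open>sg_perturb\<close> absorbs the change.\<close>
    let ?z = "z1 + (1/2) *s (z2 - z1)"
    have Y: "Y (y1 + q *s (y2 - y1)) ?z" if q: "0 < q" "q < 1" for q
    proof -
      have "tc (\<alpha> *s (y1 + q *s (y2 - y1)) + \<beta> *s ?z + c) = tc (\<alpha> *s y1 + \<beta> *s z1 + c)"
        if "(\<alpha>, \<beta>, c) \<in> A" for \<alpha> \<beta> c
      proof (cases "\<alpha> = 0")
        case True
        then have "\<alpha> *s (y1 + q *s (y2 - y1)) + \<beta> *s ?z + c =
            \<alpha> *s (y1 + (1/2) *s (y2 - y1)) + \<beta> *s ?z + c"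
          by simp
        moreover have "tc (\<alpha> *s (y1 + (1/2) *s (y2 - y1)) + \<beta> *s ?z + c) = tc (\<alpha> *s y1 + \<beta> *s z1 + c)"
          unfolding affine_between by (rule tc_between[OF same[OF that]]) auto
        ultimately show ?thesis by metis
      next
        case False
        let ?f1 = "\<alpha> *s y1 + \<beta> *s z1 + c" and ?f2 = "\<alpha> *s y2 + \<beta> *s z2 + c"
        have 1: "?z = z1 + q *s (z2 - z1) + (1/2 - q) *s (z2 - z1)"
          using scale_left_distrib[of q "1/2 - q" "z2 - z1"] by simp
        have 2: "\<alpha> *s (y1 + q *s (y2 - y1)) + \<beta> *s ?z + c =
            ?f1 + q *s (?f2 - ?f1) + (\<beta> * (1/2 - q)) *s (z2 - z1)"
          unfolding 1 affine_between[symmetric] by (simp add: scale_right_distrib)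
        have "?f1 - ?f2 = \<alpha> *s (y1 - y2) + (- \<beta>) *s (z2 - z1)"
          by (simp add: scale_right_diff_distrib)
        then have "sg k (?f1 - ?f2) \<noteq> 0"
          using sg_add_null[OF sg0_scale[OF True, of "- \<beta>"], of "\<alpha> *s (y1 - y2)"] y(3) False
          by (simp add: sg0_scale_iff)
        then show ?thesis
          unfolding 2 tc_eq_iff using same[OF that] q sg0_scale[OF True]
          by (intro allI sg_perturb) (simp_all only: tc_eq_iff)
      qed
      then show ?thesis using A(2) Y1 by blast
    qed
    \<comment> \<open>Membership is known only for q strictly between 0 and 1, hence the segment
      from 1/4 to 3/4.\<close>
    have "big k {y. Y y ?z}"
    proof (rule big_segment)
      show "sg k ((1/2) *s (y2 - y1)) \<noteq> 0"
        using y(3) sg_minus[of k "y1 - y2"] by (simp add: sg0_scale_iff)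
      fix q :: rat assume "0 \<le> q" "q \<le> 1"
      have "(y1 + (1/4) *s (y2 - y1)) + q *s (1/2) *s (y2 - y1) = y1 + (1/4 + q/2) *s (y2 - y1)"
        by (simp only: scale_left_distrib scale_scale add.assoc) simp
      moreover have "Y (y1 + (1/4 + q/2) *s (y2 - y1)) ?z"
        by (rule Y) (use \<open>0 \<le> q\<close> \<open>q \<le> 1\<close> in auto)
      ultimately show "(y1 + (1/4) *s (y2 - y1)) + q *s (1/2) *s (y2 - y1) \<in> {y. Y y ?z}"
        by (metis mem_Collect_eq)
    qed
    then show ?thesis by blast
  qed
qed

lemma le_scale_nonneg: "0 \<le> q \<Longrightarrow> le v w \<Longrightarrow> le (q *s v) (q *s w)"
  unfolding le_def using P_scale[of q 0 "v - w"]
  by (cases "q = 0") (auto simp flip: scale_right_diff_distrib)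

lemma le_add_mono: "le v w \<Longrightarrow> le v' w' \<Longrightarrow> le (v + v') (w + w')"
  using le_add[of v w v'] le_add[of v' w' w] le_trans by (metis add.commute)

lemma le_scale_abs:
  assumes "le (- d) u" "le u d"
  shows "le (- (\<bar>q\<bar> *s d)) (q *s u)" "le (q *s u) (\<bar>q\<bar> *s d)"
  using le_scale_nonneg[of "\<bar>q\<bar>" "- d" u] le_scale_nonneg[of "\<bar>q\<bar>" u d] assms
    le_minus[of "\<bar>q\<bar> *s u" "\<bar>q\<bar> *s d"] le_minus[of "- (\<bar>q\<bar> *s d)" "\<bar>q\<bar> *s u"]
  by (auto simp: abs_if split: if_splits)

text \<open>Two pigeonholes, within a fibre and across fibres, give three points in the same
  position for every form, spanning a triangle that is nondegenerate modulo U_k. A nonconstant form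
  separates its vertices modulo U_k, so its position is stable around the centroid, and the least of
  finitely many radii gives the box.\<close>

lemma planar_box:
  assumes "planar Y" and big: "big k {y. big k {z. Y y z}}"
  shows "\<exists>y z d. P k d \<and>
    (\<forall>u v. le (- d) u \<longrightarrow> le u d \<longrightarrow> le (- d) v \<longrightarrow> le v d \<longrightarrow> Y (y + u) (z + v))"
proof -
  obtain A :: "(rat \<times> rat \<times> 'v) set" where A: "finite A" "\<And>y z y' z'.
      (\<And>\<alpha> \<beta> c. (\<alpha>, \<beta>, c) \<in> A \<Longrightarrow> tc (\<alpha> *s y + \<beta> *s z + c) = tc (\<alpha> *s y' + \<beta> *s z' + c)) \<Longrightarrow>
        Y y z = Y y' z'"
    using planarE[OF assms(1)] by metis
  define f where "f y z p = fst p *s y + fst (snd p) *s z + snd (snd p)"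
    for y z and p :: "rat \<times> rat \<times> 'v"
  let ?S = "{y. big k {z. Y y z}}"
  have "\<exists>z z'. Y y z \<and> sg k (z - z') \<noteq> 0 \<and> (\<forall>p\<in>A. tc (f y z p) = tc (f y z' p))"
    if "y \<in> ?S" for y
    using big_pigeonhole[OF _ finite_tc_image[OF A(1), of "\<lambda>p z. f y z p"]] that
    unfolding restrict_eq_iff by blast
  then obtain z z' where z: "\<And>y. y \<in> ?S \<Longrightarrow> Y y (z y) \<and> sg k (z y - z' y) \<noteq> 0 \<and>
      (\<forall>p\<in>A. tc (f y (z y) p) = tc (f y (z' y) p))"
    by metis
  obtain y1 y2 where y: "y1 \<in> ?S" "y2 \<in> ?S" "sg k (y1 - y2) \<noteq> 0"
    "\<forall>p\<in>A. tc (f y1 (z y1) p) = tc (f y2 (z y2) p)"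
    using big_pigeonhole[OF big finite_tc_image[OF A(1), of "\<lambda>p y. f y (z y) p"]]
    unfolding restrict_eq_iff by blast
  define f0 f1 f2 where "f0 = f y1 (z y1)" and "f1 = f y1 (z' y1)" and "f2 = f y2 (z y2)"
  \<comment> \<open>The centroid of (y1, z y1), (y1, z' y1) and (y2, z y2).\<close>
  define y0 z0 where "y0 = (1/3) *s (y1 + y1 + y2)" and "z0 = (1/3) *s (z y1 + z' y1 + z y2)"
  have km: "k \<le> m" using y(3) sg_beyond not_less by blast
  have third: "(1/3) *s (c + c + c) = c" for c
    by (simp add: scale_right_distrib flip: scale_left_distrib)
  have f: "f (y0 + u) (z0 + v) p =
      (1/3) *s (f0 p + f1 p + f2 p) + (fst p *s u + fst (snd p) *s v)" for u v p
  proof -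
    have "(1/3) *s (f0 p + f1 p + f2 p) = fst p *s y0 + fst (snd p) *s z0 +
        (1/3) *s (snd (snd p) + snd (snd p) + snd (snd p))"
      by (simp add: f_def f0_def f1_def f2_def y0_def z0_def scale_right_distrib ac_simps)
    then show ?thesis
      unfolding third by (simp add: f_def scale_right_distrib)
  qed
  have "\<exists>d. P k d \<and> (\<forall>p\<in>A. \<forall>u v. le (- d) u \<longrightarrow> le u d \<longrightarrow> le (- d) v \<longrightarrow> le v d \<longrightarrow>
      tc (f (y0 + u) (z0 + v) p) = tc (f0 p))"
  proof (rule uniform_radius)
    fix p assume "p \<in> A"
    have eq: "tc (f0 p) = tc (f1 p)" "tc (f0 p) = tc (f2 p)"
      using \<open>p \<in> A\<close> y z by (simp_all add: f0_def f1_def f2_def)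
    obtain \<alpha> \<beta> c where p: "p = (\<alpha>, \<beta>, c)" by (cases p)
    show "\<exists>d. P k d \<and> (\<forall>u v. le (- d) u \<longrightarrow> le u d \<longrightarrow> le (- d) v \<longrightarrow> le v d \<longrightarrow>
      tc (f (y0 + u) (z0 + v) p) = tc (f0 p))"
    proof (cases "\<alpha> = 0 \<and> \<beta> = 0")
      case True
      then show ?thesis
        using exists_beyond P_mono[OF km] p by (auto simp: f_def f0_def)
    next
      case False
      have "f0 p - f1 p = \<beta> *s (z y1 - z' y1)"
        by (simp add: f_def f0_def f1_def p scale_right_diff_distrib)
      moreover have "f0 p - f2 p = \<alpha> *s (y1 - y2) + \<beta> *s (z y1 - z y2)"
        by (simp add: f_def f0_def f2_def p scale_right_diff_distrib)
      \<comment> \<open>If \<beta> is nonzero, the form differs on the vertical side of the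
        triangle; if \<beta> = 0, then \<alpha> is nonzero and it differs between the two
        fibres.\<close>
      ultimately have "sg k (f0 p - f1 p) \<noteq> 0 \<or> sg k (f0 p - f2 p) \<noteq> 0"
        using False y z by (cases "\<beta> = 0") (simp_all add: sg0_scale_iff)
      then obtain d where d: "P k d"
        "\<And>w. le (- d) w \<Longrightarrow> le w d \<Longrightarrow> tc ((1/3) *s (f0 p + f1 p + f2 p) + w) = tc (f0 p)"
        using tc_robust[OF eq] by blast
      \<comment> \<open>When both coordinates move by at most d divided by this number, the form
        moves by at most d.\<close>
      let ?n = "\<bar>\<alpha>\<bar> + \<bar>\<beta>\<bar>"
      have n: "?n > 0" using False by (auto simp: add_pos_nonneg add_nonneg_pos)
      let ?d = "(1 / ?n) *s d"
      have dd: "\<bar>\<alpha>\<bar> *s ?d + \<bar>\<beta>\<bar> *s ?d = d"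
        using n by (simp flip: scale_left_distrib del: scale_scale) simp
      have "tc (f (y0 + u) (z0 + v) p) = tc (f0 p)"
        if "le (- ?d) u" "le u ?d" "le (- ?d) v" "le v ?d" for u v
      proof -
        have "le (\<alpha> *s u + \<beta> *s v) d"
          using le_add_mono[OF le_scale_abs(2)[OF that(1,2)] le_scale_abs(2)[OF that(3,4)]] dd by metis
        moreover have "- d = - (\<bar>\<alpha>\<bar> *s ?d) + - (\<bar>\<beta>\<bar> *s ?d)"
          using dd by (metis minus_add_distrib)
        then have "le (- d) (\<alpha> *s u + \<beta> *s v)"
          using le_add_mono[OF le_scale_abs(1)[OF that(1,2)] le_scale_abs(1)[OF that(3,4)]] by metis
        ultimately show ?thesis
          unfolding f using d(2) by (simp add: p)
      qed
      then show ?thesis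
        using d(1) n by (intro exI[of _ ?d]) (simp add: P_scale)
    qed
  next
    fix p c d
    assume *: "\<forall>u v. le (- d) u \<longrightarrow> le u d \<longrightarrow> le (- d) v \<longrightarrow> le v d \<longrightarrow>
      tc (f (y0 + u) (z0 + v) p) = tc (f0 p)" and "le c d"
    then have "le (- d) (- c)" using le_minus by blast
    then show "\<forall>u v. le (- c) u \<longrightarrow> le u c \<longrightarrow> le (- c) v \<longrightarrow> le v c \<longrightarrow>
      tc (f (y0 + u) (z0 + v) p) = tc (f0 p)"
      using * \<open>le c d\<close> le_trans by blast
  qed (use A km in auto)
  then obtain d where d: "P k d" "\<And>p u v. p \<in> A \<Longrightarrow> le (- d) u \<Longrightarrow> le u d \<Longrightarrow> le (- d) v \<Longrightarrow>
      le v d \<Longrightarrow> tc (f (y0 + u) (z0 + v) p) = tc (f0 p)"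
    by blast
  have "Y (y0 + u) (z0 + v)" if "le (- d) u" "le u d" "le (- d) v" "le v d" for u v
  proof -
    have "Y (y0 + u) (z0 + v) = Y y1 (z y1)"
      using d(2)[OF _ that] by (intro A(2)) (force simp: f_def f0_def)
    then show ?thesis using z y(1) by blast
  qed
  then show ?thesis
    using d(1) by blast
qed

lemma big_ball:
  assumes "P k d" "\<And>u. le (- d) u \<Longrightarrow> le u d \<Longrightarrow> v + u \<in> S"
  shows "big k S"
proof (rule big_segment[of k d v])
  show "sg k d \<noteq> 0" using assms(1) by (simp add: sg_def)
  have "le 0 d"
    using assms(1) P_mono[of 0 k] P_asym[of 0 d] by (auto simp: le_def)
  then have d: "le (- d) 0"
    using le_minus by fastforce
  fix q :: rat assume "0 \<le> q" "q \<le> 1"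
  have "le (q *s 0) (q *s d)" "le ((1 - q) *s 0) ((1 - q) *s d)"
    using le_scale_nonneg[OF _ \<open>le 0 d\<close>] \<open>0 \<le> q\<close> \<open>q \<le> 1\<close> by auto
  then have "le 0 (q *s d)" "le (q *s d) d"
    by (simp_all add: le_def scale_left_diff_distrib)
  then show "v + q *s d \<in> S"
    using assms(2) le_trans d by blast
qed

text \<open>A box looks the same along both axes.\<close>

lemma planar_big_swap:
  assumes "planar Y" "big k {y. big k {z. Y y z}}"
  shows "big k {z. big k {y. Y y z}}"
proof -
  obtain y z d where d: "P k d" and
    Y: "\<And>u v. le (- d) u \<Longrightarrow> le u d \<Longrightarrow> le (- d) v \<Longrightarrow> le v d \<Longrightarrow> Y (y + u) (z + v)"
    using planar_box[OF assms] by blast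
  show ?thesis
    by (intro big_ball[OF d, of z]) (use Y in \<open>auto intro: big_ball[OF d, of y]\<close>)
qed

text \<open>S plays the part of the positive elements of a definable convex subgroup: as soon as it
  reaches above U_k it exhausts the positive part of U_{k+1}. If it stopped earlier, a point x
  inside S and a point x' outside S could be chosen in U_{k+1} with the same position relative to
  every t in T.\<close>

lemma determined_cut:
  assumes "finite T"
    and det: "\<And>a b. (\<And>t. t \<in> T \<Longrightarrow> tc (a - t) = tc (b - t)) \<Longrightarrow> a \<in> S \<longleftrightarrow> b \<in> S"
    and pos: "\<And>v. v \<in> S \<Longrightarrow> P 0 v"
    and add: "\<And>v w. v \<in> S \<Longrightarrow> w \<in> S \<Longrightarrow> v + w \<in> S"
    and down: "\<And>v w. v \<in> S \<Longrightarrow> P 0 w \<Longrightarrow> le w v \<Longrightarrow> w \<in> S"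
    and s: "s \<in> S" "P k s"
    and b: "P 0 b" "sg (Suc k) b = 0"
  shows "b \<in> S"
proof (rule ccontr)
  assume bS: "b \<notin> S"
  have cut: "le v w" if "v \<in> S" "P 0 w" "w \<notin> S" for v w
    using that down le_total by blast
  \<comment> \<open>\<open>T0\<close> collects the parameters that S has passed, \<open>T1\<close>
    those of U_{k+1} that it has not. Any other parameter lies outside U_{k+1} and cannot
    distinguish elements of U_{k+1}.\<close>
  define T0 where "T0 = {t \<in> T. \<exists>s\<in>S. le t s}"
  define T1 where "T1 = {t \<in> T. sg (Suc k) t = 0 \<and> t \<notin> T0}"
  have "\<exists>x\<in>S. \<forall>t\<in>T0. le t x"
  proof -
    have "\<forall>t\<in>T0. \<exists>s\<in>S. le t s" by (auto simp: T0_def)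
    then obtain h where h: "\<And>t. t \<in> T0 \<Longrightarrow> h t \<in> S \<and> le t (h t)" by metis
    have "finite (insert s (h ` T0))" using assms(1) by (simp add: T0_def)
    then obtain x where "x \<in> insert s (h ` T0)" "\<forall>y\<in>insert s (h ` T0). le y x"
      using le_extremal(1)[of "insert s (h ` T0)" "\<lambda>x. x"] by blast
    then show ?thesis
      using h s(1) le_trans by (metis image_eqI insertE insertI2 imageE)
  qed
  then obtain x0 where x0: "x0 \<in> S" "\<And>t. t \<in> T0 \<Longrightarrow> le t x0" by blast
  \<comment> \<open>The summand s keeps x above all of \<open>T0\<close> by a margin exceeding
    U_k.\<close>
  define x where "x = x0 + s"
  have "x \<in> S" using x0 s add by (simp add: x_def)
  have T1: "P 0 t \<and> t \<notin> S" if "t \<in> T1" for t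
    using that s(1) pos[OF s(1)] le_refl P_diff_le[of 0 s t] le_total[of s t]
    by (auto simp: T1_def T0_def)
  have "finite (insert b T1)" using assms(1) by (simp add: T1_def)
  then obtain c where c: "c \<in> insert b T1" "\<And>t. t \<in> insert b T1 \<Longrightarrow> le c t"
    using le_extremal(2)[of "insert b T1" "\<lambda>x. x"] by blast
  have cS: "P 0 c" "c \<notin> S" "sg (Suc k) c = 0"
    using c(1) T1 b bS by (auto simp: T1_def)
  \<comment> \<open>Half of an element outside S is outside S because S is closed under addition. As
    c is a lower bound of \<open>T1\<close>, the distance from x' to each of its members is at least
    x', which exceeds U_k.\<close>
  define x' where "x' = (1/2) *s c"
  have x'2: "x' + x' = c" by (simp add: x'_def flip: scale_left_distrib)
  then have "x' \<notin> S" using add cS(2) by blast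
  have "P 0 x'" using cS by (simp add: x'_def P_scale)
  then have xx': "le x x'" using cut \<open>x \<in> S\<close> \<open>x' \<notin> S\<close> by blast
  have "le 0 x" using pos[OF \<open>x \<in> S\<close>] P_asym[of 0 x] by (simp add: le_def)
  have "sg (Suc k) x = 0"
    using sg_convex[OF \<open>le 0 x\<close> cut[OF \<open>x \<in> S\<close> b(1) bS], of "Suc k" 0 0] b(2) by simp
  have "sg (Suc k) x' = 0"
    using cS(3) by (simp add: x'_def sg0_scale)
  have "le s x"
    using pos[OF x0(1)] P_asym[of 0 x0] by (simp add: le_def x_def)
  have "P k x'"
    using P_diff_le[OF s(2)] \<open>le s x\<close> xx' le_trans by blast
  have "tc (x - t) = tc (x' - t)" if "t \<in> T" for t
    unfolding tc_eq_iff
  proof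
    fix j
    have above: "sg j (x - t) = sg j (x' - t)" if "Suc k \<le> j"
    proof -
      have "sg j (x - x') = 0"
        using sg0_mono[OF that] \<open>sg (Suc k) x = 0\<close> \<open>sg (Suc k) x' = 0\<close> sg0_diff by blast
      then show ?thesis
        using sg_add_null[of j "x - x'" "x' - t"] by simp
    qed
    consider "Suc k \<le> j" | "j \<le> k" "t \<in> T0" | "j \<le> k" "t \<in> T1" | "j \<le> k" "sg (Suc k) t \<noteq> 0"
      using \<open>t \<in> T\<close> not_less_eq_eq[of j k] by (auto simp: T1_def)
    then show "sg j (x - t) = sg j (x' - t)"
    proof cases
      case 2
      have "le s (x - t)"
        using x0(2)[OF 2(2)] by (simp add: le_def x_def algebra_simps)
      then have "P k (x - t)" "P k (x' - t)"
        using P_diff_le[OF s(2)] le_diff[OF xx'] le_trans by blast+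
      then show ?thesis
        using P_mono[OF 2(1)] by (metis sg_eq_1)
    next
      case 3
      have "le x' (t - x')"
        using c(2)[of t] 3(2) x'2 by (auto simp: le_def algebra_simps)
      moreover have "le (t - x') (t - x)"
        using xx' by (simp add: le_def)
      ultimately have "P k (t - x')" "P k (t - x)"
        using P_diff_le[OF \<open>P k x'\<close>] le_trans by blast+
      then have "P j (- (x' - t))" "P j (- (x - t))"
        using P_mono[OF 3(1)] by auto
      then show ?thesis
        by (metis sg_eq_m1)
    next
      case 4
      have "sg (Suc k) (x - t) = - sg (Suc k) t" "sg (Suc k) (x' - t) = - sg (Suc k) t"
        using sg_add_null[OF \<open>sg (Suc k) x = 0\<close>, of "- t"] sg_add_null[OF \<open>sg (Suc k) x' = 0\<close>, of "- t"]
        by (simp_all add: sg_minus)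
      then show ?thesis
        using sg_down[of "Suc k" _ j] 4 by simp
    qed (use above in auto)
  qed
  then show False
    using det \<open>x \<in> S\<close> \<open>x' \<notin> S\<close> by blast
qed

end

section \<open>Definable sets in arbitrary structures\<close>

lemma eval_tm_fresh:
  "\<exists>K. \<forall>e e'. (\<forall>i<K. e i = e' i) \<longrightarrow> eval_tm M e t = eval_tm M e' t"
proof (induction t)
  case (Var i)
  show ?case by (rule exI[of _ "Suc i"]) auto
next
  case (Fn f ts)
  then obtain K where K: "\<And>t. t \<in> set ts \<Longrightarrow>
      \<forall>e e'. (\<forall>i<K t. e i = e' i) \<longrightarrow> eval_tm M e t = eval_tm M e' t"
    by metis
  have "eval_tm M e (Fn f ts) = eval_tm M e' (Fn f ts)"
    if "\<forall>i<Max (insert 0 (K ` set ts)). e i = e' i" for e e'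
  proof -
    have "eval_tm M e t = eval_tm M e' t" if t: "t \<in> set ts" for t
    proof -
      have "K t \<le> Max (insert 0 (K ` set ts))"
        using t by (intro Max_ge) auto
      then have "i < Max (insert 0 (K ` set ts))" if "i < K t" for i
        using that by (rule order_less_le_trans[rotated])
      then have "\<forall>i<K t. e i = e' i"
        using \<open>\<forall>i<Max (insert 0 (K ` set ts)). e i = e' i\<close> by blast
      then show ?thesis
        using K[OF t] by blast
    qed
    then show ?thesis by (simp cong: map_cong)
  qed
  then show ?case by blast
qed

text \<open>Supplies variables that may be quantified in a larger formula without affecting the
  given one.\<close>

lemma sat_fresh: "\<exists>K. \<forall>e e'. (\<forall>i<K. e i = e' i) \<longrightarrow> sat M e \<phi> = sat M e' \<phi>"
proof (induction \<phi>)
  case (Eq s t)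
  obtain K K' where "\<forall>e e'. (\<forall>i<K. e i = e' i) \<longrightarrow> eval_tm M e s = eval_tm M e' s"
    "\<forall>e e'. (\<forall>i<K'. e i = e' i) \<longrightarrow> eval_tm M e t = eval_tm M e' t"
    using eval_tm_fresh by metis
  then show ?case
    by (intro exI[of _ "max K K'"]) (simp, metis less_max_iff_disj)
next
  case (Rel r ts)

  have "\<exists>K. \<forall>e e'. (\<forall>i<K. e i = e' i) \<longrightarrow> map (eval_tm M e) ts = map (eval_tm M e') ts"
  proof (induction ts)
    case (Cons t ts)
    then obtain K where K: "\<forall>e e'. (\<forall>i<K. e i = e' i) \<longrightarrow> map (eval_tm M e) ts = map (eval_tm M e') ts"
      by blast
    obtain K' where "\<forall>e e'. (\<forall>i<K'. e i = e' i) \<longrightarrow> eval_tm M e t = eval_tm M e' t"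
      using eval_tm_fresh by metis
    with K have "map (eval_tm M e) (t # ts) = map (eval_tm M e') (t # ts)"
      if "\<forall>i<max K K'. e i = e' i" for e e'
      using that by (metis less_max_iff_disj list.simps(9))
    then show ?case by blast
  qed simp
  then obtain K where "\<And>e e'. \<forall>i<K. e i = e' i \<Longrightarrow> map (eval_tm M e) ts = map (eval_tm M e') ts"
    by blast
  then have "\<forall>i<K. e i = e' i \<Longrightarrow> sat M e (Rel r ts) = sat M e' (Rel r ts)" for e e'
    by (metis sat.simps(2))
  then show ?case by blast
next
  case (Neg \<phi>)
  then show ?case by simp
next
  case (Conj \<phi> \<psi>)
  from Conj.IH(1) obtain K where K: "\<forall>e e'. (\<forall>i<K. e i = e' i) \<longrightarrow> sat M e \<phi> = sat M e' \<phi>"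
    by (elim exE)
  from Conj.IH(2) obtain K' where K': "\<forall>e e'. (\<forall>i<K'. e i = e' i) \<longrightarrow> sat M e \<psi> = sat M e' \<psi>"
    by (elim exE)
  have "sat M e (Conj \<phi> \<psi>) = sat M e' (Conj \<phi> \<psi>)" if "\<forall>i<max K K'. e i = e' i" for e e'
  proof -
    have "sat M e \<phi> = sat M e' \<phi>" "sat M e \<psi> = sat M e' \<psi>"
      using that by (intro K[rule_format] K'[rule_format]; simp)+
    then show ?thesis by simp
  qed
  then show ?case by blast
next
  case (Exists x \<phi>)
  then obtain K where K: "\<forall>e e'. (\<forall>i<K. e i = e' i) \<longrightarrow> sat M e \<phi> = sat M e' \<phi>"
    by (elim exE)
  have "sat M (e(x := a)) \<phi> = sat M (e'(x := a)) \<phi>" if "\<forall>i<K. e i = e' i" for e e' a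
    using that by (intro K[rule_format]) auto
  then have "sat M e (Exists x \<phi>) = sat M e' (Exists x \<phi>)" if "\<forall>i<K. e i = e' i" for e e'
    unfolding sat.simps using that by blast
  then show ?case by blast
qed

fun rename_tm :: "(nat \<Rightarrow> nat) \<Rightarrow> 'f tm \<Rightarrow> 'f tm" where
  "rename_tm f (Var i) = Var (f i)"
| "rename_tm f (Fn g ts) = Fn g (map (rename_tm f) ts)"

text \<open>Bound variables are renamed along with the free ones, which preserves the meaning when f
  is injective.\<close>

primrec rename_fm :: "(nat \<Rightarrow> nat) \<Rightarrow> ('f, 'r) fm \<Rightarrow> ('f, 'r) fm" where
  "rename_fm f (Eq s t) = Eq (rename_tm f s) (rename_tm f t)"
| "rename_fm f (Rel r ts) = Rel r (map (rename_tm f) ts)"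
| "rename_fm f (Neg \<phi>) = Neg (rename_fm f \<phi>)"
| "rename_fm f (Conj \<phi> \<psi>) = Conj (rename_fm f \<phi>) (rename_fm f \<psi>)"
| "rename_fm f (Exists x \<phi>) = Exists (f x) (rename_fm f \<phi>)"

lemma wf_rename_tm [simp]: "wf_tm L (rename_tm f t) = wf_tm L t"
  by (induction t) auto

lemma wf_rename_fm [simp]: "wf_fm L (rename_fm f \<phi>) = wf_fm L \<phi>"
  by (induction \<phi>) auto

lemma eval_rename_tm [simp]: "eval_tm M e (rename_tm f t) = eval_tm M (e \<circ> f) t"
  by (induction t) (auto cong: map_cong)

lemma sat_rename_fm: "inj f \<Longrightarrow> sat M e (rename_fm f \<phi>) = sat M (e \<circ> f) \<phi>"
proof (induction \<phi> arbitrary: e)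
  case (Exists x \<phi>)
  have "e(f x := a) \<circ> f = (e \<circ> f)(x := a)" for a
    using Exists.prems by (auto simp: fun_eq_iff inj_eq)
  then show ?case
    using Exists.IH[OF Exists.prems] by (simp only: rename_fm.simps sat.simps)
qed (auto cong: map_cong)

section \<open>Closure properties of definable sets\<close>

lemma tuples_Suc: "xs @ [y] \<in> tuples M (Suc n) \<longleftrightarrow> xs \<in> tuples M n \<and> y \<in> univ M"
  by (auto simp: tuples_def)

lemma tuples_SucE:
  assumes "zs \<in> tuples M (Suc n)"
  obtains xs y where "zs = xs @ [y]" "xs \<in> tuples M n" "y \<in> univ M"
  using assms by (cases zs rule: rev_cases) (auto simp: tuples_def)

lemma butlast_tuples: "X \<subseteq> tuples M (Suc n) \<Longrightarrow> butlast ` X \<subseteq> tuples M n"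
  by (auto simp: tuples_def subset_iff dest: in_set_butlastD)

lemma Def_n_subset: "X \<in> Def_n L M n \<Longrightarrow> X \<subseteq> tuples M n"
  by (auto simp: Def_n_def definable_by_def)

lemma DefI: "X \<in> Def_n L M n \<Longrightarrow> 0 < n \<Longrightarrow> X \<in> Def L M"
  by (auto simp: Def_def)

lemma DefE:
  assumes "X \<in> Def L M"
  obtains n where "0 < n" "X \<in> Def_n L M n"
  using assms by (auto simp: Def_def)

lemma Def_nE:
  assumes "X \<in> Def_n L M n"
  obtains \<phi> e where "wf_fm L \<phi>" "range e \<subseteq> univ M" "X = definable_by M n \<phi> e"
  using assms by (auto simp: Def_n_def)

lemma Def_nI: "wf_fm L \<phi> \<Longrightarrow> range e \<subseteq> univ M \<Longrightarrow> definable_by M n \<phi> e \<in> Def_n L M n"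
  by (auto simp: Def_n_def)

lemma Def_n_compl:
  assumes "X \<in> Def_n L M n"
  shows "tuples M n - X \<in> Def_n L M n"
proof -
  obtain \<phi> e where \<phi>: "wf_fm L \<phi>" "range e \<subseteq> univ M" "X = definable_by M n \<phi> e"
    using assms by (rule Def_nE)
  have "tuples M n - X = definable_by M n (Neg \<phi>) e"
    using \<phi> by (auto simp: definable_by_def)
  then show ?thesis
    using \<phi> by (auto intro: Def_nI)
qed

lemma Def_n_Int:
  assumes "X \<in> Def_n L M n" "Y \<in> Def_n L M n"
  shows "X \<inter> Y \<in> Def_n L M n"
proof -
  obtain \<phi> e where \<phi>: "wf_fm L \<phi>" "range e \<subseteq> univ M" "X = definable_by M n \<phi> e"
    using assms(1) by (rule Def_nE)
  obtain \<psi> e' where \<psi>: "wf_fm L \<psi>" "range e' \<subseteq> univ M" "Y = definable_by M n \<psi> e'"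
    using assms(2) by (rule Def_nE)
  \<comment> \<open>The parameters of the two formulas are moved to the variables of even and odd offset.\<close>
  define f g where "f i = (if i < n then i else n + 2 * (i - n))"
    and "g i = (if i < n then i else n + 2 * (i - n) + 1)" for i :: nat
  define h where "h i = (if even (i - n) then e (n + (i - n) div 2) else e' (n + (i - n) div 2))" for i
  have inj: "inj f" "inj g"
    by (auto simp: inj_def f_def g_def split: if_splits)
  have "(\<lambda>i. if i < n then xs ! i else h i) \<circ> f = (\<lambda>i. if i < n then xs ! i else e i)"
    "(\<lambda>i. if i < n then xs ! i else h i) \<circ> g = (\<lambda>i. if i < n then xs ! i else e' i)" for xs
    by (auto simp: fun_eq_iff f_def g_def h_def)
  then have "X \<inter> Y = definable_by M n (Conj (rename_fm f \<phi>) (rename_fm g \<psi>)) h"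
    using \<phi> \<psi> inj by (auto simp: definable_by_def sat_rename_fm)
  moreover have "range h \<subseteq> univ M"
    using \<phi> \<psi> by (auto simp: h_def)
  ultimately show ?thesis
    using \<phi> \<psi> by (auto intro: Def_nI)
qed

lemma Def_n_Un:
  assumes "X \<in> Def_n L M n" "Y \<in> Def_n L M n"
  shows "X \<union> Y \<in> Def_n L M n"
proof -
  have "X \<union> Y = tuples M n - ((tuples M n - X) \<inter> (tuples M n - Y))"
    using assms Def_n_subset by blast
  then show ?thesis
    using assms by (metis Def_n_Int Def_n_compl)
qed

lemma Def_n_Diff:
  assumes "X \<in> Def_n L M n" "Y \<in> Def_n L M n"
  shows "X - Y \<in> Def_n L M n"
proof -
  have "X - Y = X \<inter> (tuples M n - Y)"
    using assms Def_n_subset by blast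
  then show ?thesis
    using assms by (metis Def_n_Int Def_n_compl)
qed

lemma Def_n_full: "univ M \<noteq> {} \<Longrightarrow> tuples M n \<in> Def_n L M n"
proof -
  assume "univ M \<noteq> {}"
  then obtain a where "a \<in> univ M" by blast
  moreover have "tuples M n = definable_by M n (Eq (Var 0) (Var 0)) (\<lambda>_. a)"
    by (auto simp: definable_by_def)
  ultimately show ?thesis
    by (auto intro!: Def_nI)
qed

lemma Def_n_empty: "univ M \<noteq> {} \<Longrightarrow> {} \<in> Def_n L M n"
  using Def_n_compl[OF Def_n_full] by fastforce

lemma env_snoc:
  "length xs = n \<Longrightarrow> (\<lambda>i. if i < Suc n then (xs @ [y]) ! i else e i) =
     (\<lambda>i. if i < n then xs ! i else e i)(n := y)"
  by (auto simp: fun_eq_iff nth_append less_Suc_eq)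

lemma Def_n_projection:
  assumes "X \<in> Def_n L M (Suc n)"
  shows "butlast ` X \<in> Def_n L M n"
proof -
  obtain \<phi> e where \<phi>: "wf_fm L \<phi>" "range e \<subseteq> univ M" "X = definable_by M (Suc n) \<phi> e"
    using assms by (rule Def_nE)
  have "xs \<in> butlast ` X \<longleftrightarrow> xs \<in> definable_by M n (Exists n \<phi>) e" for xs
  proof -
    have "xs \<in> butlast ` X \<longleftrightarrow> (\<exists>y. xs @ [y] \<in> X)"
      using Def_n_subset[OF assms] by (force elim!: tuples_SucE)
    also have "\<dots> \<longleftrightarrow> xs \<in> tuples M n \<and> (\<exists>y\<in>univ M. sat M ((\<lambda>i. if i < n then xs ! i else e i)(n := y)) \<phi>)"
      using env_snoc[of xs n _ e] unfolding \<phi>(3) definable_by_def mem_Collect_eq tuples_Suc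
      by (auto simp: tuples_def)
    finally show ?thesis
      by (simp add: definable_by_def)
  qed
  then have "butlast ` X = definable_by M n (Exists n \<phi>) e"
    by blast
  then show ?thesis
    using \<phi> by (auto intro: Def_nI)
qed

text \<open>Exchanging the variables 0 and n makes the last coordinate the only remaining one; the
  entries of \<open>xs\<close> turn into parameters.\<close>

lemma Def_n_fibre:
  assumes "X \<in> Def_n L M (Suc n)" "xs \<in> tuples M n"
  shows "fibre X xs \<in> Def_n L M 1"
proof -
  obtain \<phi> e where \<phi>: "wf_fm L \<phi>" "range e \<subseteq> univ M" "X = definable_by M (Suc n) \<phi> e"
    using assms(1) by (rule Def_nE)
  let ?f = "transpose 0 n" and ?h = "\<lambda>i. if i < n then xs ! i else e i"
  have "length xs = n" using assms(2) by (simp add: tuples_def)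
  have *: "(\<lambda>i. if i < 1 then [y] ! i else (?h \<circ> ?f) i) \<circ> ?f = ?h(n := y)" for y
    by (auto simp: fun_eq_iff transpose_def)
  have "range ?h \<subseteq> univ M"
    using assms(2) \<phi>(2) by (auto simp: tuples_def subset_iff)
  then have "range (?h \<circ> ?f) \<subseteq> univ M" by auto
  moreover have "fibre X xs = definable_by M 1 (rename_fm ?f \<phi>) (?h \<circ> ?f)"
  proof (rule Set.set_eqI)
    fix ys
    show "ys \<in> fibre X xs \<longleftrightarrow> ys \<in> definable_by M 1 (rename_fm ?f \<phi>) (?h \<circ> ?f)"
    proof (cases "\<exists>y. ys = [y]")
      case True
      then obtain y where y: "ys = [y]" by blast
      have "ys \<in> fibre X xs \<longleftrightarrow> xs @ [y] \<in> X" by (simp add: fibre_def y)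
      also have "\<dots> \<longleftrightarrow> y \<in> univ M \<and> sat M (?h(n := y)) \<phi>"
        unfolding \<phi>(3) definable_by_def mem_Collect_eq tuples_Suc env_snoc[OF \<open>length xs = n\<close>]
        using assms(2) by simp
      also have "\<dots> \<longleftrightarrow> ys \<in> definable_by M 1 (rename_fm ?f \<phi>) (?h \<circ> ?f)"
        unfolding definable_by_def mem_Collect_eq y sat_rename_fm[OF inj_transpose] *
        by (simp add: tuples_def)
      finally show ?thesis .
    next
      case False
      then show ?thesis
        by (auto simp: fibre_def definable_by_def tuples_def length_Suc_conv)
    qed
  qed
  ultimately show ?thesis
    using Def_nI[of L "rename_fm ?f \<phi>"] \<phi>(1) by (metis wf_rename_fm)
qed

lemma permute_list_inv:
  assumes "\<sigma> permutes {..<length xs}"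
  shows "permute_list (inv_into UNIV \<sigma>) (permute_list \<sigma> xs) = xs" "permute_list \<sigma> (permute_list (inv_into UNIV \<sigma>) xs) = xs"
  using permute_list_compose[of "inv_into UNIV \<sigma>" xs \<sigma>] permute_list_compose[of \<sigma> xs "inv_into UNIV \<sigma>"]
    permutes_inv[OF assms] assms by (simp_all add: permutes_inv_o)

lemma mem_permute_image:
  assumes "X \<subseteq> tuples M n" "\<sigma> permutes {..<n}"
  shows "ys \<in> permute_list \<sigma> ` X \<longleftrightarrow> length ys = n \<and> permute_list (inv_into UNIV \<sigma>) ys \<in> X"
proof
  assume "ys \<in> permute_list \<sigma> ` X"
  then show "length ys = n \<and> permute_list (inv_into UNIV \<sigma>) ys \<in> X"
    using assms permute_list_inv(1)[of \<sigma>] by (force simp: tuples_def)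
next
  assume "length ys = n \<and> permute_list (inv_into UNIV \<sigma>) ys \<in> X"
  then show "ys \<in> permute_list \<sigma> ` X"
    using permute_list_inv(2)[of \<sigma> ys] assms(2) by (metis image_eqI)
qed

lemma Def_n_permute:
  assumes "X \<in> Def_n L M n" "\<sigma> permutes {..<n}"
  shows "permute_list \<sigma> ` X \<in> Def_n L M n"
proof -
  obtain \<phi> e where \<phi>: "wf_fm L \<phi>" "range e \<subseteq> univ M" "X = definable_by M n \<phi> e"
    using assms(1) by (rule Def_nE)
  have inv: "inv_into UNIV \<sigma> permutes {..<n}" using permutes_inv[OF assms(2)] .
  have "permute_list \<sigma> ` X = definable_by M n (rename_fm (inv_into UNIV \<sigma>) \<phi>) e"
  proof (rule Set.set_eqI)
    fix ys
    have *: "(\<lambda>i. if i < n then permute_list (inv_into UNIV \<sigma>) ys ! i else e i) =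
        (\<lambda>i. if i < n then ys ! i else e i) \<circ> inv_into UNIV \<sigma>" if "length ys = n"
      using inv that permutes_in_image[OF inv] permutes_not_in[OF inv]
      by (auto simp: fun_eq_iff permute_list_nth)
    show "ys \<in> permute_list \<sigma> ` X \<longleftrightarrow> ys \<in> definable_by M n (rename_fm (inv_into UNIV \<sigma>) \<phi>) e"
    proof (cases "length ys = n")
      case True
      then have "permute_list (inv_into UNIV \<sigma>) ys \<in> tuples M n \<longleftrightarrow> ys \<in> tuples M n"
        using inv by (auto simp: tuples_def)
      moreover have "ys \<in> permute_list \<sigma> ` X \<longleftrightarrow> permute_list (inv_into UNIV \<sigma>) ys \<in> X"
        using mem_permute_image[OF Def_n_subset[OF assms(1)] assms(2)] True by simp
      ultimately show ?thesis
        unfolding \<phi>(3) definable_by_def mem_Collect_eq sat_rename_fm[OF permutes_inj[OF inv]]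
          *[OF True] by blast
    next
      case False
      then show ?thesis
        unfolding mem_permute_image[OF Def_n_subset[OF assms(1)] assms(2)] definable_by_def
        by (simp add: tuples_def)
    qed
  qed
  then show ?thesis
    using \<phi> by (auto intro: Def_nI)
qed

section \<open>Definable sets in models of the theory\<close>

text \<open>Satisfaction is studied above the model: assignments lift along \<open>ev\<close>, and
  equality in the model becomes congruence modulo U_0.\<close>

locale chain_model = convex_chain scale m P
  for scale :: "rat \<Rightarrow> 'v::ab_group_add \<Rightarrow> 'v" (infixr \<open>*s\<close> 75) and m P +
  fixes M :: "(og_fun, og_rel, 'a) fo_struct" and ev :: "'v \<Rightarrow> 'a"
  assumes ev_range: "range ev = univ M"
    and ev_add [simp]: "ifun M Add [ev v, ev w] = ev (v + w)"
    and ev_less [simp]: "irel M Less [ev v, ev w] \<longleftrightarrow> P 0 (w - v)"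
    and ev_eq: "ev v = ev w \<longleftrightarrow> sg 0 (v - w) = 0"
    and ev_U [simp]: "1 \<le> k \<Longrightarrow> k \<le> m \<Longrightarrow> irel M (U k) [ev v] \<longleftrightarrow> sg k v = 0"
begin

abbreviation "L \<equiv> lang m"
abbreviation "D n \<equiv> Def_n L M n"

lemma ev_in_univ [simp]: "ev v \<in> univ M"
  using ev_range by auto

lemma univ_nonempty [simp]: "univ M \<noteq> {}"
  using ev_in_univ by blast

lemma univE:
  assumes "a \<in> univ M"
  obtains v where "a = ev v"
  using assms ev_range by blast

lemma ev_update: "(ev \<circ> e)(x := ev v) = ev \<circ> (e(x := v))"
  by (simp add: fun_upd_comp)

lemma bex_univ: "(\<exists>a\<in>univ M. Q a) \<longleftrightarrow> (\<exists>v. Q (ev v))"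
  by (simp flip: ev_range)

lemma sat_Exists [simp]: "sat M (ev \<circ> e) (Exists x \<phi>) \<longleftrightarrow> (\<exists>v. sat M (ev \<circ> (e(x := v))) \<phi>)"
  by (simp add: bex_univ ev_update)

declare sat.simps(5) [simp del]

lemma eval_Aff:
  assumes "wf_tm L t"
  shows "\<exists>F\<in>Aff. \<forall>e. eval_tm M (ev \<circ> e) t = ev (F e)"
  using assms
proof (induction t)
  case (Var i)
  show ?case by (rule bexI[OF _ Aff.proj[of i]]) simp
next
  case (Fn f ts)
  then have "f = Add" "length ts = 2" by (auto simp: lang_def)
  then obtain s t where ts: "ts = [s, t]"
    by (auto simp: numeral_2_eq_2 length_Suc_conv)
  from Fn ts obtain F where "F \<in> Aff" "\<forall>e. eval_tm M (ev \<circ> e) s = ev (F e)"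
    by (metis list.set_intros(1) wf_tm.simps(2))
  moreover from Fn ts obtain G where "G \<in> Aff" "\<forall>e. eval_tm M (ev \<circ> e) t = ev (G e)"
    by (metis list.set_intros wf_tm.simps(2))
  ultimately show ?case
    using \<open>f = Add\<close> ts by (intro bexI[OF _ Aff.add[of F G]]) (simp_all del: comp_def comp_apply)
qed

text \<open>Atomic formulas place a single affine form relative to the chain: the difference of the
  two sides for equality and order, the term itself for a predicate. Quantifiers are covered by
  \<open>determined_exists\<close>.\<close>

lemma sat_determined:
  assumes "wf_fm L \<phi>"
  shows "determined (\<lambda>e. sat M (ev \<circ> e) \<phi>)"
  using assms
proof (induction \<phi>)
  case (Eq s t)
  then obtain F G where F: "F \<in> Aff" "\<And>e. eval_tm M (ev \<circ> e) s = ev (F e)"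
    "G \<in> Aff" "\<And>e. eval_tm M (ev \<circ> e) t = ev (G e)"
    using eval_Aff by (metis wf_fm.simps(1))
  show ?case
    by (rule determined_atom[OF Aff_diff[OF F(1,3)]])
       (simp only: sat.simps F ev_eq tc_eq_iff)
next
  case (Rel r ts)
  then consider "r = Less" "length ts = 2" | k where "r = U k" "1 \<le> k" "k \<le> m" "length ts = 1"
    by (auto simp: lang_def)
  then show ?case
  proof cases
    case 1
    then obtain s t where ts: "ts = [s, t]"
      by (auto simp: numeral_2_eq_2 length_Suc_conv)
    then obtain F G where F: "F \<in> Aff" "\<And>e. eval_tm M (ev \<circ> e) s = ev (F e)"
      "G \<in> Aff" "\<And>e. eval_tm M (ev \<circ> e) t = ev (G e)"
      using Rel eval_Aff[of s] eval_Aff[of t] by auto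
    show ?thesis
      by (rule determined_atom[OF Aff_diff[OF F(3,1)]])
         (simp only: F 1 ts sat.simps list.map ev_less, rule P_cong)
  next
    case (2 k)
    then obtain t where ts: "ts = [t]"
      by (auto simp: length_Suc_conv)
    then obtain F where F: "F \<in> Aff" "\<And>e. eval_tm M (ev \<circ> e) t = ev (F e)"
      using Rel eval_Aff[of t] by auto
    show ?thesis
      by (rule determined_atom[OF F(1)])
         (simp only: F ts tc_eq_iff sat.simps list.map 2 ev_U[OF 2(2,3)])
  qed
next
  case (Neg \<phi>)
  then show ?case using determined_not by simp
next
  case (Conj \<phi> \<psi>)
  then show ?case using determined_conj by simp
next
  case (Exists x \<phi>)
  then show ?case
    unfolding sat_Exists wf_fm.simps by (intro determined_exists)
qed

lemma tuples_eq: "tuples M n = {map ev vs | vs. length vs = n}"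
proof (intro Set.set_eqI iffI)
  fix xs assume xs: "xs \<in> tuples M n"
  then have "set xs \<subseteq> range ev" by (simp add: tuples_def ev_range)
  then obtain vs where "xs = map ev vs"
    by (metis ex_map_conv subset_iff rangeE)
  with xs show "xs \<in> {map ev vs | vs. length vs = n}"
    by (auto simp: tuples_def)
qed (auto simp: tuples_def)

lemma tuplesE:
  assumes "xs \<in> tuples M n"
  obtains vs where "xs = map ev vs" "length vs = n"
  using assms unfolding tuples_eq by blast

lemma map_ev_tuples: "map ev vs \<in> tuples M n \<longleftrightarrow> length vs = n"
  by (auto simp: tuples_def)

lemma lift_env:
  assumes "range e \<subseteq> univ M"
  obtains e' where "e = ev \<circ> e'"
proof -
  have "\<forall>i. \<exists>v. e i = ev v"
    using assms ev_range by (metis range_subsetD rangeE)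
  then obtain e' where "\<forall>i. e i = ev (e' i)" by metis
  then show ?thesis by (intro that[of e']) auto
qed

lemma definable_byE:
  assumes "X \<in> D n"
  obtains \<phi> e where "wf_fm L \<phi>"
    "\<forall>vs. length vs = n \<longrightarrow> map ev vs \<in> X \<longleftrightarrow> sat M (ev \<circ> (\<lambda>i. if i < n then vs ! i else e i)) \<phi>"
proof -
  obtain \<phi> e where \<phi>: "wf_fm L \<phi>" "range e \<subseteq> univ M" "X = definable_by M n \<phi> e"
    using assms by (rule Def_nE)
  obtain e' where e': "e = ev \<circ> e'" using lift_env[OF \<phi>(2)] .
  have "(\<lambda>i. if i < n then map ev vs ! i else e i) = ev \<circ> (\<lambda>i. if i < n then vs ! i else e' i)"
    if "length vs = n" for vs
    using that by (auto simp: e')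
  then show ?thesis
    using \<phi> by (intro that[of \<phi> e']) (auto simp: definable_by_def map_ev_tuples)
qed

lemma definableI:
  assumes "X \<subseteq> tuples M n" "wf_fm L \<phi>"
    and "\<And>vs. length vs = n \<Longrightarrow> map ev vs \<in> X \<longleftrightarrow> sat M (ev \<circ> (\<lambda>i. if i < n then vs ! i else e i)) \<phi>"
  shows "X \<in> D n"
proof -
  have eq: "(\<lambda>i. if i < n then map ev vs ! i else (ev \<circ> e) i) = ev \<circ> (\<lambda>i. if i < n then vs ! i else e i)"
    if "length vs = n" for vs
    using that by auto
  have "X = definable_by M n \<phi> (ev \<circ> e)"
  proof (rule Set.set_eqI)
    fix xs
    show "xs \<in> X \<longleftrightarrow> xs \<in> definable_by M n \<phi> (ev \<circ> e)"
    proof (cases "xs \<in> tuples M n")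
      case True
      then obtain vs where vs: "xs = map ev vs" "length vs = n" by (rule tuplesE)
      then show ?thesis
        using assms(3)[OF vs(2)] eq[OF vs(2)] True by (simp add: definable_by_def)
    next
      case False
      then show ?thesis using assms(1) by (auto simp: definable_by_def)
    qed
  qed
  then show ?thesis
    using assms(2) by (auto intro: Def_nI)
qed

lemma unary_determined:
  assumes "X \<in> D 1"
  obtains T where "finite T"
    "\<forall>a b. (\<forall>t\<in>T. tc (a - t) = tc (b - t)) \<longrightarrow> ([ev a] \<in> X \<longleftrightarrow> [ev b] \<in> X)"
proof -
  obtain \<phi> e where \<phi>: "wf_fm L \<phi>"
    "\<forall>vs. length vs = 1 \<longrightarrow> map ev vs \<in> X \<longleftrightarrow> sat M (ev \<circ> (\<lambda>i. if i < 1 then vs ! i else e i)) \<phi>"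
    by (rule definable_byE[OF assms]) (rule that)
  have "(\<lambda>i. if i < 1 then [v] ! i else e i) = e(0 := v)" for v
    by auto
  then have X: "[ev v] \<in> X \<longleftrightarrow> sat M (ev \<circ> e(0 := v)) \<phi>" for v
    using \<phi>(2)[rule_format, of "[v]"] by simp
  show ?thesis
    using determined_unary[OF sat_determined[OF \<phi>(1)], of e 0]
    by (elim exE conjE) (rule that, assumption, simp only: X)
qed

text \<open>g records the positions relative to the finitely many points of T. Its level sets are
  the convex pieces, used both for weak o-minimality and for finding intervals in large
  sets.\<close>

lemma unary_pieces:
  assumes "X \<in> D 1"
  obtains g :: "'v \<Rightarrow> 'v \<Rightarrow> nat \<Rightarrow> int" where "finite (range g)"
    "\<forall>a b. g a = g b \<longrightarrow> ([ev a] \<in> X \<longleftrightarrow> [ev b] \<in> X)"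
    "\<forall>a b c. g a = g c \<longrightarrow> le a b \<longrightarrow> le b c \<longrightarrow> g b = g a"
proof -
  obtain T where T: "finite T"
    "\<forall>a b. (\<forall>t\<in>T. tc (a - t) = tc (b - t)) \<longrightarrow> ([ev a] \<in> X \<longleftrightarrow> [ev b] \<in> X)"
    by (rule unary_determined[OF assms]) (rule that)
  define g where "g a = (\<lambda>t\<in>T. tc (a - t))" for a
  have g: "g a = g b \<longleftrightarrow> (\<forall>t\<in>T. tc (a - t) = tc (b - t))" for a b
    unfolding g_def by (rule restrict_eq_iff)
  show ?thesis
  proof (rule that[of g])
    show "finite (range g)"
      unfolding g_def using finite_tc_image[OF T(1)] .
    show "\<forall>a b. g a = g b \<longrightarrow> ([ev a] \<in> X \<longleftrightarrow> [ev b] \<in> X)"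
      unfolding g by (rule T(2))
    show "\<forall>a b c. g a = g c \<longrightarrow> le a b \<longrightarrow> le b c \<longrightarrow> g b = g a"
      unfolding g tc_eq_iff by (metis sg_convex)
  qed
qed

section \<open>Large fibres and the recursive dimension\<close>

definition fat :: "nat \<Rightarrow> 'a list set \<Rightarrow> bool" where
  "fat k X \<longleftrightarrow> big k {v. [ev v] \<in> X}"

lemma fat_Un: "fat k (X \<union> Y) \<longleftrightarrow> fat k X \<or> fat k Y"
  by (simp add: fat_def Collect_disj_eq big_Un)

lemma not_fat_empty [simp]: "\<not> fat k {}"
  by (simp add: fat_def)

text \<open>Two points of X in one convex piece that are incongruent modulo U_k span an interval
  inside X. The right-hand side, unlike the covering condition, can be written as a formula.\<close>

lemma fat_iff_interval:
  assumes "X \<in> D 1"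
  shows "fat k X \<longleftrightarrow> (\<exists>a b. P k (b - a) \<and> (\<forall>x. le a x \<longrightarrow> le x b \<longrightarrow> [ev x] \<in> X))"
proof
  assume fat: "fat k X"
  obtain g :: "'v \<Rightarrow> 'v \<Rightarrow> nat \<Rightarrow> int" where g: "finite (range g)"
    "\<forall>a b. g a = g b \<longrightarrow> ([ev a] \<in> X \<longleftrightarrow> [ev b] \<in> X)"
    "\<forall>a b c. g a = g c \<longrightarrow> le a b \<longrightarrow> le b c \<longrightarrow> g b = g a"
    by (rule unary_pieces[OF assms]) (rule that)
  have "finite (g ` {v. [ev v] \<in> X})"
    using g(1) by (rule finite_subset[rotated]) auto
  then obtain a b where ab: "[ev a] \<in> X" "[ev b] \<in> X" "g a = g b" "sg k (a - b) \<noteq> 0"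
    using big_pigeonhole fat unfolding fat_def by blast
  then consider "P k (b - a)" | "P k (a - b)"
    by (auto simp: sg_eq_0)
  then show "\<exists>a b. P k (b - a) \<and> (\<forall>x. le a x \<longrightarrow> le x b \<longrightarrow> [ev x] \<in> X)"
  proof cases
    case 1
    then show ?thesis using ab g(2,3) by metis
  next
    case 2
    then show ?thesis using ab g(2,3) by metis
  qed
next
  assume "\<exists>a b. P k (b - a) \<and> (\<forall>x. le a x \<longrightarrow> le x b \<longrightarrow> [ev x] \<in> X)"
  then obtain a b where ab: "P k (b - a)" "\<And>x. le a x \<Longrightarrow> le x b \<Longrightarrow> [ev x] \<in> X" by blast
  have "le 0 (b - a)"
    using ab(1) P_mono[of 0 k] P_asym[of 0 "b - a"] by (auto simp: le_def)
  have "le a (a + q *s (b - a))" "le (a + q *s (b - a)) b" if "0 \<le> q" "q \<le> 1" for q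
    using le_scale_nonneg[OF that(1) \<open>le 0 (b - a)\<close>] le_scale_nonneg[OF _ \<open>le 0 (b - a)\<close>, of "1 - q"] that
    by (simp_all add: le_def scale_left_diff_distrib algebra_simps)
  then have "big k {v. [ev v] \<in> X}"
    using ab by (intro big_segment[of k "b - a" a]) (auto simp: sg_def)
  then show "fat k X" by (simp add: fat_def)
qed

definition fat_base :: "nat \<Rightarrow> 'a list set \<Rightarrow> 'a list set" where
  "fat_base k X = {xs. fat k (fibre X xs)}"

lemma fat_base_subset: "fat_base k X \<subseteq> butlast ` X"
proof
  fix xs assume "xs \<in> fat_base k X"
  then have "fibre X xs \<noteq> {}" by (auto simp: fat_base_def)
  then obtain y where "xs @ [y] \<in> X" by (auto simp: fibre_def)
  then show "xs \<in> butlast ` X" by force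
qed

lemma fat_base_definable:
  assumes X: "X \<in> D (Suc n)" and "k \<le> m"
  shows "fat_base k X \<in> D n"
proof -
  obtain \<phi> e where \<phi>: "wf_fm L \<phi>" "\<forall>vs. length vs = Suc n \<longrightarrow>
      map ev vs \<in> X \<longleftrightarrow> sat M (ev \<circ> (\<lambda>i. if i < Suc n then vs ! i else e i)) \<phi>"
    by (rule definable_byE[OF X]) (rule that)
  obtain K where K: "\<And>e e'. (\<forall>i<K. e i = e' i) \<Longrightarrow> sat M e \<phi> = sat M e' \<phi>"
    using sat_fresh[of M \<phi>] by metis
  \<comment> \<open>The variables A, A + 1 and A + 2 clash neither with the coordinates nor with a
    variable that matters for \<phi>.\<close>
  define A where "A = Suc (max n K)"
  \<comment> \<open>The language has no predicate for U_0 and no subtraction. For k = 0 the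
    inequality of the endpoints says everything; otherwise the variable A + 2 carries their
    difference.\<close>
  define nonU :: og_fm where
    "nonU = (if k = 0 then Eq (Var A) (Var A) else Neg (in_U k (Var (A + 2))))"
  define \<psi> where "\<psi> = Exists A (Exists (A + 1) (Exists (A + 2)
    (Conj (Conj (lt_fm (Var A) (Var (A + 1))) (Eq (Var (A + 1)) (add (Var A) (Var (A + 2)))))
      (Conj nonU
        (Forall n (Imp (Conj (Neg (lt_fm (Var n) (Var A))) (Neg (lt_fm (Var (A + 1)) (Var n)))) \<phi>))))))"
  have "wf_fm L \<psi>"
    using \<phi>(1) \<open>k \<le> m\<close> by (auto simp: \<psi>_def nonU_def lang_def)
  moreover have "map ev vs \<in> fat_base k X \<longleftrightarrow>
      sat M (ev \<circ> (\<lambda>i. if i < n then vs ! i else e i)) \<psi>" if "length vs = n" for vs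
  proof -
    let ?e = "\<lambda>i. if i < n then vs ! i else e i"
    have nA: "n < A" by (simp add: A_def)
    have body: "sat M (ev \<circ> (?e(A := a, A + 1 := b, A + 2 := c, n := x))) \<phi> \<longleftrightarrow>
        [ev x] \<in> fibre X (map ev vs)" for a b c x
    proof -
      have "sat M (ev \<circ> (?e(A := a, A + 1 := b, A + 2 := c, n := x))) \<phi> =
          sat M (ev \<circ> (\<lambda>i. if i < Suc n then (vs @ [x]) ! i else e i)) \<phi>"
        using that by (intro K) (auto simp: A_def nth_append less_Suc_eq)
      then show ?thesis
        using \<phi>(2)[rule_format, of "vs @ [x]"] that by (simp add: fibre_def)
    qed
    have nonU: "P 0 (b - a) \<and> ev b = ev (a + c) \<and>
        sat M (ev \<circ> (?e(A := a, A + 1 := b, A + 2 := c))) nonU \<longleftrightarrow>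
        P k (b - a) \<and> ev b = ev (a + c)" for a b c
    proof (cases "k = 0")
      case True
      then show ?thesis by (auto simp: nonU_def)
    next
      case False
      have *: "sg k c = sg k (b - a)" if "sg 0 (b - (a + c)) = 0"
        using sg_add_null[OF sg0_mono[OF _ that], of k c] by (simp add: algebra_simps)
      have "P k (b - a) \<longleftrightarrow> P 0 (b - a) \<and> sg k (b - a) \<noteq> 0"
        using P_mono[of 0 k "b - a"] P_mono[of 0 k "- (b - a)"] P_asym[of 0 "b - a"]
        by (auto simp: sg_eq_0)
      moreover have "sat M (ev \<circ> (?e(A := a, A + 1 := b, A + 2 := c))) nonU \<longleftrightarrow> sg k c \<noteq> 0"
        using False \<open>k \<le> m\<close> by (simp add: nonU_def)
      ultimately show ?thesis
        using * unfolding ev_eq by metis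
    qed
    have "sat M (ev \<circ> ?e) \<psi> \<longleftrightarrow> (\<exists>a b c. (P 0 (b - a) \<and> ev b = ev (a + c) \<and>
        sat M (ev \<circ> (?e(A := a, A + 1 := b, A + 2 := c))) nonU) \<and>
        (\<forall>x. \<not> P 0 (a - x) \<and> \<not> P 0 (x - b) \<longrightarrow>
          sat M (ev \<circ> (?e(A := a, A + 1 := b, A + 2 := c, n := x))) \<phi>))"
      using nA by (simp add: \<psi>_def conj_assoc) blast
    also have "\<dots> \<longleftrightarrow> (\<exists>a b c. (P k (b - a) \<and> ev b = ev (a + c)) \<and>
        (\<forall>x. le a x \<longrightarrow> le x b \<longrightarrow> [ev x] \<in> fibre X (map ev vs)))"
      unfolding nonU body le_def by blast
    also have "\<dots> \<longleftrightarrow> (\<exists>a b. P k (b - a) \<and> (\<forall>x. le a x \<longrightarrow> le x b \<longrightarrow> [ev x] \<in> fibre X (map ev vs)))"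
      by (metis add.commute diff_add_cancel)
    also have "\<dots> \<longleftrightarrow> map ev vs \<in> fat_base k X"
      using fat_iff_interval[OF Def_n_fibre[OF X, of "map ev vs"]] that
      by (simp add: fat_base_def map_ev_tuples)
    finally show ?thesis ..
  qed
  moreover have "fat_base k X \<subseteq> tuples M n"
    using fat_base_subset butlast_tuples[OF Def_n_subset[OF X]] by blast
  ultimately show ?thesis
    by (intro definableI)
qed

text \<open>The first term uses the whole projection instead of the base points with small fibres.
  The maximum is the same, since points with large fibres count one more in the second term, and
  additivity becomes immediate.\<close>

primrec rdim :: "nat \<Rightarrow> nat \<Rightarrow> 'a list set \<Rightarrow> nat option" where
  "rdim k 0 X = (if X = {} then None else Some 0)"
| "rdim k (Suc n) X = max (rdim k n (butlast ` X)) (map_option Suc (rdim k n (fat_base k X)))"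

lemma map_Suc_max: "map_option Suc (max a b) = max (map_option Suc a) (map_option Suc b)"
  by (cases a; cases b) (auto simp: max_def)

lemma fibre_Un: "fibre (X \<union> Y) xs = fibre X xs \<union> fibre Y xs"
  by (auto simp: fibre_def)

lemma fat_base_Un: "fat_base k (X \<union> Y) = fat_base k X \<union> fat_base k Y"
  by (auto simp: fat_base_def fibre_Un fat_Un)

lemma rdim_Un: "rdim k n (X \<union> Y) = max (rdim k n X) (rdim k n Y)"
proof (induction n arbitrary: X Y)
  case (Suc n)
  then show ?case
    by (simp add: image_Un fat_base_Un map_Suc_max max.assoc max.left_commute)
qed auto

lemma rdim_None_iff: "rdim k n X = None \<longleftrightarrow> X = {}"
proof (induction n arbitrary: X)
  case (Suc n)
  have "max a b = None \<longleftrightarrow> a = None \<and> b = None" for a b :: "nat option"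
    by (cases a; cases b) (auto simp: max_def)
  moreover have "fat_base k {} = {}"
    using fat_base_subset[of k "{}"] by auto
  ultimately show ?case
    using Suc by auto
qed auto

end

section \<open>Dimension functions in arbitrary structures\<close>

lemma mem_butlast_image: "X \<subseteq> tuples M (Suc n) \<Longrightarrow> xs \<in> butlast ` X \<longleftrightarrow> (\<exists>y. xs @ [y] \<in> X)"
  by (force elim!: tuples_SucE)

lemma Def_n_cylinder:
  assumes "B \<in> Def_n L M n"
  shows "{xs \<in> tuples M (Suc n). butlast xs \<in> B} \<in> Def_n L M (Suc n)"
proof -
  obtain \<phi> e where \<phi>: "wf_fm L \<phi>" "range e \<subseteq> univ M" "B = definable_by M n \<phi> e"
    using assms by (rule Def_nE)
  define f where "f i = (if i < n then i else Suc i)" for i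
  have f: "inj f" by (auto simp: inj_def f_def split: if_splits)
  have eq: "(\<lambda>i. if i < Suc n then xs ! i else e (i - 1)) \<circ> f = (\<lambda>i. if i < n then butlast xs ! i else e i)"
    if "length xs = Suc n" for xs
    using that by (auto simp: fun_eq_iff f_def nth_butlast)
  have "butlast xs \<in> tuples M n \<and> length xs = Suc n" if "xs \<in> tuples M (Suc n)" for xs
    using that by (auto simp: tuples_def dest: in_set_butlastD)
  then have "{xs \<in> tuples M (Suc n). butlast xs \<in> B} =
      definable_by M (Suc n) (rename_fm f \<phi>) (\<lambda>i. e (i - 1))"
    unfolding \<phi>(3) definable_by_def sat_rename_fm[OF f] using eq by auto
  moreover have "range (\<lambda>i. e (i - 1)) \<subseteq> univ M"
    using \<phi>(2) by auto
  ultimately show ?thesis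
    using \<phi>(1) Def_nI[of L "rename_fm f \<phi>"] by (metis wf_rename_fm)
qed

lemma Def_n_restrict:
  assumes "X \<in> Def_n L M (Suc n)" "B \<in> Def_n L M n"
  shows "{xs \<in> X. butlast xs \<in> B} \<in> Def_n L M (Suc n)"
proof -
  have "{xs \<in> X. butlast xs \<in> B} = X \<inter> {xs \<in> tuples M (Suc n). butlast xs \<in> B}"
    using Def_n_subset[OF assms(1)] by auto
  then show ?thesis
    using Def_n_Int[OF assms(1) Def_n_cylinder[OF assms(2)]] by simp
qed

lemma Def_n_singleton:
  assumes "a \<in> univ M"
  shows "{[a]} \<in> Def_n L M 1"
proof -
  have "{[a]} = definable_by M 1 (Eq (Var 0) (Var 1)) (\<lambda>_. a)"
    using assms by (auto simp: definable_by_def tuples_def length_Suc_conv)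
  then show ?thesis
    using assms Def_nI[of L "Eq (Var 0) (Var 1)" "\<lambda>_. a" M 1] by auto
qed

locale dimension =
  fixes L :: "('f, 'r) language" and M :: "('f, 'r, 'a) fo_struct" and d :: "'a list set \<Rightarrow> nat option"
  assumes dimension_function: "dimension_function L M d" and nonempty: "univ M \<noteq> {}"
begin

lemma d_empty: "d {} = None"
  and d_singleton: "a \<in> univ M \<Longrightarrow> d {[a]} = Some 0"
  and d_line: "d (tuples M 1) = Some 1"
  and d_extensional: "d \<in> extensional (Def L M)"
  using dimension_function by (simp_all add: dimension_function_def)

lemma d_Un: "X \<in> Def_n L M n \<Longrightarrow> Y \<in> Def_n L M n \<Longrightarrow> 0 < n \<Longrightarrow> d (X \<union> Y) = max (d X) (d Y)"
  using dimension_function by (simp add: dimension_function_def)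

lemma d_permute: "X \<in> Def_n L M n \<Longrightarrow> \<sigma> permutes {..<n} \<Longrightarrow> 0 < n \<Longrightarrow> d (permute_list \<sigma> ` X) = d X"
  using dimension_function by (simp add: dimension_function_def)

lemma d_fibre:
  assumes "X \<in> Def_n L M (Suc n)" "0 < n" "i \<in> {0, 1}"
  shows "fibre_dim_set d X i \<in> Def_n L M n"
    "d {xs \<in> X. butlast xs \<in> fibre_dim_set d X i} = map_option (\<lambda>j. j + i) (d (fibre_dim_set d X i))"
proof -
  have "\<forall>X\<in>Def_n L M (Suc n). \<forall>i\<in>{0, 1}. fibre_dim_set d X i \<in> Def_n L M n \<and>
      d {xs \<in> X. butlast xs \<in> fibre_dim_set d X i} = map_option (\<lambda>j. j + i) (d (fibre_dim_set d X i))"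
    using dimension_function[unfolded dimension_function_def, THEN conjunct2, THEN conjunct2,
        THEN conjunct2, THEN conjunct2, THEN spec, of "Suc n"] assms(2)
    by simp
  then show "fibre_dim_set d X i \<in> Def_n L M n"
    "d {xs \<in> X. butlast xs \<in> fibre_dim_set d X i} = map_option (\<lambda>j. j + i) (d (fibre_dim_set d X i))"
    using assms by blast+
qed

lemma d_mono: "X \<subseteq> Y \<Longrightarrow> X \<in> Def_n L M n \<Longrightarrow> Y \<in> Def_n L M n \<Longrightarrow> 0 < n \<Longrightarrow> d X \<le> d Y"
  using d_Un[of X n Y] by (simp add: sup.absorb2 sup_absorb2) (metis max.cobounded1)

lemma d_unary:
  assumes "X \<in> Def_n L M 1" "X \<noteq> {}"
  shows "d X = Some 0 \<or> d X = Some 1"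
proof -
  obtain a where a: "a \<in> univ M" "[a] \<in> X"
    using assms Def_n_subset[OF assms(1)] by (fastforce simp: tuples_def length_Suc_conv)
  have "Some 0 \<le> d X"
    using d_mono[OF _ Def_n_singleton[OF a(1)] assms(1)] a d_singleton by auto
  moreover have "d X \<le> Some 1"
    using d_mono[OF Def_n_subset[OF assms(1)] assms(1) Def_n_full[OF nonempty]] d_line by simp
  ultimately show ?thesis
    by (cases "d X") auto
qed

lemma d_constant_fibres:
  assumes X: "X \<in> Def_n L M (Suc n)" "0 < n" "i \<in> {0, 1}"
    and fib: "\<And>xs. xs \<in> butlast ` X \<Longrightarrow> d (fibre X xs) = Some i"
  shows "d X = map_option (\<lambda>j. j + i) (d (butlast ` X))"
proof -
  have eq: "fibre_dim_set d X i = butlast ` X"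
    using fib by (auto simp: fibre_dim_set_def)
  have "{xs \<in> X. butlast xs \<in> butlast ` X} = X"
    by auto
  then show ?thesis
    using d_fibre(2)[OF X] by (simp add: eq)
qed

lemma fibre_d_cases:
  assumes "X \<in> Def_n L M (Suc n)" "xs \<in> butlast ` X"
  shows "d (fibre X xs) = Some 0 \<or> d (fibre X xs) = Some 1"
proof (rule d_unary)
  have "butlast ` X \<subseteq> tuples M n"
    using Def_n_subset[OF assms(1)] by (rule butlast_tuples)
  then show "fibre X xs \<in> Def_n L M 1"
    using Def_n_fibre assms by blast
  show "fibre X xs \<noteq> {}"
    using assms mem_butlast_image[OF Def_n_subset[OF assms(1)]] by (auto simp: fibre_def)
qed

lemma d_split:
  assumes X: "X \<in> Def_n L M (Suc n)" "0 < n"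
  shows "d X = max (d (fibre_dim_set d X 0)) (map_option Suc (d (fibre_dim_set d X 1)))"
proof -
  let ?X = "\<lambda>i. {xs \<in> X. butlast xs \<in> fibre_dim_set d X i}"
  have "X = ?X 0 \<union> ?X 1"
    using fibre_d_cases[OF X(1)] by (auto simp: fibre_dim_set_def)
  moreover have "?X 0 \<in> Def_n L M (Suc n)" "?X 1 \<in> Def_n L M (Suc n)"
    using d_fibre(1)[OF X] X by (auto intro!: Def_n_restrict)
  ultimately have "d X = max (d (?X 0)) (d (?X 1))"
    using d_Un[of "?X 0" "Suc n" "?X 1"] by simp
  then show ?thesis
    using d_fibre(2)[OF X, of 0] d_fibre(2)[OF X, of 1] by (simp add: option.map_ident)
qed

end

text \<open>By \<open>d_split\<close>, the value on a set in n + 1 variables depends only on the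
  dimensions of its unary fibres and on values in n variables.\<close>

lemma dimension_function_eqI:
  assumes "dimension L M d" "dimension L M d'"
    and unary: "\<And>X. X \<in> Def_n L M 1 \<Longrightarrow> d X = d' X"
  shows "d = d'"
proof (rule extensionalityI)
  interpret d: dimension L M d by fact
  interpret d': dimension L M d' by fact
  show "d \<in> extensional (Def L M)" "d' \<in> extensional (Def L M)"
    by (rule d.d_extensional d'.d_extensional)+
  have "d X = d' X" if "X \<in> Def_n L M (Suc n)" for n X
    using that
  proof (induction n arbitrary: X)
    case (Suc n)
    have "butlast ` X \<subseteq> tuples M (Suc n)"
      using Def_n_subset[OF Suc.prems] by (rule butlast_tuples)
    then have "d (fibre X xs) = d' (fibre X xs)" if "xs \<in> butlast ` X" for xs
      using that unary Def_n_fibre[OF Suc.prems] by blast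
    then have "fibre_dim_set d X i = fibre_dim_set d' X i" for i
      by (auto simp: fibre_dim_set_def)
    then show ?case
      using d.d_split[OF Suc.prems] d'.d_split[OF Suc.prems]
        Suc.IH[OF d.d_fibre(1)[OF Suc.prems]] by simp
  qed (simp add: unary)
  then show "d X = d' X" if "X \<in> Def L M" for X
    using that by (metis DefE Suc_pred)
qed

section \<open>The dimension function of a convex subgroup\<close>

context chain_model
begin

section \<open>Exchanging the last two coordinates\<close>

lemma planar_flip: "planar Y \<Longrightarrow> planar (\<lambda>z y. Y y z)"
  unfolding planar_def
proof (elim exE conjE)
  fix A :: "(rat \<times> rat \<times> 'v) set"
  assume A: "finite A" "\<forall>y z y' z'. (\<forall>\<alpha> \<beta> c. (\<alpha>, \<beta>, c) \<in> A \<longrightarrow>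
        tc (\<alpha> *s y + \<beta> *s z + c) = tc (\<alpha> *s y' + \<beta> *s z' + c)) \<longrightarrow> Y y z = Y y' z'"
  show "\<exists>A. finite A \<and> (\<forall>y z y' z'. (\<forall>\<alpha> \<beta> c. (\<alpha>, \<beta>, c) \<in> A \<longrightarrow>
        tc (\<alpha> *s y + \<beta> *s z + c) = tc (\<alpha> *s y' + \<beta> *s z' + c)) \<longrightarrow> Y z y = Y z' y')"
  proof (intro exI[of _ "(\<lambda>(\<alpha>, \<beta>, c). (\<beta>, \<alpha>, c)) ` A"] conjI allI impI)
    fix y z y' z'
    assume "\<forall>\<alpha> \<beta> c. (\<alpha>, \<beta>, c) \<in> (\<lambda>(\<alpha>, \<beta>, c). (\<beta>, \<alpha>, c)) ` A \<longrightarrow>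
        tc (\<alpha> *s y + \<beta> *s z + c) = tc (\<alpha> *s y' + \<beta> *s z' + c)"
    then have "tc (\<alpha> *s z + \<beta> *s y + c) = tc (\<alpha> *s z' + \<beta> *s y' + c)" if "(\<alpha>, \<beta>, c) \<in> A" for \<alpha> \<beta> c
      using that by (force simp: add.commute)
    then show "Y z y = Y z' y'"
      using A(2) by blast
  qed (use A in auto)
qed

lemma ex_univ: "(\<And>y. y \<notin> univ M \<Longrightarrow> \<not> Q y) \<Longrightarrow> (\<exists>y. Q y) \<longleftrightarrow> (\<exists>v. Q (ev v))"
  by (metis univE)

lemma fat_Collect: "fat k {[y] | y. Q y} = big k {v. Q (ev v)}"
  by (simp add: fat_def)

lemma fibre_planar:
  assumes "X \<in> D (Suc (Suc n))" "length vs = n"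
  shows "planar (\<lambda>y z. map ev vs @ [ev y, ev z] \<in> X)"
proof -
  obtain \<phi> e where \<phi>: "wf_fm L \<phi>" "\<forall>vs. length vs = Suc (Suc n) \<longrightarrow>
      map ev vs \<in> X \<longleftrightarrow> sat M (ev \<circ> (\<lambda>i. if i < Suc (Suc n) then vs ! i else e i)) \<phi>"
    by (rule definable_byE[OF assms(1)]) (rule that)
  let ?e = "\<lambda>i. if i < n then vs ! i else e i"
  have "map ev vs @ [ev y, ev z] \<in> X \<longleftrightarrow> sat M (ev \<circ> (?e(n := y, Suc n := z))) \<phi>" for y z
  proof -
    have "(\<lambda>i. if i < Suc (Suc n) then (vs @ [y, z]) ! i else e i) = ?e(n := y, Suc n := z)"
      using assms(2) by (auto simp: fun_eq_iff nth_append less_Suc_eq)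
    then show ?thesis
      using \<phi>(2)[rule_format, of "vs @ [y, z]"] assms(2) by simp
  qed
  then show ?thesis
    using determined_binary[OF sat_determined[OF \<phi>(1)], of n "Suc n" ?e] by simp
qed

text \<open>Two steps of the recursion, sorted by what the plane fibre contributes: it is nonempty,
  it has a large projection or a large fibre, or it has a large set of large fibres. In this form
  only plane sets need to be compared.\<close>

lemma rdim_Suc_Suc:
  assumes "X \<subseteq> tuples M (Suc (Suc n))"
  shows "rdim k (Suc (Suc n)) X =
    max (rdim k n {xs. \<exists>y z. xs @ [y, z] \<in> X})
     (max (map_option Suc (rdim k n {xs. fat k {[y] | y. \<exists>z. xs @ [y, z] \<in> X} \<or>
                                         (\<exists>y. fat k {[z] | z. xs @ [y, z] \<in> X})}))
       (map_option Suc (map_option Suc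
         (rdim k n {xs. fat k {[y] | y. fat k {[z] | z. xs @ [y, z] \<in> X}}}))))"
proof -
  note b = butlast_tuples[OF assms]
  have bf: "fat_base k X \<subseteq> tuples M (Suc n)"
    using fat_base_subset b by blast
  have 1: "butlast ` butlast ` X = {xs. \<exists>y z. xs @ [y, z] \<in> X}"
    by (intro Set.set_eqI)
       (simp only: mem_butlast_image[OF b] mem_butlast_image[OF assms] mem_Collect_eq append_assoc append.simps)
  have 2: "fat_base k (butlast ` X) = {xs. fat k {[y] | y. \<exists>z. xs @ [y, z] \<in> X}}"
    using mem_butlast_image[OF assms] by (simp add: fat_base_def fibre_def)
  have 3: "butlast ` fat_base k X = {xs. \<exists>y. fat k {[z] | z. xs @ [y, z] \<in> X}}"
    using mem_butlast_image[OF bf] by (auto simp: fat_base_def fibre_def)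
  have 4: "fat_base k (fat_base k X) = {xs. fat k {[y] | y. fat k {[z] | z. xs @ [y, z] \<in> X}}}"
    by (simp add: fat_base_def fibre_def)
  have "{xs. fat k {[y] | y. \<exists>z. xs @ [y, z] \<in> X} \<or> (\<exists>y. fat k {[z] | z. xs @ [y, z] \<in> X})} =
      fat_base k (butlast ` X) \<union> butlast ` fat_base k X"
    unfolding 2 3 by blast
  then show ?thesis
    by (simp add: 1 4[symmetric] rdim_Un map_Suc_max max.assoc)
qed

text \<open>Each of the three base sets in \<open>rdim_Suc_Suc\<close> is unchanged: the first
  trivially, the second by \<open>planar_big_projection\<close> and the third by
  \<open>planar_big_swap\<close>, each used in both directions.\<close>

lemma rdim_swap_last:
  assumes X: "X \<in> D (Suc (Suc n))" and X': "X' \<subseteq> tuples M (Suc (Suc n))"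
    and swap: "\<And>xs y z. xs @ [y, z] \<in> X' \<longleftrightarrow> xs @ [z, y] \<in> X"
  shows "rdim k (Suc (Suc n)) X' = rdim k (Suc (Suc n)) X"
proof -
  note sub = Def_n_subset[OF X]
  have inner:
    "((fat k {[y] | y. \<exists>z. xs @ [z, y] \<in> X} \<or> (\<exists>y. fat k {[z] | z. xs @ [z, y] \<in> X})) =
      (fat k {[y] | y. \<exists>z. xs @ [y, z] \<in> X} \<or> (\<exists>y. fat k {[z] | z. xs @ [y, z] \<in> X}))) \<and>
     fat k {[y] | y. fat k {[z] | z. xs @ [z, y] \<in> X}} =
      fat k {[y] | y. fat k {[z] | z. xs @ [y, z] \<in> X}}" (is "?A \<and> ?B") for xs
  proof (cases "xs \<in> tuples M n")
    case True
    then obtain vs where vs: "xs = map ev vs" "length vs = n" by (rule tuplesE)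
    define Y where "Y y z \<longleftrightarrow> xs @ [ev y, ev z] \<in> X" for y z
    have Y: "planar Y" "planar (\<lambda>z y. Y y z)"
      using fibre_planar[OF X vs(2)] planar_flip by (simp_all add: Y_def[abs_def] vs)
    have univ: "y \<in> univ M \<and> z \<in> univ M" if "xs @ [y, z] \<in> X" for y z
      using that sub by (auto simp: tuples_def)
    have ex: "(\<exists>z. xs @ [a, z] \<in> X) \<longleftrightarrow> (\<exists>z. xs @ [a, ev z] \<in> X)"
      "(\<exists>z. xs @ [z, a] \<in> X) \<longleftrightarrow> (\<exists>z. xs @ [ev z, a] \<in> X)"
      for a
      using univ univE by metis+
    have exfat: "(\<exists>y. fat k {[z] | z. xs @ [y, z] \<in> X}) \<longleftrightarrow> (\<exists>y. fat k {[z] | z. xs @ [ev y, z] \<in> X})"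
      "(\<exists>y. fat k {[z] | z. xs @ [z, y] \<in> X}) \<longleftrightarrow> (\<exists>y. fat k {[z] | z. xs @ [z, ev y] \<in> X})"
    proof -
      have none: "{[z] | z. xs @ [y, z] \<in> X} = {}" "{[z] | z. xs @ [z, y] \<in> X} = {}" if "y \<notin> univ M" for y
        using univ that by auto
      show "(\<exists>y. fat k {[z] | z. xs @ [y, z] \<in> X}) \<longleftrightarrow> (\<exists>y. fat k {[z] | z. xs @ [ev y, z] \<in> X})"
        by (rule ex_univ) (simp only: none not_fat_empty not_False_eq_True)
      show "(\<exists>y. fat k {[z] | z. xs @ [z, y] \<in> X}) \<longleftrightarrow> (\<exists>y. fat k {[z] | z. xs @ [z, ev y] \<in> X})"
        by (rule ex_univ) (simp only: none not_fat_empty not_False_eq_True)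
    qed
    have mono: "big k {z. Y y z} \<Longrightarrow> big k {z. \<exists>y. Y y z}" "big k {y. Y y z} \<Longrightarrow> big k {y. \<exists>z. Y y z}" for y z
      by (erule big_mono[rotated], blast)+
    have "?A"
      unfolding ex exfat unfolding fat_Collect Y_def[symmetric]
      using planar_big_projection[OF Y(1), of k] planar_big_projection[OF Y(2), of k] mono by blast
    moreover have "?B"
      unfolding fat_Collect Y_def[symmetric]
      using planar_big_swap[OF Y(1), of k] planar_big_swap[OF Y(2), of k] by blast
    ultimately show ?thesis ..
  next
    case False
    have no: "xs @ [y, z] \<notin> X" for y z
    proof
      assume "xs @ [y, z] \<in> X"
      then have "xs @ [y, z] \<in> tuples M (Suc (Suc n))" using sub by blast
      then show False using False by (auto simp: tuples_def)
    qed
    show ?thesis by (simp add: no)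
  qed
  show ?thesis
    unfolding rdim_Suc_Suc[OF sub] rdim_Suc_Suc[OF X'] swap inner[THEN conjunct1] inner[THEN conjunct2]
    by (simp add: ex_comm[of "\<lambda>y z. _ @ [z, y] \<in> X"])
qed

section \<open>From the last exchange to arbitrary permutations\<close>

lemma permute_list_snoc:
  assumes "\<sigma> permutes {..<length xs}"
  shows "permute_list \<sigma> (xs @ [y]) = permute_list \<sigma> xs @ [y]"
  using permutes_in_image[OF assms] permutes_not_in[OF assms, of "length xs"]
  by (auto simp: permute_list_def nth_append)

text \<open>A permutation that fixes the last coordinate commutes with the projection along it and
  with taking the base of large fibres.\<close>

lemma rdim_permute_initial:
  assumes X: "X \<in> D (Suc n)" and "\<sigma> permutes {..<n}" "k \<le> m"
    and IH: "\<And>Y. Y \<in> D n \<Longrightarrow> rdim k n (permute_list \<sigma> ` Y) = rdim k n Y"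
  shows "rdim k (Suc n) (permute_list \<sigma> ` X) = rdim k (Suc n) X"
proof -
  let ?p = "permute_list \<sigma>" and ?q = "permute_list (inv_into UNIV \<sigma>)"
  note sub = Def_n_subset[OF X]
  have len: "length xs = n" if "xs @ [y] \<in> X" for xs y
    using that sub by (auto simp: tuples_def)
  have snoc: "xs @ [y] \<in> ?p ` X \<longleftrightarrow> length xs = n \<and> ?q xs @ [y] \<in> X" for xs y
  proof -
    have "\<sigma> permutes {..<Suc n}"
      using assms(2) by (rule permutes_subset) auto
    then show ?thesis
      unfolding mem_permute_image[OF sub \<open>\<sigma> permutes {..<Suc n}\<close>]
      using permutes_inv[OF assms(2)] by (auto simp: permute_list_snoc)
  qed
  have "\<sigma> permutes {..<Suc n}"
    using assms(2) by (rule permutes_subset) auto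
  then have subp: "?p ` X \<subseteq> tuples M (Suc n)"
    using Def_n_permute[OF X] Def_n_subset by blast
  have "xs \<in> butlast ` ?p ` X \<longleftrightarrow> xs \<in> ?p ` (butlast ` X)" for xs
    unfolding mem_butlast_image[OF subp] snoc
      mem_permute_image[OF Def_n_subset[OF Def_n_projection[OF X]] assms(2)] mem_butlast_image[OF sub]
    by blast
  then have 1: "butlast ` ?p ` X = ?p ` (butlast ` X)" by blast
  have "xs \<in> fat_base k (?p ` X) \<longleftrightarrow> xs \<in> ?p ` fat_base k X" for xs
  proof -
    have "fibre (?p ` X) xs = (if length xs = n then fibre X (?q xs) else {})"
      using snoc by (auto simp: fibre_def)
    then show ?thesis
      unfolding mem_permute_image[OF Def_n_subset[OF fat_base_definable[OF X assms(3)]] assms(2)]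
      by (simp add: fat_base_def)
  qed
  then have 2: "fat_base k (?p ` X) = ?p ` fat_base k X" by blast
  show ?thesis
    by (simp add: 1 2 IH Def_n_projection[OF X] fat_base_definable[OF X assms(3)])
qed

lemma rdim_permute_comp:
  assumes "\<sigma> permutes {..<n}" "\<tau> permutes {..<n}" "X \<in> D n"
    and "\<And>Y. Y \<in> D n \<Longrightarrow> rdim k n (permute_list \<sigma> ` Y) = rdim k n Y"
    and "\<And>Y. Y \<in> D n \<Longrightarrow> rdim k n (permute_list \<tau> ` Y) = rdim k n Y"
  shows "rdim k n (permute_list (\<sigma> \<circ> \<tau>) ` X) = rdim k n X"
proof -
  have "permute_list (\<sigma> \<circ> \<tau>) xs = permute_list \<tau> (permute_list \<sigma> xs)" if "xs \<in> X" for xs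
    using that Def_n_subset[OF assms(3)] assms(2)
    by (intro permute_list_compose) (auto simp: tuples_def)
  then have "permute_list (\<sigma> \<circ> \<tau>) ` X = permute_list \<tau> ` permute_list \<sigma> ` X"
    by (auto simp: image_image)
  then show ?thesis
    using assms Def_n_permute by metis
qed

lemma rdim_transpose:
  assumes "k \<le> m" "X \<in> D n" "a < b" "b < n"
  shows "rdim k n (permute_list (transpose a b) ` X) = rdim k n X"
  using assms(2-)
proof (induction n arbitrary: a b X)
  case (Suc n)
  have perm: "transpose i j permutes {..<l}" if "i < l" "j < l" for i j l :: nat
    using that by (intro permutes_swap_id) auto
  have initial: "rdim k (Suc n) (permute_list (transpose i j) ` Y) = rdim k (Suc n) Y"
    if "i < j" "j < n" "Y \<in> D (Suc n)" for i j Y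
    using that by (intro rdim_permute_initial assms perm Suc.IH) auto
  have last: "rdim k (Suc (Suc l)) (permute_list (transpose l (Suc l)) ` Y) = rdim k (Suc (Suc l)) Y"
    if Y: "Y \<in> D (Suc (Suc l))" for l Y
  proof (rule rdim_swap_last[OF Y])
    have p: "transpose l (Suc l) permutes {..<Suc (Suc l)}" by (rule perm) auto
    show "permute_list (transpose l (Suc l)) ` Y \<subseteq> tuples M (Suc (Suc l))"
      using Def_n_permute[OF Y p] Def_n_subset by blast
    have swap: "permute_list (transpose l (Suc l)) (xs @ [y, z]) = xs @ [z, y]" if "length xs = l" for xs y z
      using that by (intro nth_equalityI)
        (auto simp: permute_list_def nth_append transpose_def less_Suc_eq)
    fix xs y z
    show "xs @ [y, z] \<in> permute_list (transpose l (Suc l)) ` Y \<longleftrightarrow> xs @ [z, y] \<in> Y"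
    proof (cases "length xs = l")
      case True
      then show ?thesis
        using mem_permute_image[OF Def_n_subset[OF Y] p, of "xs @ [y, z]"] swap[OF True]
        by (simp add: inv_unique_comp[OF transpose_comp_involutory transpose_comp_involutory])
    next
      case False
      then show ?thesis
        using mem_permute_image[OF Def_n_subset[OF Y] p, of "xs @ [y, z]"] subsetD[OF Def_n_subset[OF Y], of "xs @ [z, y]"]
        by (auto simp: tuples_def)
    qed
  qed
  consider "b < n" | "b = n" "n = Suc a" | l where "b = n" "n = Suc l" "a < l"
    using Suc.prems by (cases n) (auto simp: less_Suc_eq)
  then show ?case
  proof cases
    case 1
    then show ?thesis using initial Suc.prems by blast
  next
    case 2
    show ?thesis using Suc.prems(1) unfolding 2 by (rule last)
  next
    case (3 l)
    \<comment> \<open>Conjugation reduces to the exchange of the last two coordinates; the outer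
      transposition moves only initial ones.\<close>
    have "transpose a n = transpose a l \<circ> (transpose l n \<circ> transpose a l)"
      using 3 by (auto simp: fun_eq_iff transpose_def)
    moreover have "rdim k (Suc n) (permute_list (transpose a l \<circ> (transpose l n \<circ> transpose a l)) ` X) =
        rdim k (Suc n) X"
      using 3 Suc.prems(1) initial[of a l] last[of _ l]
      by (intro rdim_permute_comp perm permutes_compose) auto
    ultimately show ?thesis by (simp only: 3(1))
  qed
qed simp

lemma rdim_permute:
  assumes "k \<le> m" "\<sigma> permutes {..<n}" "X \<in> D n"
  shows "rdim k n (permute_list \<sigma> ` X) = rdim k n X"
proof -
  have "\<forall>X\<in>D n. rdim k n (permute_list \<sigma> ` X) = rdim k n X"
    using finite_lessThan assms(2)
  proof (induction rule: permutes_rev_induct)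
    case id
    show ?case by simp
  next
    case (swap a b p)
    have "rdim k n (permute_list (transpose a b) ` Y) = rdim k n Y" if "Y \<in> D n" for Y
    proof (cases "a < b")
      case True
      then show ?thesis using rdim_transpose[OF assms(1) that] swap by auto
    next
      case False
      then show ?thesis
        using rdim_transpose[OF assms(1) that, of b a] swap by (simp add: transpose_commute)
    qed
    then show ?case
      by (intro ballI rdim_permute_comp permutes_swap_id) (use swap in auto)
  qed
  then show ?thesis using assms(3) by blast
qed

text \<open>The number of coordinates is read off from any element. The empty set has none, but on
  it \<open>rdim\<close> is \<open>None\<close> for every length.\<close>

definition chain_dim :: "nat \<Rightarrow> 'a list set \<Rightarrow> nat option" where
  "chain_dim k X = (if X \<in> Def L M then rdim k (length (SOME xs. xs \<in> X)) X else undefined)"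

lemma chain_dim_eq: "X \<in> D n \<Longrightarrow> 0 < n \<Longrightarrow> chain_dim k X = rdim k n X"
proof -
  assume X: "X \<in> D n" "0 < n"
  show ?thesis
  proof (cases "X = {}")
    case True
    moreover have "rdim k i {} = None" for i by (simp add: rdim_None_iff)
    ultimately show ?thesis using X by (simp add: chain_dim_def DefI)
  next
    case False
    then have "(SOME xs. xs \<in> X) \<in> X" by (simp add: some_in_eq)
    then have "length (SOME xs. xs \<in> X) = n"
      using Def_n_subset[OF X(1)] by (auto simp: tuples_def)
    then show ?thesis using X by (simp add: chain_dim_def DefI)
  qed
qed

lemma rdim_unary:
  assumes "X \<subseteq> tuples M 1"
  shows "rdim k 1 X = (if X = {} then None else if fat k X then Some 1 else Some 0)"
proof -
  have "fibre X [] = X"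
    using assms by (auto simp: fibre_def tuples_def length_Suc_conv)
  moreover have "fibre X xs = {}" if "xs \<noteq> []" for xs
    using assms that by (auto simp: fibre_def tuples_def)
  ultimately have "fat_base k X = (if fat k X then {[]} else {})"
    unfolding fat_base_def by (auto split: if_splits) (metis not_fat_empty)+
  then show ?thesis by (auto simp: max_def)
qed

lemma chain_dim_unary:
  "X \<in> D 1 \<Longrightarrow> chain_dim k X = (if X = {} then None else if fat k X then Some 1 else Some 0)"
  by (metis chain_dim_eq rdim_unary Def_n_subset zero_less_one)

lemma fibre_dim_set_chain_dim:
  assumes X: "X \<in> D (Suc n)"
  shows "fibre_dim_set (chain_dim k) X 1 = fat_base k X"
    "fibre_dim_set (chain_dim k) X 0 = butlast ` X - fat_base k X"
proof -
  have c: "chain_dim k (fibre X xs) = (if fat k (fibre X xs) then Some 1 else Some 0)"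
    if "xs \<in> butlast ` X" for xs
  proof -
    have "fibre X xs \<in> D 1" "fibre X xs \<noteq> {}"
      using that Def_n_fibre[OF X] butlast_tuples[OF Def_n_subset[OF X]]
        mem_butlast_image[OF Def_n_subset[OF X]] by (auto simp: fibre_def)
    then show ?thesis by (simp add: chain_dim_unary)
  qed
  have f: "xs \<in> butlast ` X" if "fat k (fibre X xs)" for xs
    using that fat_base_subset unfolding fat_base_def by blast
  have "xs \<in> butlast ` X \<and> chain_dim k (fibre X xs) = Some 1 \<longleftrightarrow> fat k (fibre X xs)"
    "xs \<in> butlast ` X \<and> chain_dim k (fibre X xs) = Some 0 \<longleftrightarrow> xs \<in> butlast ` X \<and> \<not> fat k (fibre X xs)"
    for xs
    using c[of xs] f[of xs] by (metis option.inject zero_neq_one)+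
  then show "fibre_dim_set (chain_dim k) X 1 = fat_base k X"
    "fibre_dim_set (chain_dim k) X 0 = butlast ` X - fat_base k X"
    by (simp_all only: fibre_dim_set_def fat_base_def set_diff_eq mem_Collect_eq)
qed

lemma rdim_restrict:
  assumes "X \<subseteq> tuples M (Suc n)" "B \<subseteq> butlast ` X"
  shows "rdim k (Suc n) {xs \<in> X. butlast xs \<in> B} =
    max (rdim k n B) (map_option Suc (rdim k n (fat_base k X \<inter> B)))"
proof -
  have "butlast ` {xs \<in> X. butlast xs \<in> B} = B"
    using assms(2) by auto
  moreover have "fibre {xs \<in> X. butlast xs \<in> B} xs = (if xs \<in> B then fibre X xs else {})" for xs
    by (auto simp: fibre_def)
  then have "fat_base k {xs \<in> X. butlast xs \<in> B} = fat_base k X \<inter> B"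
    by (auto simp: fat_base_def split: if_splits)
  ultimately show ?thesis by simp
qed

lemma big_univ:
  assumes "k \<le> m"
  shows "big k UNIV"
proof -
  obtain w where "P k w"
    using exists_beyond P_mono[OF assms] by blast
  then show ?thesis
    by (intro big_segment[of k w 0]) (auto simp: sg_def)
qed

text \<open>The fibre axiom is the recursion for \<open>rdim\<close> restricted to the base
  \<open>?B\<close>: for i = 0 the second term is empty, for i = 1 it dominates the first. The line
  has dimension 1 because it contains a segment beyond U_k, and a point is covered by one
  coset.\<close>

lemma dimension_function_chain_dim:
  assumes "k \<le> m"
  shows "dimension_function L M (chain_dim k)"
  unfolding dimension_function_def
proof (intro conjI allI impI ballI)
  show "chain_dim k \<in> extensional (Def L M)"
    by (simp add: chain_dim_def extensional_def)
  show "chain_dim k {} = None"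
    using chain_dim_unary[OF Def_n_empty] by simp
  show "chain_dim k {[a]} = Some 0" if "a \<in> univ M" for a
  proof -
    obtain v where v: "a = ev v" using \<open>a \<in> univ M\<close> by (rule univE)
    have "\<not> fat k {[a]}"
      unfolding fat_def big_def using sg0_mono[of 0 k]
      by (auto simp: v ev_eq intro!: exI[of _ "{v}"])
    then show ?thesis
      using chain_dim_unary[OF Def_n_singleton[OF that]] by simp
  qed
  have "fat k (tuples M 1)"
    using big_univ[OF assms] by (simp add: fat_def tuples_def)
  then show "chain_dim k (tuples M 1) = Some 1"
    using chain_dim_unary[OF Def_n_full] by auto
  fix n :: nat assume n: "0 < n"
  show "chain_dim k (X \<union> Y) = max (chain_dim k X) (chain_dim k Y)" if "X \<in> D n" "Y \<in> D n" for X Y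
    using chain_dim_eq[OF Def_n_Un[OF that] n] chain_dim_eq[OF that(1) n] chain_dim_eq[OF that(2) n]
    by (simp only: rdim_Un)
  show "chain_dim k (permute_list \<sigma> ` X) = chain_dim k X" if "X \<in> D n" "\<sigma> permutes {..<n}" for X \<sigma>
    using chain_dim_eq[OF that(1) n] chain_dim_eq[OF Def_n_permute[OF that] n]
      rdim_permute[OF assms that(2,1)] by simp
  fix X i assume "1 < n" and X: "X \<in> D n" and i: "i \<in> {0, 1::nat}"
  then obtain l where l: "n = Suc l" "0 < l" by (cases n) auto
  let ?B = "fibre_dim_set (chain_dim k) X i"
  note X' = X[unfolded l(1)]
  have B: "?B \<in> D l"
    using i fibre_dim_set_chain_dim[OF X', of k] fat_base_definable[OF X' assms]
      Def_n_Diff[OF Def_n_projection[OF X'] fat_base_definable[OF X' assms]] by auto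
  then show "?B \<in> D (n - 1)" by (simp add: l)
  have "?B \<subseteq> butlast ` X" by (auto simp: fibre_dim_set_def)
  have "chain_dim k {xs \<in> X. butlast xs \<in> ?B} =
      max (rdim k l ?B) (map_option Suc (rdim k l (fat_base k X \<inter> ?B)))"
    using chain_dim_eq[OF Def_n_restrict[OF X' B], of k]
      rdim_restrict[OF Def_n_subset[OF X'] \<open>?B \<subseteq> butlast ` X\<close>] by simp
  also have "\<dots> = map_option (\<lambda>j. j + i) (rdim k l ?B)"
  proof (cases "i = 0")
    case True
    then have "fat_base k X \<inter> ?B = {}"
      using fibre_dim_set_chain_dim(2)[OF X'] by auto
    then have "rdim k l (fat_base k X \<inter> ?B) = None"
      by (simp add: rdim_None_iff)
    then show ?thesis
      using True by (cases "rdim k l ?B") auto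
  next
    case False
    then have "i = 1" using i by simp
    then have "fat_base k X \<inter> ?B = ?B"
      using fibre_dim_set_chain_dim(1)[OF X'] by simp
    then show ?thesis
      using \<open>i = 1\<close> by (cases "rdim k l ?B") (auto simp: max_def)
  qed
  finally show "chain_dim k {xs \<in> X. butlast xs \<in> ?B} =
      map_option (\<lambda>j. j + i) (chain_dim k ?B)"
    using chain_dim_eq[OF B l(2)] by simp
qed

section \<open>Weak o-minimality\<close>

lemma dense_linear_order:
  "dense_linear_order_without_endpoints (univ M) (\<lambda>x y. irel M Less [x, y])"
proof -
  obtain w where "P 0 w"
    using exists_beyond P_mono[of 0 m] by blast
  then have "P 0 (v - (v - w))" "P 0 ((v + w) - v)" for v
    by auto
  moreover have "P 0 (w - v)" if "P 0 (u - v)" "P 0 (w - u)" for u v w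
    using P_add_pos[OF that] by simp
  moreover have "P 0 (w - v) \<or> ev v = ev w \<or> P 0 (v - w)" for v w
    by (auto simp: ev_eq sg_eq_0)
  moreover have "\<exists>u. P 0 (u - v) \<and> P 0 (w - u)" if "P 0 (w - v)" for v w
  proof (intro exI conjI)
    have "w - (v + (1/2) *s (w - v)) = (1/2) *s (w - v)"
      using scale_left_distrib[of "1/2" "1/2" "w - v"] by (simp add: algebra_simps)
    then show "P 0 (w - (v + (1/2) *s (w - v)))"
      using that by (simp add: P_scale)
    show "P 0 (v + (1/2) *s (w - v) - v)"
      using that by (simp add: P_scale)
  qed
  ultimately show ?thesis
    unfolding dense_linear_order_without_endpoints_def ev_range[symmetric] ball_simps(9) bex_simps(7) ev_less
    by (simp, blast)
qed

lemma weakly_o_minimal_model: "is_struct L M \<Longrightarrow> weakly_o_minimal L Less M"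
  unfolding weakly_o_minimal_def Let_def
proof (intro conjI ballI)
  show "(Less, 2) \<in> rels L" by (simp add: lang_def)
  show "dense_linear_order_without_endpoints (univ M) (\<lambda>x y. irel M Less [x, y])"
    by (rule dense_linear_order)
  fix X assume X: "X \<in> D 1"
  obtain g :: "'v \<Rightarrow> 'v \<Rightarrow> nat \<Rightarrow> int" where g: "finite (range g)"
    "\<forall>a b. g a = g b \<longrightarrow> ([ev a] \<in> X \<longleftrightarrow> [ev b] \<in> X)"
    "\<forall>a b c. g a = g c \<longrightarrow> le a b \<longrightarrow> le b c \<longrightarrow> g b = g a"
    by (rule unary_pieces[OF X]) (rule that)
  let ?C = "\<lambda>c. ev ` {v. [ev v] \<in> X \<and> g v = c}"
  show "\<exists>\<C>. finite \<C> \<and> (\<forall>C\<in>\<C>. order_convex (univ M) (\<lambda>x y. irel M Less [x, y]) C) \<and>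
      {a. [a] \<in> X} = \<Union>\<C>"
  proof (intro exI conjI ballI)
    show "finite (?C ` range g)" using g(1) by simp
    have "a \<in> range ev" if "[a] \<in> X" for a
      using that Def_n_subset[OF X] by (auto simp: tuples_def ev_range)
    then show "{a. [a] \<in> X} = \<Union> (?C ` range g)"
      by blast
    fix C assume "C \<in> ?C ` range g"
    then obtain c where C: "C = ?C c" by blast
    have "ev b \<in> C" if "[ev u] \<in> X" "g u = c" "g w = c" "P 0 (b - u)" "P 0 (w - b)" for u w b
    proof -
      have "le u b" "le b w"
        using that P_asym[of 0] by (force simp: le_def)+
      then have "g b = g u" using g(3) that by metis
      then show ?thesis using g(2) that C by blast
    qed
    then show "order_convex (univ M) (\<lambda>x y. irel M Less [x, y]) C"
      unfolding order_convex_def by (auto simp: C elim!: univE)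
  qed
qed

end

section \<open>Classification of the dimension functions\<close>

context dimension
begin

lemma d_swap:
  assumes "X \<in> Def_n L M 2" and "X' \<subseteq> tuples M 2" and "\<And>x y. [x, y] \<in> X' \<longleftrightarrow> [y, x] \<in> X"
  shows "X' \<in> Def_n L M 2" "d X' = d X"
proof -
  have p: "transpose 0 1 permutes {..<2::nat}" by (rule permutes_swap_id) auto
  have *: "\<exists>x y. xs = [x, y]" if "xs \<in> tuples M 2" for xs
    using that by (auto simp: tuples_def numeral_2_eq_2 length_Suc_conv)
  have swap: "permute_list (transpose 0 1) [x, y] = [y, x]" for x y :: 'a
    by (simp add: permute_list_def)
  have "xs \<in> permute_list (transpose 0 1) ` X \<longleftrightarrow> xs \<in> X'" for xs
  proof
    assume "xs \<in> permute_list (transpose 0 1) ` X"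
    then obtain ys where ys: "ys \<in> X" "xs = permute_list (transpose 0 1) ys" by blast
    then obtain x y where "ys = [x, y]" using * Def_n_subset[OF assms(1)] by blast
    then show "xs \<in> X'" using ys swap assms(3) by simp
  next
    assume "xs \<in> X'"
    then obtain x y where "xs = [x, y]" using * assms(2) by blast
    then show "xs \<in> permute_list (transpose 0 1) ` X"
      using \<open>xs \<in> X'\<close> swap assms(3) by (metis imageI)
  qed
  then have "X' = permute_list (transpose 0 1) ` X" by blast
  then show "X' \<in> Def_n L M 2" "d X' = d X"
    using Def_n_permute[OF assms(1) p] d_permute[OF assms(1) p] by simp_all
qed

end

locale chain_dimension = chain_model scale m P M ev + dimension "lang m" M d
  for scale :: "rat \<Rightarrow> 'v::ab_group_add \<Rightarrow> 'v" (infixr \<open>*s\<close> 75) and m P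
    and M :: "(og_fun, og_rel, 'a) fo_struct" and ev :: "'v \<Rightarrow> 'a" and d
begin

definition unary_set :: "('v \<Rightarrow> bool) \<Rightarrow> 'a list set" where
  "unary_set Q = {[ev v] | v. Q v}"

definition binary_set :: "('v \<Rightarrow> 'v \<Rightarrow> bool) \<Rightarrow> 'a list set" where
  "binary_set R = {[ev v, ev w] | v w. R v w}"

text \<open>The formula also shows that Q respects congruence modulo U_0, so that membership can be
  tested on any representative.\<close>

lemma unary_set_definable:
  assumes "wf_fm (lang m) \<phi>" and "\<And>v. Q v \<longleftrightarrow> sat M (ev \<circ> (e(0 := v))) \<phi>"
  shows "unary_set Q \<in> D 1" and "[ev v] \<in> unary_set Q \<longleftrightarrow> Q v"
proof -
  have cong: "Q v \<longleftrightarrow> Q w" if "ev v = ev w" for v w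
    using assms(2) that ev_update by metis
  show mem: "[ev v] \<in> unary_set Q \<longleftrightarrow> Q v" for v
  proof
    assume "[ev v] \<in> unary_set Q"
    then obtain v' where "ev v = ev v'" "Q v'"
      by (auto simp: unary_set_def)
    then show "Q v" using cong[of v v'] by blast
  qed (auto simp: unary_set_def)
  show "unary_set Q \<in> D 1"
  proof (rule definableI[OF _ assms(1)])
    show "unary_set Q \<subseteq> tuples M 1"
      by (auto simp: unary_set_def tuples_def)
    fix vs :: "'v list" assume "length vs = 1"
    then obtain v where "vs = [v]" by (auto simp: length_Suc_conv)
    moreover have "(\<lambda>i. if i < 1 then [v] ! i else e i) = e(0 := v)"
      by auto
    ultimately show "map ev vs \<in> unary_set Q \<longleftrightarrow>
        sat M (ev \<circ> (\<lambda>i. if i < 1 then vs ! i else e i)) \<phi>"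
      using mem assms(2) by (simp only: list.map)
  qed
qed

lemma binary_set_definable:
  assumes "wf_fm (lang m) \<phi>" and "\<And>v w. R v w \<longleftrightarrow> sat M (ev \<circ> (e(0 := v, 1 := w))) \<phi>"
  shows "binary_set R \<in> D 2" and "[ev v, ev w] \<in> binary_set R \<longleftrightarrow> R v w"
proof -
  have cong: "R v w \<longleftrightarrow> R v' w'" if "ev v = ev v'" "ev w = ev w'" for v w v' w'
    using assms(2) that ev_update by metis
  show mem: "[ev v, ev w] \<in> binary_set R \<longleftrightarrow> R v w" for v w
  proof
    assume "[ev v, ev w] \<in> binary_set R"
    then obtain v' w' where "ev v = ev v'" "ev w = ev w'" "R v' w'"
      by (auto simp: binary_set_def)
    then show "R v w" using cong[of v v' w w'] by blast
  qed (auto simp: binary_set_def)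
  show "binary_set R \<in> D 2"
  proof (rule definableI[OF _ assms(1)])
    show "binary_set R \<subseteq> tuples M 2"
      by (auto simp: binary_set_def tuples_def)
    fix vs :: "'v list" assume "length vs = 2"
    then obtain v w where "vs = [v, w]"
      by (auto simp: numeral_2_eq_2 length_Suc_conv)
    have "(\<lambda>i. if i < 2 then [v, w] ! i else e i) = e(0 := v, 1 := w)"
      by (auto simp: fun_eq_iff nth_Cons split: nat.split)
    then show "map ev vs \<in> binary_set R \<longleftrightarrow>
        sat M (ev \<circ> (\<lambda>i. if i < 2 then vs ! i else e i)) \<phi>"
      using mem assms(2) by (simp only: \<open>vs = [v, w]\<close> list.map)
  qed
qed

lemma unaryE:
  assumes "X \<in> D 1" "xs \<in> X"
  obtains v where "xs = [ev v]"
proof -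
  have "xs \<in> tuples M 1" using assms Def_n_subset by blast
  then obtain a where "xs = [a]" "a \<in> univ M"
    by (auto simp: tuples_def length_Suc_conv)
  then show ?thesis using that univE by metis
qed

lemma binaryE:
  assumes "X \<subseteq> tuples M 2" "xs \<in> X"
  obtains v w where "xs = [ev v, ev w]"
proof -
  have "xs \<in> tuples M 2" using assms by blast
  then obtain a b where "xs = [a, b]" "a \<in> univ M" "b \<in> univ M"
    by (auto simp: tuples_def numeral_2_eq_2 length_Suc_conv)
  then show ?thesis using that univE by metis
qed

lemma unaryD: "X \<in> D 1 \<Longrightarrow> xs \<in> X \<Longrightarrow> \<exists>v. xs = [ev v]"
  using unaryE by metis

lemma base_singleton: "X \<subseteq> tuples M 2 \<Longrightarrow> xs \<in> butlast ` X \<Longrightarrow> \<exists>v. xs = [ev v]"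
proof -
  assume X: "X \<subseteq> tuples M 2" "xs \<in> butlast ` X"
  then obtain zs where "zs \<in> X" "xs = butlast zs" by blast
  moreover obtain v w where "zs = [ev v, ev w]"
    using X(1) \<open>zs \<in> X\<close> by (rule binaryE)
  ultimately show ?thesis by (intro exI[of _ v]) simp
qed

lemma base_binary:
  assumes "X \<subseteq> tuples M 2"
  shows "[ev v] \<in> butlast ` X \<longleftrightarrow> (\<exists>w. [ev v, ev w] \<in> X)"
proof -
  have "\<exists>w. [ev v, ev w] \<in> X" if "xs \<in> X" "[ev v] = butlast xs" for xs
    using binaryE[OF assms that(1)] that by (metis butlast.simps(2) list.inject list.simps(3))
  then show ?thesis by force
qed

text \<open>The graph of g over X has singleton fibres in both directions. Sliced one way it has the
  dimension of X, sliced the other way that of Y.\<close>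

lemma d_image:
  assumes X: "X \<in> D 1" and graph: "wf_fm (lang m) \<phi>"
      "\<And>v w. ev w = ev (g v) \<longleftrightarrow> sat M (ev \<circ> (e(0 := v, 1 := w))) \<phi>"
    and inj: "\<And>v w. ev (g v) = ev (g w) \<Longrightarrow> ev v = ev w"
    and Y: "Y = {[ev (g v)] | v. [ev v] \<in> X}"
  shows "Y \<in> D 1" "d Y = d X"
proof -
  let ?G = "binary_set (\<lambda>v w. ev w = ev (g v))"
  note G = binary_set_definable[OF graph]
  define Z where "Z = {xs \<in> ?G. butlast xs \<in> X}"
  have Z: "Z \<in> D 2"
    using Def_n_restrict[of ?G _ _ 1 X] G(1) X by (simp add: Z_def numeral_2_eq_2)
  define Z' where "Z' = {[y, x] | x y. [x, y] \<in> Z}"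
  have mem: "[ev v, ev w] \<in> Z \<longleftrightarrow> [ev v] \<in> X \<and> ev w = ev (g v)" for v w
    using G(2) by (auto simp: Z_def)
  note subZ = Def_n_subset[OF Z]
  have subZ': "Z' \<subseteq> tuples M 2"
    using subZ by (auto simp: Z'_def tuples_def)
  have swap: "[x, y] \<in> Z' \<longleftrightarrow> [y, x] \<in> Z" for x y
    by (auto simp: Z'_def)
  note Z' = d_swap[OF Z subZ' swap]
  have "xs \<in> butlast ` Z \<longleftrightarrow> xs \<in> X" for xs
  proof (cases "\<exists>v. xs = [ev v]")
    case True
    then show ?thesis using base_binary[OF subZ] mem by auto
  next
    case False
    then show ?thesis using unaryD[OF X] base_singleton[OF subZ] by blast
  qed
  then have 1: "butlast ` Z = X" by blast
  have "xs \<in> butlast ` Z' \<longleftrightarrow> xs \<in> Y" for xs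
  proof (cases "\<exists>v. xs = [ev v]")
    case True
    then obtain v where v: "xs = [ev v]" by blast
    have "xs \<in> butlast ` Z' \<longleftrightarrow> (\<exists>w. [ev w] \<in> X \<and> ev v = ev (g w))"
      unfolding v base_binary[OF subZ'] swap mem ..
    then show ?thesis by (auto simp: v Y)
  next
    case False
    moreover have "\<exists>v. xs = [ev v]" if "xs \<in> Y" using that by (auto simp: Y)
    ultimately show ?thesis using base_singleton[OF subZ'] by blast
  qed
  then have 2: "butlast ` Z' = Y" by blast
  have "d (fibre Z xs) = Some 0" if xs: "xs \<in> butlast ` Z" for xs
  proof -
    have "xs \<in> X" using xs 1 by simp
    then obtain v where v: "xs = [ev v]" by (rule unaryE[OF X])
    have "fibre Z xs = {[ev (g v)]}"
    proof (intro Set.set_eqI iffI)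
      fix ys assume "ys \<in> fibre Z xs"
      then obtain y where y: "ys = [y]" "[ev v, y] \<in> Z" by (auto simp: fibre_def v)
      then obtain w where "y = ev w" using binaryE[OF subZ y(2)] by auto
      then show "ys \<in> {[ev (g v)]}" using y mem by simp
    qed (use mem xs 1 v in \<open>auto simp: fibre_def\<close>)
    then show ?thesis by (simp add: d_singleton)
  qed
  then have "d Z = d X"
    using d_constant_fibres[of Z 1 0] Z 1 by (simp add: numeral_2_eq_2 option.map_ident)
  have "d (fibre Z' xs) = Some 0" if xs: "xs \<in> butlast ` Z'" for xs
  proof -
    obtain v where v: "[ev v] \<in> X" "xs = [ev (g v)]" using xs 2 by (auto simp: Y)
    have "fibre Z' xs = {[ev v]}"
    proof (intro Set.set_eqI iffI)
      fix ys assume "ys \<in> fibre Z' xs"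
      then obtain y where y: "ys = [y]" "[y, ev (g v)] \<in> Z" by (auto simp: fibre_def v swap)
      then obtain u where "y = ev u" using binaryE[OF subZ y(2)] by auto
      then have "ev (g v) = ev (g u)" using y mem by simp
      then show "ys \<in> {[ev v]}" using y inj[of v u] \<open>y = ev u\<close> by simp
    qed (use mem v in \<open>auto simp: fibre_def swap\<close>)
    then show ?thesis by (simp add: d_singleton)
  qed
  then have "d Z' = d Y"
    using d_constant_fibres[of Z' 1 0] Z'(1) 2 by (simp add: numeral_2_eq_2 option.map_ident)
  then show "d Y = d X"
    using Z'(2) \<open>d Z = d X\<close> by simp
  show "Y \<in> D 1"
    using Def_n_projection[of Z' _ _ 1] Z'(1) 2 by (simp add: numeral_2_eq_2)
qed

lemma d_translate:
  assumes "X \<in> D 1" "Y = {[ev (v + c)] | v. [ev v] \<in> X}"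
  shows "Y \<in> D 1" "d Y = d X"
proof -
  have "wf_fm (lang m) (Eq (Var 1) (add (Var 0) (Var 2)))"
    by (simp add: lang_def)
  moreover have "ev w = ev (v + c) \<longleftrightarrow>
      sat M (ev \<circ> ((\<lambda>_. c)(0 := v, 1 := w))) (Eq (Var 1) (add (Var 0) (Var 2)))" for v w
    by simp
  moreover have "ev v = ev w" if "ev (v + c) = ev (w + c)" for v w
    using that by (simp add: ev_eq)
  ultimately show "Y \<in> D 1" "d Y = d X"
    using d_image[OF assms(1) _ _ _ assms(2)] by blast+
qed

lemma d_negate:
  assumes "X \<in> D 1" "Y = {[ev (- v)] | v. [ev v] \<in> X}"
  shows "Y \<in> D 1" "d Y = d X"
proof -
  have "wf_fm (lang m) (Defs.is_zero (add (Var 0) (Var 1)))"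
    by (simp add: lang_def Defs.is_zero_def)
  moreover have "ev w = ev (- v) \<longleftrightarrow>
      sat M (ev \<circ> ((\<lambda>_. 0)(0 := v, 1 := w))) (Defs.is_zero (add (Var 0) (Var 1)))" for v w
    by (simp add: Defs.is_zero_def ev_eq add.commute)
  moreover have "ev v = ev w" if "ev (- v) = ev (- w)" for v w
    using that sg_minus[of 0 "- v - - w"] by (simp add: ev_eq)
  ultimately show "Y \<in> D 1" "d Y = d X"
    using d_image[OF assms(1) _ _ _ assms(2)] by blast+
qed

lemma d_Un_small:
  "X \<in> D 1 \<Longrightarrow> Y \<in> D 1 \<Longrightarrow> d X \<le> Some 0 \<Longrightarrow> d Y \<le> Some 0 \<Longrightarrow> X \<union> Y \<in> D 1 \<and> d (X \<union> Y) \<le> Some 0"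
  using d_Un[of X 1 Y] by (simp add: Def_n_Un)

lemma d_small_subset: "X \<subseteq> Y \<Longrightarrow> X \<in> D 1 \<Longrightarrow> Y \<in> D 1 \<Longrightarrow> d Y \<le> Some 0 \<Longrightarrow> d X \<le> Some 0"
  using d_mono[of X Y 1] by force

lemma d_unary_eq_0: "X \<in> D 1 \<Longrightarrow> X \<noteq> {} \<Longrightarrow> d X \<le> Some 0 \<Longrightarrow> d X = Some 0"
  using d_unary[of X] by auto

lemma d_small_singleton: "{[ev v]} \<in> D 1" "d {[ev v]} \<le> Some 0"
proof -
  show "{[ev v]} \<in> D 1" by (rule Def_n_singleton) simp
  show "d {[ev v]} \<le> Some 0" by (simp add: d_singleton)
qed

section \<open>The convex subgroup attached to a dimension function\<close>

definition interval :: "'v \<Rightarrow> 'a list set" where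
  "interval b = unary_set (\<lambda>v. P 0 v \<and> P 0 (b - v))"

lemma interval_definable: "interval b \<in> D 1"
  and mem_interval: "[ev v] \<in> interval b \<longleftrightarrow> P 0 v \<and> P 0 (b - v)"
proof -
  have wf: "wf_fm (lang m) (Conj (lt_fm (Var 2) (Var 0)) (lt_fm (Var 0) (Var 1)))"
    by (simp add: lang_def)
  have s: "P 0 v \<and> P 0 (b - v) \<longleftrightarrow> sat M (ev \<circ> ((\<lambda>i. if i = 1 then b else 0)(0 := v)))
      (Conj (lt_fm (Var 2) (Var 0)) (lt_fm (Var 0) (Var 1)))" for v
    by simp
  show "interval b \<in> D 1" "[ev v] \<in> interval b \<longleftrightarrow> P 0 v \<and> P 0 (b - v)"
    using unary_set_definable[OF wf s] by (simp_all only: interval_def)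
qed

lemma half: "P 0 ((1/2) *s b)" "P 0 (b - (1/2) *s b)" if "P 0 b"
proof -
  show "P 0 ((1/2) *s b)" using that by (simp add: P_scale)
  moreover have "b - (1/2) *s b = (1/2) *s b"
    using scale_left_distrib[of "1/2" "1/2" b] by (simp add: algebra_simps)
  ultimately show "P 0 (b - (1/2) *s b)" by simp
qed

lemma interval_nonempty: "P 0 b \<Longrightarrow> interval b \<noteq> {}"
  using mem_interval half by blast

text \<open>The positive part of that convex subgroup, taken in the vector space; for an element
  that is not positive the interval would be empty.\<close>

definition null :: "'v set" where
  "null = {b. P 0 b \<and> d (interval b) = Some 0}"

lemma null_iff: "b \<in> null \<longleftrightarrow> P 0 b \<and> d (interval b) \<le> Some 0"
  using d_unary_eq_0[OF interval_definable interval_nonempty] by (auto simp: null_def)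

lemma null_down:
  assumes "v \<in> null" "P 0 w" "le w v"
  shows "w \<in> null"
proof -
  have "interval w \<subseteq> interval v"
  proof
    fix xs assume xs: "xs \<in> interval w"
    then obtain u where u: "xs = [ev u]" using unaryE[OF interval_definable] by blast
    have "le (w - u) (v - u)" using assms(3) by (rule le_diff)
    then show "xs \<in> interval v"
      using xs P_diff_le by (auto simp: u mem_interval)
  qed
  then show ?thesis
    using assms d_small_subset[OF _ interval_definable interval_definable] by (auto simp: null_iff)
qed

text \<open>The interval (0, v + w) is covered by (0, v), the point v and the translate of (0, w) by
  v.\<close>

lemma null_add:
  assumes "v \<in> null" "w \<in> null"
  shows "v + w \<in> null"
proof -
  let ?T = "{[ev (u + v)] | u. [ev u] \<in> interval w}"
  have "interval (v + w) \<subseteq> interval v \<union> {[ev v]} \<union> ?T"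
  proof
    fix xs assume xs: "xs \<in> interval (v + w)"
    then obtain u where u: "xs = [ev u]" using unaryE[OF interval_definable] by blast
    have pos: "P 0 u" "P 0 (v + w - u)" using xs by (simp_all add: u mem_interval)
    consider "P 0 (v - u)" | "ev u = ev v" | "P 0 (u - v)"
      by (auto simp: ev_eq sg_eq_0)
    then show "xs \<in> interval v \<union> {[ev v]} \<union> ?T"
    proof cases
      case 3
      then have "[ev (u - v)] \<in> interval w"
        using pos(2) by (simp add: mem_interval algebra_simps)
      moreover have "xs = [ev ((u - v) + v)]" by (simp add: u)
      ultimately show ?thesis by blast
    qed (use pos in \<open>auto simp: u mem_interval\<close>)
  qed
  moreover have T: "?T \<in> D 1" "d ?T = d (interval w)"
    using d_translate[OF interval_definable refl] by auto
  moreover have "interval v \<union> {[ev v]} \<in> D 1 \<and> d (interval v \<union> {[ev v]}) \<le> Some 0"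
    using assms d_Un_small[OF interval_definable d_small_singleton(1)] d_small_singleton(2)
    by (simp add: null_iff)
  moreover have "d ?T \<le> Some 0"
    using T(2) assms(2) by (simp add: null_iff)
  ultimately have "interval v \<union> {[ev v]} \<union> ?T \<in> D 1 \<and> d (interval v \<union> {[ev v]} \<union> ?T) \<le> Some 0"
    using d_Un_small T(1) by blast
  moreover note \<open>interval (v + w) \<subseteq> interval v \<union> {[ev v]} \<union> ?T\<close>
  ultimately have "d (interval (v + w)) \<le> Some 0"
    using d_small_subset[OF _ interval_definable] by blast
  then show ?thesis
    using assms P_add_pos by (auto simp: null_iff)
qed

text \<open>Definability is supplied by d itself: by the fibre axiom the set of b over which the
  triangle 0 < v < b has a fibre of dimension 0 is definable.\<close>

lemma null_determined:
  obtains T where "finite T"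
    "\<forall>a b. (\<forall>t\<in>T. tc (a - t) = tc (b - t)) \<longrightarrow> (a \<in> null \<longleftrightarrow> b \<in> null)"
proof -
  define R where "R b v \<longleftrightarrow> P 0 v \<and> P 0 (b - v)" for b v
  let ?\<phi> = "Conj (lt_fm (Var 2) (Var 1)) (lt_fm (Var 1) (Var 0))"
  have wf: "wf_fm (lang m) ?\<phi>"
    by (simp add: lang_def)
  have s: "R b v \<longleftrightarrow> sat M (ev \<circ> ((\<lambda>_. 0)(0 := b, 1 := v))) ?\<phi>" for b v
    by (simp add: R_def)
  note R = binary_set_definable[OF wf s]
  have R1: "binary_set R \<in> D (Suc 1)" using R(1) by (simp add: numeral_2_eq_2)
  have fib: "fibre (binary_set R) [ev b] = interval b" for b
  proof (intro Set.set_eqI iffI)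
    fix xs assume "xs \<in> fibre (binary_set R) [ev b]"
    then obtain y where y: "xs = [y]" "[ev b, y] \<in> binary_set R" by (auto simp: fibre_def)
    then obtain v where "y = ev v" using binaryE[OF Def_n_subset[OF R(1)] y(2)] by auto
    then show "xs \<in> interval b" using y R(2) by (simp add: mem_interval R_def)
  next
    fix xs assume xs: "xs \<in> interval b"
    then obtain v where v: "xs = [ev v]" using unaryE[OF interval_definable] by blast
    then show "xs \<in> fibre (binary_set R) [ev b]"
      using xs R(2)[of b v] by (simp add: fibre_def mem_interval R_def[symmetric])
  qed
  have "[ev b] \<in> fibre_dim_set d (binary_set R) 0 \<longleftrightarrow> b \<in> null" for b
  proof -
    have "[ev b] \<in> butlast ` binary_set R \<longleftrightarrow> P 0 b"
      unfolding base_binary[OF Def_n_subset[OF R(1)]] R(2) unfolding R_def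
      using half P_add_pos[of 0 "b - _"] by (metis diff_add_cancel)
    then show ?thesis by (simp add: fibre_dim_set_def fib null_def)
  qed
  moreover have "fibre_dim_set d (binary_set R) 0 \<in> D 1"
    using d_fibre(1)[OF R1] by simp
  then obtain T where "finite T" "\<forall>a b. (\<forall>t\<in>T. tc (a - t) = tc (b - t)) \<longrightarrow>
      ([ev a] \<in> fibre_dim_set d (binary_set R) 0 \<longleftrightarrow> [ev b] \<in> fibre_dim_set d (binary_set R) 0)"
    by (rule unary_determined) (rule that)
  ultimately show ?thesis using that by simp
qed

text \<open>All levels under one formula: U_0 through the equation x + x = x, and the levels beyond
  m through a tautology.\<close>

definition subgroup_fm :: "nat \<Rightarrow> og_fun tm \<Rightarrow> og_fm" where
  "subgroup_fm k t = (if k = 0 then Defs.is_zero t else if k \<le> m then in_U k t else whole t)"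

lemma sat_subgroup_fm:
  "eval_tm M (ev \<circ> e) t = ev v \<Longrightarrow> sat M (ev \<circ> e) (subgroup_fm k t) \<longleftrightarrow> sg k v = 0"
  by (simp add: subgroup_fm_def Defs.is_zero_def ev_eq sg_beyond)

lemma wf_subgroup_fm: "wf_tm (lang m) t \<Longrightarrow> wf_fm (lang m) (subgroup_fm k t)"
  by (auto simp: subgroup_fm_def Defs.is_zero_def lang_def)

definition subgroup_set :: "nat \<Rightarrow> 'a list set" where
  "subgroup_set k = unary_set (\<lambda>v. sg k v = 0)"

lemma subgroup_definable: "subgroup_set k \<in> D 1"
  and mem_subgroup: "[ev v] \<in> subgroup_set k \<longleftrightarrow> sg k v = 0"
proof -
  have wf: "wf_fm (lang m) (subgroup_fm k (Var 0))"
    by (rule wf_subgroup_fm) simp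
  have s: "sg k v = 0 \<longleftrightarrow> sat M (ev \<circ> ((\<lambda>_. 0)(0 := v))) (subgroup_fm k (Var 0))" for v
    using sat_subgroup_fm[of "(\<lambda>_. 0)(0 := v)" "Var 0" v k] by simp
  show "subgroup_set k \<in> D 1" "[ev v] \<in> subgroup_set k \<longleftrightarrow> sg k v = 0"
    using unary_set_definable[OF wf s] by (simp_all only: subgroup_set_def)
qed

definition positive_part :: "nat \<Rightarrow> 'a list set" where
  "positive_part k = unary_set (\<lambda>v. P 0 v \<and> sg k v = 0)"

lemma positive_part_definable: "positive_part k \<in> D 1"
  and mem_positive_part: "[ev v] \<in> positive_part k \<longleftrightarrow> P 0 v \<and> sg k v = 0"
proof -
  let ?\<phi> = "Conj (lt_fm (Var 1) (Var 0)) (subgroup_fm k (Var 0))"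
  have wf: "wf_fm (lang m) ?\<phi>"
    using wf_subgroup_fm[of "Var 0" k] by (simp add: lang_def)
  have s: "P 0 v \<and> sg k v = 0 \<longleftrightarrow> sat M (ev \<circ> ((\<lambda>_. 0)(0 := v))) ?\<phi>" for v
    using sat_subgroup_fm[of "(\<lambda>_. 0)(0 := v)" "Var 0" v k] by simp
  show "positive_part k \<in> D 1" "[ev v] \<in> positive_part k \<longleftrightarrow> P 0 v \<and> sg k v = 0"
    using unary_set_definable[OF wf s] by (simp_all only: positive_part_def)
qed

text \<open>Otherwise the triangle \<open>0 < x < y\<close> inside the subgroup would have dimension 1 when sliced by
  \<open>y\<close> but dimension 2 when sliced by \<open>x\<close>.\<close>

lemma positive_part_small:
  assumes null: "\<And>v. P 0 v \<Longrightarrow> sg k v = 0 \<Longrightarrow> v \<in> null"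
  shows "d (positive_part k) \<le> Some 0"
proof (rule ccontr)
  assume "\<not> ?thesis"
  then have "positive_part k \<noteq> {}" by (auto simp: d_empty)
  then have pos: "d (positive_part k) = Some 1"
    using d_unary[OF positive_part_definable, of k] \<open>\<not> d (positive_part k) \<le> Some 0\<close> by auto
  define R where "R x y \<longleftrightarrow> P 0 x \<and> P 0 (y - x) \<and> sg k y = 0" for x y
  let ?\<phi> = "Conj (lt_fm (Var 2) (Var 0)) (Conj (lt_fm (Var 0) (Var 1)) (subgroup_fm k (Var 1)))"
  have wf: "wf_fm (lang m) ?\<phi>"
    using wf_subgroup_fm[of "Var 1" k] by (simp add: lang_def)
  have s: "R x y \<longleftrightarrow> sat M (ev \<circ> ((\<lambda>_. 0)(0 := x, 1 := y))) ?\<phi>" for x y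
    using sat_subgroup_fm[of "(\<lambda>_. 0)(0 := x, 1 := y)" "Var 1" y k] by (simp add: R_def)
  let ?Y = "binary_set R" and ?Y' = "binary_set (\<lambda>y x. R x y)"
  note Y = binary_set_definable[OF wf s]
  note subY = Def_n_subset[OF Y(1)]
  have subY': "?Y' \<subseteq> tuples M 2"
    by (auto simp: binary_set_def tuples_def)
  have swap: "[x, y] \<in> ?Y' \<longleftrightarrow> [y, x] \<in> ?Y" for x y
    by (auto simp: binary_set_def)
  note Y' = d_swap[OF Y(1) subY' swap]
  have sgk: "sg k x = 0" if "R x y" for x y
  proof (rule sg_convex[of 0 x y k 0 0, simplified])
    show "le 0 x" "le x y" "sg k y = 0"
      using that P_asym[of 0] by (force simp: R_def le_def)+
  qed
  have base': "butlast ` ?Y' = positive_part k"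
  proof (rule Set.set_eqI)
    fix xs
    show "xs \<in> butlast ` ?Y' \<longleftrightarrow> xs \<in> positive_part k"
    proof (cases "\<exists>y. xs = [ev y]")
      case True
      then obtain y where y: "xs = [ev y]" by blast
      have "xs \<in> butlast ` ?Y' \<longleftrightarrow> (\<exists>x. R x y)"
        unfolding y base_binary[OF subY'] swap Y(2) ..
      also have "\<dots> \<longleftrightarrow> P 0 y \<and> sg k y = 0"
        unfolding R_def using half P_add_pos[of 0 "y - _"] by (metis diff_add_cancel)
      finally show ?thesis by (simp add: y mem_positive_part)
    next
      case False
      then show ?thesis using base_singleton[OF subY'] unaryD[OF positive_part_definable] by blast
    qed
  qed
  \<comment> \<open>Sliced by y, the fibres are the intervals (0, y), which have dimension 0 by
    assumption.\<close>
  have "d (fibre ?Y' xs) = Some 0" if xs: "xs \<in> butlast ` ?Y'" for xs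
  proof -
    obtain y where y: "xs = [ev y]" "P 0 y" "sg k y = 0"
      using xs unaryD[OF positive_part_definable, of xs k] mem_positive_part[of _ k] unfolding base' by metis
    have "fibre ?Y' xs = interval y"
    proof (intro Set.set_eqI iffI)
      fix zs assume "zs \<in> fibre ?Y' xs"
      then obtain z where z: "zs = [z]" "[ev y, z] \<in> ?Y'" by (auto simp: fibre_def y)
      then obtain v where "z = ev v" using binaryE[OF subY' z(2)] by auto
      then have "R v y" using z swap Y(2)[of v y] by simp
      then show "zs \<in> interval y" using z \<open>z = ev v\<close> by (simp add: mem_interval R_def)
    next
      fix zs assume zs: "zs \<in> interval y"
      then obtain v where v: "zs = [ev v]" using unaryE[OF interval_definable] by blast
      then have "R v y" using zs y by (simp add: mem_interval R_def)
      then show "zs \<in> fibre ?Y' xs"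
        using swap Y(2)[of v y] y v by (simp add: fibre_def)
    qed
    then show ?thesis using null[OF y(2,3)] by (simp add: null_def)
  qed
  then have "d ?Y' = Some 1"
    using d_constant_fibres[of ?Y' 1 0] Y'(1) base' pos by (simp add: numeral_2_eq_2)
  have base: "butlast ` ?Y = positive_part k"
  proof (rule Set.set_eqI)
    fix xs
    show "xs \<in> butlast ` ?Y \<longleftrightarrow> xs \<in> positive_part k"
    proof (cases "\<exists>x. xs = [ev x]")
      case True
      then obtain x where x: "xs = [ev x]" by blast
      have "xs \<in> butlast ` ?Y \<longleftrightarrow> (\<exists>y. R x y)"
        unfolding x base_binary[OF subY] Y(2) ..
      also have "\<dots> \<longleftrightarrow> P 0 x \<and> sg k x = 0"
      proof
        assume "P 0 x \<and> sg k x = 0"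
        then have "R x (x + x)" by (simp add: R_def sg0_add)
        then show "\<exists>y. R x y" ..
      qed (use sgk in \<open>auto simp: R_def\<close>)
      finally show ?thesis by (simp add: x mem_positive_part)
    next
      case False
      then show ?thesis using base_singleton[OF subY] unaryD[OF positive_part_definable] by blast
    qed
  qed
  have Y1: "?Y \<in> D (Suc 1)" using Y(1) by (simp add: numeral_2_eq_2)
  \<comment> \<open>Sliced by x, the fibre is the part of the subgroup beyond x. If it had dimension
    0, its union with (0, x) and the point x would force dimension 0 on the whole positive
    part.\<close>
  have "d (fibre ?Y xs) = Some 1" if xs: "xs \<in> butlast ` ?Y" for xs
  proof (rule ccontr)
    assume "d (fibre ?Y xs) \<noteq> Some 1"
    then have "d (fibre ?Y xs) = Some 0"
      using fibre_d_cases[OF Y1 xs] by blast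
    obtain x where x: "xs = [ev x]" "P 0 x" "sg k x = 0"
      using xs unaryD[OF positive_part_definable, of xs k] mem_positive_part[of _ k] unfolding base by metis
    have F: "fibre ?Y xs \<in> D 1"
      by (rule Def_n_fibre[OF Y1]) (simp add: x tuples_def)
    have "positive_part k \<subseteq> interval x \<union> {[ev x]} \<union> fibre ?Y xs"
    proof
      fix zs assume zs: "zs \<in> positive_part k"
      then obtain z where z: "zs = [ev z]" using unaryE[OF positive_part_definable] by blast
      then have "P 0 z" "sg k z = 0" using zs by (simp_all add: mem_positive_part)
      then consider "P 0 (x - z)" | "ev z = ev x" | "R x z"
        using x(2) by (auto simp: ev_eq sg_eq_0[of 0] R_def)
      then show "zs \<in> interval x \<union> {[ev x]} \<union> fibre ?Y xs"
        by cases (use \<open>P 0 z\<close> Y(2) in \<open>auto simp: z x mem_interval fibre_def\<close>)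
    qed
    moreover have "interval x \<union> {[ev x]} \<in> D 1 \<and> d (interval x \<union> {[ev x]}) \<le> Some 0"
      using null[OF x(2,3)] d_Un_small[OF interval_definable d_small_singleton(1)] d_small_singleton(2)
      by (simp add: null_iff)
    then have "interval x \<union> {[ev x]} \<union> fibre ?Y xs \<in> D 1 \<and>
        d (interval x \<union> {[ev x]} \<union> fibre ?Y xs) \<le> Some 0"
      using d_Un_small[of "interval x \<union> {[ev x]}" "fibre ?Y xs"] F \<open>d (fibre ?Y xs) = Some 0\<close>
      by (simp only: order_refl)
    ultimately have "d (positive_part k) \<le> Some 0"
      using d_small_subset positive_part_definable by blast
    then show False using pos by simp
  qed
  then have "d ?Y = Some 2"
    using d_constant_fibres[OF Y1, of 1] base pos by simp
  then show False
    using Y'(2) \<open>d ?Y' = Some 1\<close> by simp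
qed

lemma subgroup_small:
  assumes "\<And>v. P 0 v \<Longrightarrow> sg k v = 0 \<Longrightarrow> v \<in> null"
  shows "d (subgroup_set k) \<le> Some 0"
proof -
  let ?N = "{[ev (- v)] | v. [ev v] \<in> positive_part k}"
  have N: "?N \<in> D 1" "d ?N \<le> Some 0"
    using d_negate[OF positive_part_definable refl, of k] positive_part_small[OF assms] by auto
  have "subgroup_set k \<subseteq> positive_part k \<union> {[ev 0]} \<union> ?N"
  proof
    fix xs assume xs: "xs \<in> subgroup_set k"
    then obtain v where v: "xs = [ev v]" using unaryE[OF subgroup_definable] by blast
    then have "sg k v = 0" using xs by (simp add: mem_subgroup)
    consider "P 0 v" | "ev v = ev 0" | "P 0 (- v)"
      by (auto simp: ev_eq sg_eq_0)
    then show "xs \<in> positive_part k \<union> {[ev 0]} \<union> ?N"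
    proof cases
      case 3
      then have "[ev (- v)] \<in> positive_part k"
        using \<open>sg k v = 0\<close> by (simp add: mem_positive_part sg_minus)
      moreover have "xs = [ev (- (- v))]" by (simp add: v)
      ultimately show ?thesis by blast
    qed (use \<open>sg k v = 0\<close> in \<open>auto simp: v mem_positive_part\<close>)
  qed
  moreover have "positive_part k \<union> {[ev 0]} \<in> D 1 \<and> d (positive_part k \<union> {[ev 0]}) \<le> Some 0"
    using d_Un_small[OF positive_part_definable d_small_singleton(1) positive_part_small[OF assms]
        d_small_singleton(2)] .
  then have "positive_part k \<union> {[ev 0]} \<union> ?N \<in> D 1 \<and> d (positive_part k \<union> {[ev 0]} \<union> ?N) \<le> Some 0"
    using d_Un_small N by blast
  ultimately show ?thesis
    using d_small_subset[OF _ subgroup_definable] by blast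
qed

text \<open>Take the largest level k whose positive elements are all in \<open>null\<close>. It is
  not m + 1, because the line has dimension 1; and an element of \<open>null\<close> above U_k
  would, by \<open>determined_cut\<close>, extend the property to level k + 1.\<close>

lemma null_eq:
  obtains k where "k \<le> m" "\<And>v. v \<in> null \<longleftrightarrow> P 0 v \<and> sg k v = 0" "d (subgroup_set k) \<le> Some 0"
proof -
  define Q where "Q j \<longleftrightarrow> j \<le> Suc m \<and> (\<forall>v. P 0 v \<longrightarrow> sg j v = 0 \<longrightarrow> v \<in> null)" for j
  define k where "k = (GREATEST j. Q j)"
  have "Q 0" by (auto simp: Q_def sg_eq_0)
  then have Qk: "Q k" unfolding k_def by (rule GreatestI_nat[of _ _ "Suc m"]) (simp add: Q_def)
  have greatest: "j \<le> k" if "Q j" for j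
    unfolding k_def using that by (rule Greatest_le_nat[of _ _ "Suc m"]) (simp add: Q_def)
  have small: "d (subgroup_set k) \<le> Some 0"
    using Qk by (intro subgroup_small) (auto simp: Q_def)
  have "k \<noteq> Suc m"
  proof
    assume "k = Suc m"
    then have "xs \<in> subgroup_set k" if "xs \<in> tuples M 1" for xs
      using that unaryD[OF Def_n_full[OF univ_nonempty], of xs] mem_subgroup sg_beyond by (metis lessI)
    then have "tuples M 1 \<subseteq> subgroup_set k" by blast
    then show False
      using d_small_subset[OF _ Def_n_full[OF univ_nonempty] subgroup_definable small] d_line by simp
  qed
  then have "k \<le> m" using Qk by (simp add: Q_def)
  have "sg k s = 0" if s: "s \<in> null" for s
  proof (rule ccontr)
    assume "sg k s \<noteq> 0"
    have "P 0 s" using s by (simp add: null_def)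
    then have "P k s"
      using \<open>sg k s \<noteq> 0\<close> P_mono[of 0 k "- s"] P_asym[of 0 s] by (auto simp: sg_eq_0)
    obtain T where T: "finite T"
      "\<forall>a b. (\<forall>t\<in>T. tc (a - t) = tc (b - t)) \<longrightarrow> (a \<in> null \<longleftrightarrow> b \<in> null)"
      by (rule null_determined)
    have "b \<in> null" if "P 0 b" "sg (Suc k) b = 0" for b
      using T(1)
    proof (rule determined_cut)
      show "a \<in> null \<longleftrightarrow> b \<in> null" if "\<And>t. t \<in> T \<Longrightarrow> tc (a - t) = tc (b - t)" for a b
        using T(2) that by blast
      show "P 0 v" if "v \<in> null" for v using that by (simp add: null_def)
    qed (use null_add null_down s \<open>P k s\<close> that in auto)
    then have "Q (Suc k)" using \<open>k \<le> m\<close> by (simp add: Q_def)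
    then show False using greatest by force
  qed
  then have "v \<in> null \<longleftrightarrow> P 0 v \<and> sg k v = 0" for v
    using Qk by (auto simp: Q_def null_def)
  then show ?thesis using \<open>k \<le> m\<close> small by (intro that)
qed

text \<open>Only unary sets need to be compared. A fat set contains a translate of an interval whose
  length is not in \<open>null\<close>; any other set lies in finitely many translates of U_k, which
  have dimension 0.\<close>

lemma d_eq_chain_dim: "\<exists>k\<le>m. d = chain_dim k"
proof -
  obtain k where k: "k \<le> m" "\<And>v. v \<in> null \<longleftrightarrow> P 0 v \<and> sg k v = 0" "d (subgroup_set k) \<le> Some 0"
    using null_eq by blast
  have cover: "\<exists>Z\<in>D 1. d Z \<le> Some 0 \<and> (\<forall>t\<in>T. \<forall>v. sg k (v - t) = 0 \<longrightarrow> [ev v] \<in> Z)"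
    if "finite T" for T
    using that
  proof induction
    case empty
    have "{} \<in> D 1" by (rule Def_n_empty) simp
    then show ?case using d_empty by (intro bexI[of _ "{}"]) auto
  next
    case (insert t T)
    then obtain Z where Z: "Z \<in> D 1" "d Z \<le> Some 0" "\<forall>t\<in>T. \<forall>v. sg k (v - t) = 0 \<longrightarrow> [ev v] \<in> Z"
      by blast
    let ?C = "{[ev (v + t)] | v. [ev v] \<in> subgroup_set k}"
    have C: "?C \<in> D 1" "d ?C \<le> Some 0"
      using d_translate[OF subgroup_definable refl, of t k] k(3) by auto
    have "[ev v] \<in> ?C" if "sg k (v - t) = 0" for v
      using that mem_subgroup by (auto intro!: exI[of _ "v - t"])
    then show ?case
      using d_Un_small[OF Z(1) C(1) Z(2) C(2)] Z(3) by (intro bexI[of _ "Z \<union> ?C"]) auto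
  qed
  have "d X = chain_dim k X" if X: "X \<in> D 1" for X
  proof (cases "X = {}")
    case True
    then show ?thesis using chain_dim_unary[OF X] d_empty by simp
  next
    case False
    show ?thesis
    proof (cases "fat k X")
      case True
      then obtain a b where ab: "P k (b - a)" "\<And>x. le a x \<Longrightarrow> le x b \<Longrightarrow> [ev x] \<in> X"
        using fat_iff_interval[OF X] by blast
      let ?I = "{[ev (v + a)] | v. [ev v] \<in> interval (b - a)}"
      have "P 0 (b - a)" using ab(1) P_mono[of 0 k] by simp
      then have "b - a \<notin> null"
        using k(2) ab(1) by (auto simp: sg_eq_0)
      then have "d (interval (b - a)) = Some 1"
        using \<open>P 0 (b - a)\<close> d_unary[OF interval_definable interval_nonempty] by (auto simp: null_def)
      then have I: "?I \<in> D 1" "d ?I = Some 1"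
        using d_translate[OF interval_definable refl] by auto
      have "[ev (v + a)] \<in> X" if "[ev v] \<in> interval (b - a)" for v
        using that P_asym[of 0 v] P_asym[of 0 "b - a - v"]
        by (intro ab(2)) (auto simp: mem_interval le_def algebra_simps)
      then have "?I \<subseteq> X" by blast
      then have "Some 1 \<le> d X"
        using d_mono[OF _ I(1) X] I(2) by simp
      then have "d X = Some 1"
        using d_unary[OF X False] by auto
      then show ?thesis using chain_dim_unary[OF X] False True by simp
    next
      case not_fat: False
      then obtain T where "finite T" "\<forall>s\<in>{v. [ev v] \<in> X}. \<exists>t\<in>T. sg k (s - t) = 0"
        unfolding fat_def big_def not_not by (elim exE conjE) (erule that)
      then obtain Z where Z: "Z \<in> D 1" "d Z \<le> Some 0"
        "\<forall>t\<in>T. \<forall>v. sg k (v - t) = 0 \<longrightarrow> [ev v] \<in> Z" using cover[OF \<open>finite T\<close>] by (elim bexE conjE)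
      have "X \<subseteq> Z"
      proof
        fix xs assume "xs \<in> X"
        then obtain v where v: "xs = [ev v]" using unaryE[OF X] by blast
        then show "xs \<in> Z"
          using \<open>xs \<in> X\<close> Z(3) \<open>\<forall>s\<in>{v. [ev v] \<in> X}. \<exists>t\<in>T. sg k (s - t) = 0\<close> by blast
      qed
      then have "d X = Some 0"
        using d_unary_eq_0[OF X False d_small_subset[OF _ X Z(1,2)]] by blast
      then show ?thesis using chain_dim_unary[OF X] False not_fat by simp
    qed
  qed
  moreover have "dimension (lang m) M (chain_dim k)"
    using dimension_function_chain_dim[OF k(1)] by unfold_locales auto
  ultimately have "d = chain_dim k"
    using dimension_function_eqI dimension_axioms by blast
  then show ?thesis using k(1) by blast
qed

end

context chain_model
begin

text \<open>For k < l the two functions differ on U_l, which is a single coset of itself but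
  contains a segment longer than U_k.\<close>

lemma chain_dim_inj: "inj_on chain_dim {..m}"
proof (rule linorder_inj_onI)
  fix k l assume "k < l" and kl: "k \<in> {..m}" "l \<in> {..m}"
  interpret chain_dimension scale m P M ev "chain_dim k"
    using dimension_function_chain_dim kl by unfold_locales auto
  obtain w where w: "P k w" "\<not> P l w"
    using P_gap[of k l] \<open>k < l\<close> kl by auto
  then have "sg l w = 0"
    using P_mono[of k l "- w"] P_asym[of k w] \<open>k < l\<close> by (auto simp: sg_eq_0)
  then have "fat k (subgroup_set l)"
    unfolding fat_def mem_subgroup using w(1)
    by (intro big_segment[of k w 0]) (auto simp: sg_def[of k] sg0_scale)
  moreover have "\<not> fat l (subgroup_set l)"
    unfolding fat_def mem_subgroup big_def by (auto intro!: exI[of _ "{0}"])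
  moreover have "subgroup_set l \<noteq> {}"
    using mem_subgroup[of 0 l] by auto
  ultimately have "chain_dim k (subgroup_set l) \<noteq> chain_dim l (subgroup_set l)"
    using chain_dim_unary[OF subgroup_definable] by simp
  then show "chain_dim k \<noteq> chain_dim l" by auto
qed auto

lemma n_dim_model: "n_dim L M = m + 1"
proof -
  have "{d. dimension_function L M d} = chain_dim ` {..m}"
  proof (intro Set.set_eqI iffI)
    fix d assume "d \<in> {d. dimension_function L M d}"
    then interpret chain_dimension scale m P M ev d
      by unfold_locales auto
    show "d \<in> chain_dim ` {..m}"
      using d_eq_chain_dim by auto
  qed (use dimension_function_chain_dim in auto)
  then show ?thesis
    by (simp add: n_dim_def card_image[OF chain_dim_inj])
qed

end

section \<open>Models as quotients of rational vector spaces\<close>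

lemma clear_denominators:
  fixes v :: "'a \<Rightarrow>\<^sub>0 rat"
  obtains N and w :: "'a \<Rightarrow>\<^sub>0 int"
  where "0 < N" "\<And>a. of_nat N * Poly_Mapping.lookup v a = of_int (Poly_Mapping.lookup w a)"
proof -
  define den where "den q = nat (snd (quotient_of q))" for q
  define N where "N = (\<Prod>a\<in>Poly_Mapping.keys v. den (Poly_Mapping.lookup v a))"
  have den: "0 < den q" "of_nat (den q) * q = of_int (fst (quotient_of q))" for q
    using quotient_of_denom_pos'[of q] quotient_of_div[of q "fst (quotient_of q)" "snd (quotient_of q)"]
    by (auto simp: den_def field_simps)
  have "0 < N"
    unfolding N_def by (rule prod_pos) (use den in auto)
  define w where "w = Poly_Mapping.map (\<lambda>q. \<lfloor>of_nat N * q\<rfloor>) v"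
  have "of_nat N * Poly_Mapping.lookup v a = of_int (Poly_Mapping.lookup w a)" for a
  proof (cases "Poly_Mapping.lookup v a = 0")
    case True
    then show ?thesis by (simp add: w_def Poly_Mapping.map.rep_eq)
  next
    case False
    let ?q = "Poly_Mapping.lookup v a"
    have "den ?q dvd N"
      unfolding N_def using False by (intro dvd_prodI) (auto simp: in_keys_iff)
    then obtain c where "N = den ?q * c" by blast
    then have "of_nat N * ?q = of_int (int c * fst (quotient_of ?q))"
      using den(2)[of ?q] by (simp add: mult.assoc mult.commute mult.left_commute)
    then have "of_int \<lfloor>of_nat N * ?q\<rfloor> = of_nat N * ?q"
      by (metis floor_of_int)
    moreover have "Poly_Mapping.lookup w a = \<lfloor>of_nat N * ?q\<rfloor>"
      using False by (simp add: w_def Poly_Mapping.map.rep_eq)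
    ultimately show ?thesis by metis
  qed
  then show ?thesis using that \<open>0 < N\<close> by blast
qed

text \<open>The free Abelian group on the underlying type maps onto G. A rational vector v = w/N
  with w integral is sent to the N-th root of the image of w, which exists by divisibility and is
  unique for lack of torsion.\<close>

lemma rational_presentation:
  fixes G :: "('a, 'b) monoid_scheme" (structure)
  assumes "comm_group G"
    and divisible: "\<And>x n. x \<in> carrier G \<Longrightarrow> 0 < n \<Longrightarrow> \<exists>y\<in>carrier G. y [^] (n::nat) = x"
    and torsion_free: "\<And>x n. x \<in> carrier G \<Longrightarrow> 0 < n \<Longrightarrow> x [^] (n::nat) = \<one> \<Longrightarrow> x = \<one>"
  obtains ev :: "('a \<Rightarrow>\<^sub>0 rat) \<Rightarrow> 'a"
  where "\<And>v w. ev (v + w) = ev v \<otimes> ev w" "range ev = carrier G"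
proof -
  interpret comm_group G by fact
  \<comment> \<open>The generators are all elements of the type; those outside the carrier go to the
    unit.\<close>
  have "(\<lambda>x. if x \<in> carrier G then x else \<one>) ` UNIV \<subseteq> carrier G" by auto
  then obtain h where h: "h \<in> hom (free_Abelian_group UNIV) G"
    "\<And>x. h (frag_of x) = (if x \<in> carrier G then x else \<one>)"
    by (rule free_Abelian_group_universal) auto
  have h_carrier: "h w \<in> carrier G" and h_add: "h (w + w') = h w \<otimes> h w'" for w w'
    using h(1) by (auto simp: hom_def)
  have h_0: "h 0 = \<one>"
    using h_add[of 0 0] h_carrier[of 0] by (simp add: r_cancel_one')
  have h_cmul: "h (frag_cmul (int n) w) = h w [^] n" for n w
    by (induction n) (simp_all add: h_0 frag_cmul_distrib h_add h_carrier m_comm)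
  define rel where "rel N v w \<longleftrightarrow> 0 < N \<and>
      (\<forall>a. of_nat N * Poly_Mapping.lookup v a = of_int (Poly_Mapping.lookup w a))"
    for N :: nat and v :: "'a \<Rightarrow>\<^sub>0 rat" and w
  have cancel: "x = y" if "x \<in> carrier G" "y \<in> carrier G" "0 < n" "x [^] n = y [^] n" for x y and n :: nat
  proof -
    have "(x \<otimes> inv y) [^] n = \<one>"
      using that by (simp add: pow_mult_distrib m_comm nat_pow_inv)
    then have "x \<otimes> inv y = \<one>"
      using torsion_free that by simp
    then show ?thesis using that by (metis inv_equality inv_inv inv_closed)
  qed
  \<comment> \<open>Two fractions representing the same v are compared after raising to the power N
    N'.\<close>
  have unique: "x = x'"
    if "rel N v w" "rel N' v w'" "x \<in> carrier G" "x' \<in> carrier G" "x [^] N = h w" "x' [^] N' = h w'"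
    for N N' v w w' x x'
  proof -
    have "of_int (int N' * Poly_Mapping.lookup w a) = (of_int (int N * Poly_Mapping.lookup w' a) :: rat)" for a
    proof -
      have "of_int (Poly_Mapping.lookup w a) = of_nat N * Poly_Mapping.lookup v a"
        "of_int (Poly_Mapping.lookup w' a) = of_nat N' * Poly_Mapping.lookup v a"
        using that(1,2) by (auto simp: rel_def)
      then show ?thesis by simp
    qed
    then have "frag_cmul (int N') w = frag_cmul (int N) w'"
      by (intro poly_mapping_eqI) (metis lookup_frag_cmul of_int_eq_iff)
    then have "h w [^] N' = h w' [^] N" by (metis h_cmul)
    then have "x [^] (N * N') = x' [^] (N * N')"
      using that by (metis nat_pow_pow mult.commute)
    then show ?thesis
      using cancel[of x x' "N * N'"] that by (simp add: rel_def)
  qed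
  have "\<exists>x\<in>carrier G. \<forall>N w. rel N v w \<longrightarrow> x [^] N = h w" for v
  proof -
    obtain N w where Nw: "rel N v w"
      using clear_denominators[of v] unfolding rel_def by metis
    then obtain x where x: "x \<in> carrier G" "x [^] N = h w"
      using divisible[OF h_carrier[of w], of N] unfolding rel_def by blast
    have "x [^] N' = h w'" if r: "rel N' v w'" for N' w'
    proof -
      obtain x' where "x' \<in> carrier G" "x' [^] N' = h w'"
        using divisible[OF h_carrier[of w'], of N'] r unfolding rel_def by blast
      then show ?thesis using unique[OF Nw r x(1) _ x(2)] by blast
    qed
    then show ?thesis using x(1) by blast
  qed
  then obtain ev where ev: "\<And>v. ev v \<in> carrier G" "\<And>v N w. rel N v w \<Longrightarrow> ev v [^] N = h w"
    by metis
  have "ev (v + v') = ev v \<otimes> ev v'" for v v'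
  proof -
    obtain N w where Nw: "rel N v w"
      using clear_denominators[of v] unfolding rel_def by metis
    obtain N' w' where Nw': "rel N' v' w'"
      using clear_denominators[of v'] unfolding rel_def by metis
    have pos: "0 < N * N'" using Nw Nw' by (simp add: rel_def)
    have "of_nat (N * N') * Poly_Mapping.lookup (v + v') a =
        of_int (Poly_Mapping.lookup (frag_cmul (int N') w + frag_cmul (int N) w') a)" for a
    proof -
      have "of_int (Poly_Mapping.lookup w a) = of_nat N * Poly_Mapping.lookup v a"
        "of_int (Poly_Mapping.lookup w' a) = of_nat N' * Poly_Mapping.lookup v' a"
        using Nw Nw' by (auto simp: rel_def)
      then show ?thesis
        by (simp add: lookup_add distrib_left)
    qed
    then have "rel (N * N') (v + v') (frag_cmul (int N') w + frag_cmul (int N) w')"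
      using pos by (simp add: rel_def)
    then have "ev (v + v') [^] (N * N') = h w [^] N' \<otimes> h w' [^] N"
      using ev(2) h_add h_cmul by metis
    also have "\<dots> = (ev v \<otimes> ev v') [^] (N * N')"
      using ev(1) ev(2)[OF Nw] ev(2)[OF Nw']
      by (simp add: pow_mult_distrib m_comm nat_pow_pow mult.commute flip: ev(2)[OF Nw] ev(2)[OF Nw'])
    finally show ?thesis
      using cancel[OF _ _ pos] ev(1) by blast
  qed
  moreover have "ev (Poly_Mapping.single a 1) = a" if "a \<in> carrier G" for a
  proof -
    have "rel 1 (Poly_Mapping.single a 1) (frag_of a)"
      by (auto simp: rel_def lookup_single when_def)
    then show ?thesis
      using ev(1)[of "Poly_Mapping.single a 1"] ev(2) h(2) that by fastforce
  qed
  then have "range ev = carrier G"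
    using ev(1) by (metis image_subset_iff rangeI subsetI subset_antisym)
  ultimately show ?thesis using that by blast
qed

definition rat_scale :: "rat \<Rightarrow> ('a \<Rightarrow>\<^sub>0 rat) \<Rightarrow> 'a \<Rightarrow>\<^sub>0 rat" where
  "rat_scale q v = Poly_Mapping.map ((*) q) v"

lemma lookup_rat_scale: "Poly_Mapping.lookup (rat_scale q v) a = q * Poly_Mapping.lookup v a"
  by (simp add: rat_scale_def Poly_Mapping.map.rep_eq when_def)

lemma vector_space_rat_scale: "vector_space rat_scale"
  by unfold_locales
     (auto intro!: poly_mapping_eqI simp: lookup_rat_scale lookup_add algebra_simps)

section \<open>Reading the axioms in a model\<close>

locale T_model =
  fixes m :: nat and M :: "(og_fun, og_rel, 'a) fo_struct"
  assumes model: "is_model (lang m) (theory_T m) M" and m_pos: "0 < m"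
begin

abbreviation pls :: "'a \<Rightarrow> 'a \<Rightarrow> 'a" (infixl \<open>\<^bold>+\<close> 65) where "x \<^bold>+ y \<equiv> ifun M Add [x, y]"
abbreviation lt :: "'a \<Rightarrow> 'a \<Rightarrow> bool" (infix \<open>\<^bold><\<close> 50) where "x \<^bold>< y \<equiv> irel M Less [x, y]"

lemma axiom: "\<phi> \<in> theory_T m \<Longrightarrow> \<exists>e. range e \<subseteq> univ M \<and> sat M e \<phi>"
proof -
  assume \<phi>: "\<phi> \<in> theory_T m"
  obtain a where "a \<in> univ M"
    using model by (auto simp: is_model_def is_struct_def)
  then have "range (\<lambda>_. a) \<subseteq> univ M" by auto
  with model \<phi> show ?thesis unfolding is_model_def by blast
qed

lemma pls_closed: "x \<in> univ M \<Longrightarrow> y \<in> univ M \<Longrightarrow> x \<^bold>+ y \<in> univ M"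
  using model by (auto simp: is_model_def is_struct_def lang_def tuples_def)

text \<open>Axioms are sentences: once the simplifier has reduced satisfaction to a statement Q that
  does not mention the assignment, Q holds.\<close>

lemma axiom_iff: "\<phi> \<in> theory_T m \<Longrightarrow> (\<And>e. sat M e \<phi> \<longleftrightarrow> Q) \<Longrightarrow> Q"
  using axiom by blast

lemma pls_assoc [rule_format]:
  "\<forall>x\<in>univ M. \<forall>y\<in>univ M. \<forall>z\<in>univ M. x \<^bold>+ y \<^bold>+ z = x \<^bold>+ (y \<^bold>+ z)"
  by (rule axiom_iff[of "Forall 0 (Forall 1 (Forall 2 (Eq (add (add (Var 0) (Var 1)) (Var 2))
      (add (Var 0) (add (Var 1) (Var 2))))))"]) (simp_all add: theory_T_def abelian_group_axioms_def)

lemma pls_commute [rule_format]: "\<forall>x\<in>univ M. \<forall>y\<in>univ M. x \<^bold>+ y = y \<^bold>+ x"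
  by (rule axiom_iff[of "Forall 0 (Forall 1 (Eq (add (Var 0) (Var 1)) (add (Var 1) (Var 0))))"])
     (simp_all add: theory_T_def abelian_group_axioms_def)

lemma zero_exists:
  "\<exists>z\<in>univ M. (\<forall>x\<in>univ M. x \<^bold>+ z = x) \<and> (\<forall>x\<in>univ M. \<exists>y\<in>univ M. x \<^bold>+ y = z)"
  by (rule axiom_iff[of "Exists 0 (Conj (Forall 1 (Eq (add (Var 1) (Var 0)) (Var 1)))
                (Forall 1 (Exists 2 (Eq (add (Var 1) (Var 2)) (Var 0)))))"])
     (simp_all add: theory_T_def abelian_group_axioms_def)

definition zero :: 'a where
  "zero = (SOME z. z \<in> univ M \<and> (\<forall>x\<in>univ M. x \<^bold>+ z = x) \<and> (\<forall>x\<in>univ M. \<exists>y\<in>univ M. x \<^bold>+ y = z))"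

lemma zero: "zero \<in> univ M" "x \<in> univ M \<Longrightarrow> x \<^bold>+ zero = x" "x \<in> univ M \<Longrightarrow> \<exists>y\<in>univ M. x \<^bold>+ y = zero"
proof -
  have "zero \<in> univ M \<and> (\<forall>x\<in>univ M. x \<^bold>+ zero = x) \<and> (\<forall>x\<in>univ M. \<exists>y\<in>univ M. x \<^bold>+ y = zero)"
    unfolding zero_def by (rule someI_ex) (use zero_exists in blast)
  then show "zero \<in> univ M" "x \<in> univ M \<Longrightarrow> x \<^bold>+ zero = x" "x \<in> univ M \<Longrightarrow> \<exists>y\<in>univ M. x \<^bold>+ y = zero"
    by blast+
qed

definition G :: "'a monoid" where
  "G = \<lparr>carrier = univ M, mult = (\<lambda>x y. x \<^bold>+ y), one = zero\<rparr>"

lemma G_simps [simp]: "carrier G = univ M" "x \<otimes>\<^bsub>G\<^esub> y = x \<^bold>+ y" "\<one>\<^bsub>G\<^esub> = zero"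
  by (simp_all add: G_def)

lemma comm_group_G: "comm_group G"
proof (rule comm_groupI)
  fix x assume "x \<in> carrier G"
  then obtain y where "y \<in> univ M" "x \<^bold>+ y = zero" using zero(3) by auto
  then show "\<exists>y\<in>carrier G. y \<otimes>\<^bsub>G\<^esub> x = \<one>\<^bsub>G\<^esub>"
    using \<open>x \<in> carrier G\<close> pls_commute by (intro bexI[of _ y]) auto
qed (use pls_closed pls_assoc pls_commute zero in auto)

sublocale G: comm_group G by (rule comm_group_G)

lemma eval_mult_tm: "eval_tm M e (mult_tm n t) = eval_tm M e t [^]\<^bsub>G\<^esub> Suc n" if "eval_tm M e t \<in> univ M"
proof (induction n)
  case 0
  show ?case using that G.l_one by simp
qed simp

lemma divisible: "x \<in> univ M \<Longrightarrow> 0 < n \<Longrightarrow> \<exists>y\<in>univ M. y [^]\<^bsub>G\<^esub> (n::nat) = x"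
proof -
  assume x: "x \<in> univ M" "0 < n"
  then obtain k where n: "n = Suc k" using gr0_implies_Suc by blast
  have "Forall 0 (Exists 1 (Eq (mult_tm k (Var 1)) (Var 0))) \<in> theory_T m"
    by (auto simp: theory_T_def divisibility_axioms_def)
  from axiom[OF this] x obtain e y where "y \<in> univ M" "eval_tm M (e(0 := x, 1 := y)) (mult_tm k (Var 1)) = x"
    by auto
  then show ?thesis
    using eval_mult_tm[of "e(0 := x, 1 := y)" "Var 1" k] by (auto simp: n)
qed

lemma lt_irrefl [rule_format]: "\<forall>x\<in>univ M. \<not> x \<^bold>< x"
  by (rule axiom_iff[of "Forall 0 (Neg (lt_fm (Var 0) (Var 0)))"])
     (simp_all add: theory_T_def order_axioms_def)

lemma lt_trans [rule_format]:
  "\<forall>x\<in>univ M. \<forall>y\<in>univ M. \<forall>z\<in>univ M. x \<^bold>< y \<longrightarrow> y \<^bold>< z \<longrightarrow> x \<^bold>< z"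
  by (rule axiom_iff[of "Forall 0 (Forall 1 (Forall 2 (Imp (Conj (lt_fm (Var 0) (Var 1))
      (lt_fm (Var 1) (Var 2))) (lt_fm (Var 0) (Var 2)))))"])
     (simp_all add: theory_T_def order_axioms_def)

lemma lt_total [rule_format]: "\<forall>x\<in>univ M. \<forall>y\<in>univ M. x \<^bold>< y \<or> x = y \<or> y \<^bold>< x"
  by (rule axiom_iff[of "Forall 0 (Forall 1 (Disj (lt_fm (Var 0) (Var 1))
      (Disj (Eq (Var 0) (Var 1)) (lt_fm (Var 1) (Var 0)))))"])
     (simp_all add: theory_T_def order_axioms_def)

lemma lt_add [rule_format]:
  "\<forall>x\<in>univ M. \<forall>y\<in>univ M. \<forall>z\<in>univ M. x \<^bold>< y \<longrightarrow> x \<^bold>+ z \<^bold>< y \<^bold>+ z"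
  by (rule axiom_iff[of "Forall 0 (Forall 1 (Forall 2 (Imp (lt_fm (Var 0) (Var 1))
      (lt_fm (add (Var 0) (Var 2)) (add (Var 1) (Var 2))))))"])
     (simp_all add: theory_T_def order_axioms_def)

lemma torsion_free:
  assumes "x \<in> univ M" "0 < n" "x [^]\<^bsub>G\<^esub> (n::nat) = zero"
  shows "x = zero"
proof (rule ccontr)
  assume "x \<noteq> zero"
  have pow: "x [^]\<^bsub>G\<^esub> k \<in> univ M" for k :: nat
    using G.nat_pow_closed assms(1) by simp
  consider "zero \<^bold>< x" | "x \<^bold>< zero"
    using lt_total[OF assms(1) zero(1)] \<open>x \<noteq> zero\<close> by blast
  then have "zero \<^bold>< x [^]\<^bsub>G\<^esub> Suc k \<or> x [^]\<^bsub>G\<^esub> Suc k \<^bold>< zero" for k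
  proof cases
    case 1
    have "zero \<^bold>< x [^]\<^bsub>G\<^esub> Suc k"
    proof (induction k)
      case 0
      then show ?case using 1 assms(1) G.l_one by simp
    next
      case (Suc k)
      then have "zero \<^bold>+ x \<^bold>< x [^]\<^bsub>G\<^esub> Suc k \<^bold>+ x"
        using lt_add[OF zero(1) pow assms(1)] by blast
      then have "x \<^bold>< x [^]\<^bsub>G\<^esub> Suc (Suc k)"
        using assms(1) G.l_one[of x] by simp
      then show ?case using lt_trans[OF zero(1) assms(1) pow 1] by blast
    qed
    then show ?thesis ..
  next
    case 2
    have "x [^]\<^bsub>G\<^esub> Suc k \<^bold>< zero"
    proof (induction k)
      case 0
      then show ?case using 2 assms(1) G.l_one by simp
    next
      case (Suc k)
      then have "x [^]\<^bsub>G\<^esub> Suc k \<^bold>+ x \<^bold>< zero \<^bold>+ x"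
        using lt_add[OF pow zero(1) assms(1)] by blast
      then have "x [^]\<^bsub>G\<^esub> Suc (Suc k) \<^bold>< x"
        using assms(1) G.l_one[of x] by simp
      then show ?case using lt_trans[OF pow assms(1) zero(1) _ 2] by blast
    qed
    then show ?thesis ..
  qed
  from this[of "n - 1"] show False
    using assms(2,3) lt_irrefl[OF zero(1)] by simp
qed

text \<open>Padded by \<open>U\<^sub>0 = {0}\<close> and \<open>U\<^sub>m\<^sub>+\<^sub>1 = M\<close>.\<close>

definition Us :: "nat \<Rightarrow> 'a set" where
  "Us k = (if k = 0 then {zero} else if k \<le> m then {x \<in> univ M. irel M (U k) [x]} else univ M)"

lemma is_zero_iff: "x \<in> univ M \<Longrightarrow> x \<^bold>+ x = x \<longleftrightarrow> x = zero"
  using G.r_cancel_one'[of x x] by auto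

lemma Us_subset: "Us k \<subseteq> univ M"
  using zero(1) by (auto simp: Us_def)

lemma Us_axioms:
  assumes "1 \<le> k" "k \<le> m"
  shows "x \<in> Us k \<Longrightarrow> x \<in> Us (Suc k)"
    and "zero \<in> Us k"
    and "x \<in> Us k \<Longrightarrow> y \<in> Us k \<Longrightarrow> x \<^bold>+ y \<in> Us k"
    and "x \<in> Us k \<Longrightarrow> y \<in> univ M \<Longrightarrow> x \<^bold>+ y = zero \<Longrightarrow> y \<in> Us k"
    and "x \<in> Us k \<Longrightarrow> z \<in> Us k \<Longrightarrow> y \<in> Us (Suc k) \<Longrightarrow> x \<^bold>< y \<Longrightarrow> y \<^bold>< z \<Longrightarrow> y \<in> Us k"
    and "\<exists>x\<in>Us k. x \<noteq> zero"
    and "\<exists>x\<in>Us (Suc k). x \<notin> Us k"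
proof -
  \<comment> \<open>The formula by which the axioms refer to U_{k+1}; for k = m it is the tautology
    that describes the whole universe.\<close>
  define H where "H = (if k = m then whole else in_U (Suc k))"
  have sub: "nontrivial_convex_subgroup_axioms (in_U k) H \<subseteq> theory_T m"
  proof (cases "k = m")
    case False
    then have "Suc k \<in> {1<..m}" using assms by auto
    then have "nontrivial_convex_subgroup_axioms (in_U (Suc k - 1)) (in_U (Suc k)) \<subseteq> theory_T m"
      unfolding theory_T_def by blast
    then show ?thesis using False by (simp add: H_def)
  qed (auto simp: theory_T_def H_def)
  have Uk: "x \<in> Us k \<longleftrightarrow> x \<in> univ M \<and> irel M (U k) [x]" for x
    using assms by (auto simp: Us_def)
  have H: "sat M e (H t) \<longleftrightarrow> eval_tm M e t \<in> Us (Suc k)" if "eval_tm M e t \<in> univ M" for e t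
    using assms that by (auto simp: H_def Us_def)
  let ?R = "\<lambda>x. irel M (U k) [x]"
  note ax = axiom_iff[OF subsetD[OF sub]]
  note simps = nontrivial_convex_subgroup_axioms_def Defs.is_zero_def H
  have "\<forall>x\<in>univ M. ?R x \<longrightarrow> x \<in> Us (Suc k)"
    by (rule ax[of "Forall 0 (Imp (in_U k (Var 0)) (H (Var 0)))"]) (simp_all add: simps)
  then show "x \<in> Us k \<Longrightarrow> x \<in> Us (Suc k)" unfolding Uk by blast
  have "\<forall>x\<in>univ M. x \<^bold>+ x = x \<longrightarrow> ?R x"
    by (rule ax[of "Forall 0 (Imp (Defs.is_zero (Var 0)) (in_U k (Var 0)))"]) (simp_all add: simps)
  then show "zero \<in> Us k" using zero unfolding Uk by blast
  have "\<forall>x\<in>univ M. \<forall>y\<in>univ M. ?R x \<longrightarrow> ?R y \<longrightarrow> ?R (x \<^bold>+ y)"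
    by (rule ax[of "Forall 0 (Forall 1 (Imp (Conj (in_U k (Var 0)) (in_U k (Var 1)))
      (in_U k (add (Var 0) (Var 1)))))"]) (simp_all add: simps)
  then show "x \<in> Us k \<Longrightarrow> y \<in> Us k \<Longrightarrow> x \<^bold>+ y \<in> Us k" unfolding Uk using pls_closed by blast
  have "\<forall>x\<in>univ M. \<forall>y\<in>univ M. ?R x \<longrightarrow> x \<^bold>+ y \<^bold>+ (x \<^bold>+ y) = x \<^bold>+ y \<longrightarrow> ?R y"
    by (rule ax[of "Forall 0 (Forall 1 (Imp (Conj (in_U k (Var 0))
      (Defs.is_zero (add (Var 0) (Var 1)))) (in_U k (Var 1))))"]) (simp_all add: simps)
  then show "x \<in> Us k \<Longrightarrow> y \<in> univ M \<Longrightarrow> x \<^bold>+ y = zero \<Longrightarrow> y \<in> Us k"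
    unfolding Uk using zero(1,2) by metis
  have "\<forall>x\<in>univ M. \<forall>y\<in>univ M. \<forall>z\<in>univ M. ?R x \<longrightarrow> ?R z \<longrightarrow> y \<in> Us (Suc k) \<longrightarrow>
      x \<^bold>< y \<longrightarrow> y \<^bold>< z \<longrightarrow> ?R y"
    by (rule ax[of "Forall 0 (Forall 1 (Forall 2 (Imp (Conj (Conj (in_U k (Var 0)) (in_U k (Var 2)))
       (Conj (H (Var 1)) (Conj (lt_fm (Var 0) (Var 1)) (lt_fm (Var 1) (Var 2)))))
       (in_U k (Var 1)))))"]) (simp_all add: simps)
  then show "x \<in> Us k \<Longrightarrow> z \<in> Us k \<Longrightarrow> y \<in> Us (Suc k) \<Longrightarrow> x \<^bold>< y \<Longrightarrow> y \<^bold>< z \<Longrightarrow> y \<in> Us k"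
    unfolding Uk using Us_subset by blast
  have "\<exists>x\<in>univ M. ?R x \<and> x \<^bold>+ x \<noteq> x"
    by (rule ax[of "Exists 0 (Conj (in_U k (Var 0)) (Neg (Defs.is_zero (Var 0))))"]) (simp_all add: simps)
  then show "\<exists>x\<in>Us k. x \<noteq> zero"
    unfolding Bex_def Uk using zero(1,2) by metis
  have "\<exists>x\<in>univ M. x \<in> Us (Suc k) \<and> \<not> ?R x"
    by (rule ax[of "Exists 0 (Conj (H (Var 0)) (Neg (in_U k (Var 0))))"]) (simp_all add: simps)
  then show "\<exists>x\<in>Us (Suc k). x \<notin> Us k" unfolding Uk by blast
qed

lemma Us_zero: "zero \<in> Us k"
  using Us_axioms(2)[of k] zero(1) by (cases "1 \<le> k \<and> k \<le> m") (auto simp: Us_def)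

lemma Us_add: "x \<in> Us k \<Longrightarrow> y \<in> Us k \<Longrightarrow> x \<^bold>+ y \<in> Us k"
  using Us_axioms(3)[of k x y] zero pls_closed by (cases "1 \<le> k \<and> k \<le> m") (auto simp: Us_def)

lemma Us_neg: "x \<in> Us k \<Longrightarrow> y \<in> univ M \<Longrightarrow> x \<^bold>+ y = zero \<Longrightarrow> y \<in> Us k"
proof (cases "1 \<le> k \<and> k \<le> m")
  case False
  assume "x \<in> Us k" "y \<in> univ M" "x \<^bold>+ y = zero"
  moreover have "zero \<^bold>+ y = y" if "y \<in> univ M" for y
    using G.l_one that by simp
  ultimately show ?thesis using False by (auto simp: Us_def split: if_splits)
qed (use Us_axioms(4) in blast)

lemma Us_Suc: "k \<le> m \<Longrightarrow> Us k \<subset> Us (Suc k)"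
proof (cases "k = 0")
  case True
  have "\<exists>x\<in>Us 1. x \<noteq> zero" using Us_axioms(6)[of 1] m_pos by auto
  then show ?thesis using Us_zero[of 1] by (auto simp: True Us_def[of 0])
next
  case False
  assume "k \<le> m"
  then show ?thesis using Us_axioms(1,7)[of k] False by auto
qed

lemma Us_mono: "i \<le> j \<Longrightarrow> Us i \<subseteq> Us j"
proof (induction rule: dec_induct)
  case (step n)
  have "Us n \<subseteq> Us (Suc n)"
    using Us_Suc[of n] by (cases "n \<le> m") (auto simp: Us_def)
  then show ?case using step.IH by blast
qed simp

lemma Us_gap: "i < j \<Longrightarrow> j \<le> Suc m \<Longrightarrow> \<exists>x\<in>Us j. x \<notin> Us i"
  using Us_Suc[of i] Us_mono[of "Suc i" j] by auto

text \<open>The axioms assert convexity of U_k only inside U_{k+1}, so the induction descends from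
  the whole universe at level m + 1.\<close>

lemma Us_convex:
  assumes "x \<in> Us k" "z \<in> Us k" "y \<in> univ M" "x \<^bold>< y" "y \<^bold>< z"
  shows "y \<in> Us k"
proof (cases "k \<le> Suc m")
  case True
  then show ?thesis
    using assms
  proof (induction arbitrary: x z rule: inc_induct)
    case base
    then show ?case by (simp add: Us_def)
  next
    case (step n)
    show ?case
    proof (cases "n = 0")
      case True
      then have "x = zero" "z = zero" using step.prems by (auto simp: Us_def)
      then show ?thesis using step.prems lt_trans[of zero y zero] lt_irrefl zero(1) by blast
    next
      case False
      then have n: "1 \<le> n" "n \<le> m" using step.hyps by auto
      then have "y \<in> Us (Suc n)"
        using step Us_axioms(1)[OF n] by blast
      then show ?thesis using Us_axioms(5)[OF n] step.prems by blast
    qed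
  qed
next
  case False
  then show ?thesis using assms by (simp add: Us_def)
qed

lemma chain_model_exists:
  "\<exists>P (ev :: ('a \<Rightarrow>\<^sub>0 rat) \<Rightarrow> 'a). chain_model rat_scale m P M ev"
proof -
  have "\<exists>ev :: ('a \<Rightarrow>\<^sub>0 rat) \<Rightarrow> 'a. (\<forall>v w. ev (v + w) = ev v \<^bold>+ ev w) \<and> range ev = univ M"
  proof (rule rational_presentation[OF comm_group_G])
    show "\<exists>y\<in>carrier G. y [^]\<^bsub>G\<^esub> n = x" if "x \<in> carrier G" "0 < n" for x and n :: nat
      using that divisible by simp
    show "x = \<one>\<^bsub>G\<^esub>" if "x \<in> carrier G" "0 < n" "x [^]\<^bsub>G\<^esub> n = \<one>\<^bsub>G\<^esub>" for x and n :: nat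
      using that torsion_free by simp
  qed auto
  then obtain ev :: "('a \<Rightarrow>\<^sub>0 rat) \<Rightarrow> 'a"
    where ev_add: "\<And>v w. ev (v + w) = ev v \<^bold>+ ev w" and ev_range: "range ev = univ M"
    by blast
  have ev_univ: "ev v \<in> univ M" for v using ev_range by auto
  have ev_0: "ev 0 = zero"
    using is_zero_iff[OF ev_univ, of 0] ev_add[of 0 0] by simp
  have lt_ev: "ev (v + u) \<^bold>< ev (w + u) \<longleftrightarrow> ev v \<^bold>< ev w" for u v w
    using lt_add[OF ev_univ[of v] ev_univ[of w] ev_univ[of u]]
      lt_add[OF ev_univ[of "v + u"] ev_univ[of "w + u"] ev_univ[of "- u"]]
    by (auto simp flip: ev_add)
  have lt_diff: "ev v \<^bold>< ev w \<longleftrightarrow> zero \<^bold>< ev (w - v)" for v w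
    using lt_ev[of 0 v "w - v"] by (simp add: ev_0)
  have eq_diff: "ev v = ev w \<longleftrightarrow> ev (v - w) = zero" for v w
  proof
    assume "ev v = ev w"
    then have "ev (v + - w) = ev (w + - w)" by (simp only: ev_add)
    then show "ev (v - w) = zero" by (simp add: ev_0)
  next
    assume "ev (v - w) = zero"
    then have "ev (v - w + w) = ev (0 + w)" by (simp only: ev_add ev_0)
    then show "ev v = ev w" by simp
  qed
  have Us_ev_add: "ev v \<in> Us j \<Longrightarrow> ev w \<in> Us j \<Longrightarrow> ev (v + w) \<in> Us j" for v w j
    using Us_add by (simp add: ev_add)
  have Us_ev_minus: "ev v \<in> Us j \<Longrightarrow> ev (- v) \<in> Us j" for v j
    using Us_neg[OF _ ev_univ[of "- v"], of "ev v" j] by (simp add: ev_0 flip: ev_add)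
  have pos_add: "zero \<^bold>< ev (v + w)" if "zero \<^bold>< ev v" "zero \<^bold>< ev w" for v w
    using that lt_diff[of v "v + w"] lt_trans[OF zero(1) ev_univ[of v] ev_univ[of "v + w"]] by simp
  have total: "zero \<^bold>< ev v \<or> ev v = zero \<or> zero \<^bold>< ev (- v)" for v
    using lt_total[OF zero(1) ev_univ[of v]] lt_diff[of v 0] by (auto simp: ev_0)
  define P where "P j v \<longleftrightarrow> zero \<^bold>< ev v \<and> ev v \<notin> Us j" for j v
  have asym: "\<not> zero \<^bold>< ev (- v)" if "zero \<^bold>< ev v" for v
    using pos_add[OF that, of "- v"] lt_irrefl[OF zero(1)] by (auto simp: ev_0)
  interpret vector_space "rat_scale :: rat \<Rightarrow> ('a \<Rightarrow>\<^sub>0 rat) \<Rightarrow> 'a \<Rightarrow>\<^sub>0 rat"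
    by (rule vector_space_rat_scale)
  interpret convex_chain rat_scale m P
  proof unfold_locales
    show "\<not> P j (- v)" if "P j v" for j v
      using that asym by (auto simp: P_def)
    show "P j (v + w)" if "P j v" "\<not> P j (- w)" for j v w
    proof (cases "zero \<^bold>< ev (- w)")
      case True
      then have w: "ev (- w) \<in> Us j" using that by (auto simp: P_def)
      then have "ev w \<in> Us j" using Us_ev_minus[of "- w"] by simp
      have "ev (v + w) \<notin> Us j"
        using Us_ev_add[OF _ w, of "v + w"] that(1) by (auto simp: P_def)
      \<comment> \<open>Otherwise \<open>ev v\<close> would lie strictly between 0 and
        \<open>ev (- w)\<close>, hence in U_j by convexity.\<close>
      moreover have "zero \<^bold>< ev (v + w)"
      proof (rule ccontr)
        assume "\<not> zero \<^bold>< ev (v + w)"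
        moreover have "ev (v + w) \<noteq> zero" using \<open>ev (v + w) \<notin> Us j\<close> Us_zero by metis
        ultimately have "zero \<^bold>< ev (- (v + w))" using total[of "v + w"] by blast
        moreover have "- (v + w) = - w - v" by simp
        ultimately have "zero \<^bold>< ev (- w - v)" by metis
        then have "ev v \<^bold>< ev (- w)" by (simp add: lt_diff[of v "- w"])
        then show False
          using Us_convex[OF Us_zero w ev_univ] that(1) by (auto simp: P_def)
      qed
      ultimately show ?thesis by (simp add: P_def)
    next
      case False
      then consider "ev w = zero" | "zero \<^bold>< ev w" using total[of w] by blast
      then show ?thesis
      proof cases
        case 1
        then have "ev (v + w) = ev v" using eq_diff[of "v + w" v] by simp
        then show ?thesis using that(1) by (simp add: P_def)
      next
        case 2
        then have "ev v \<^bold>< ev (v + w)" by (simp add: lt_diff[of v "v + w"])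
        then have "ev (v + w) \<notin> Us j"
          using Us_convex[OF Us_zero _ ev_univ[of v]] that(1) by (auto simp: P_def)
        then show ?thesis using pos_add that(1) 2 by (simp add: P_def)
      qed
    qed
    show "P i v" if "i \<le> j" "P j v" for i j v
      using that Us_mono by (auto simp: P_def)
    show "\<exists>v. P i v \<and> \<not> P j v" if ij: "i < j" "j \<le> Suc m" for i j
    proof -
      obtain x where "x \<in> Us j" "x \<notin> Us i" using Us_gap[OF ij] by blast
      moreover obtain v where "x = ev v" using \<open>x \<in> Us j\<close> Us_subset ev_range by blast
      ultimately have v: "ev v \<in> Us j" "ev v \<notin> Us i" by auto
      then have "ev v \<noteq> zero" "ev (- v) \<notin> Us i"
        using Us_zero[of i] Us_ev_minus[of "- v" i] by auto
      then show ?thesis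
        using v total[of v] Us_ev_minus[OF v(1)] by (auto simp: P_def)
    qed
    show "\<not> P (Suc m) v" for v
      using ev_univ by (simp add: P_def Us_def)
  qed
  have "chain_model rat_scale m P M ev"
  proof unfold_locales
    show "range ev = univ M" by (rule ev_range)
    show "ev v \<^bold>+ ev w = ev (v + w)" for v w by (simp add: ev_add)
    show "ev v \<^bold>< ev w \<longleftrightarrow> P 0 (w - v)" for v w
      using lt_irrefl[OF zero(1)] by (auto simp: lt_diff[of v w] P_def Us_def)
    have P0: "P 0 v \<longleftrightarrow> zero \<^bold>< ev v" for v
      using lt_irrefl[OF zero(1)] by (auto simp: P_def Us_def)
    show "ev v = ev w \<longleftrightarrow> sg 0 (v - w) = 0" for v w
      using total[of "v - w"] lt_irrefl[OF zero(1)] eq_diff[of v w] eq_diff[of w v]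
      by (auto simp: sg_eq_0 P0)
    show "irel M (U k) [ev v] \<longleftrightarrow> sg k v = 0" if "1 \<le> k" "k \<le> m" for k v
    proof -
      have "irel M (U k) [ev v] \<longleftrightarrow> ev v \<in> Us k"
        using that ev_univ by (auto simp: Us_def)
      also have "\<dots> \<longleftrightarrow> \<not> P k v \<and> \<not> P k (- v)"
        using total[of v] Us_ev_minus[of v k] Us_ev_minus[of "- v" k] Us_zero[of k]
        by (auto simp: P_def)
      finally show ?thesis by (simp add: sg_eq_0)
    qed
  qed
  then show ?thesis by blast
qed

lemma conclusion: "weakly_o_minimal (lang m) Less M \<and> n_dim (lang m) M = m + 1"
proof -
  obtain P and ev :: "('a \<Rightarrow>\<^sub>0 rat) \<Rightarrow> 'a" where "chain_model rat_scale m P M ev"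
    using chain_model_exists by blast
  then interpret chain_model rat_scale m P M ev .
  show ?thesis
    using weakly_o_minimal_model n_dim_model model by (simp add: is_model_def)
qed

end

section \<open>Consistency\<close>

text \<open>If q had the largest degree, the leading coefficients of q - p and r - q would have
  opposite signs, although both differences are positive.\<close>

lemma degree_convex:
  fixes p q r :: "'a::linordered_idom poly"
  assumes "p < q" "q < r"
  shows "degree q \<le> max (degree p) (degree r)"
proof (rule ccontr)
  assume "\<not> ?thesis"
  then have "degree p < degree q" "degree r < degree q" by auto
  then have "degree (q - p) = degree q" "degree (r - q) = degree q"
    using degree_add_eq_left[of "- p" q] degree_add_eq_right[of r "- q"] by auto
  moreover have "coeff p (degree q) = 0" "coeff r (degree q) = 0"
    using \<open>degree p < degree q\<close> \<open>degree r < degree q\<close> by (auto simp: coeff_eq_0)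
  ultimately show False
    using assms by (auto simp: less_poly_def pos_poly_def)
qed

definition poly_code :: "rat poly \<Rightarrow> nat" where
  "poly_code p = to_nat (coeffs p)"

definition poly_decode :: "nat \<Rightarrow> rat poly" where
  "poly_decode = inv_into UNIV poly_code"

lemma poly_decode_code [simp]: "poly_decode (poly_code p) = p"
proof -
  have "inj poly_code"
    by (auto simp: inj_def poly_code_def coeffs_eq_iff)
  then show ?thesis by (simp add: poly_decode_def)
qed

text \<open>Rational polynomials ordered by the sign of the leading coefficient, with U_k the
  polynomials of degree below k, all coded as natural numbers. One structure serves every m.\<close>

definition poly_model :: "(og_fun, og_rel, nat) fo_struct" where
  "poly_model = \<lparr>univ = range poly_code,
     ifun = (\<lambda>_ xs. poly_code (poly_decode (xs ! 0) + poly_decode (xs ! 1))),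
     irel = (\<lambda>r xs. case r of Less \<Rightarrow> poly_decode (xs ! 0) < poly_decode (xs ! 1)
       | U k \<Rightarrow> degree (poly_decode (xs ! 0)) < k)\<rparr>"

lemma poly_code_eq_iff [simp]: "poly_code p = poly_code q \<longleftrightarrow> p = q"
  by (metis poly_decode_code)

lemma poly_model_simps [simp]:
  "univ poly_model = range poly_code"
  "ifun poly_model f [a, b] = poly_code (poly_decode a + poly_decode b)"
  "irel poly_model Less [a, b] \<longleftrightarrow> poly_decode a < poly_decode b"
  "irel poly_model (U k) [a] \<longleftrightarrow> degree (poly_decode a) < k"
  by (simp_all add: poly_model_def)

lemma eval_mult_tm_poly:
  "eval_tm poly_model e (mult_tm n (Var i)) = poly_code (of_nat (Suc n) * p)" if "e i = poly_code p"
  using that by (induction n) (simp_all add: algebra_simps)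

text \<open>S describes the ambient group, which is everything for the top subgroup and the next
  degree bound for the others; in either case the monomial of degree k shows that the inclusion is
  proper.\<close>

lemma poly_model_subgroup:
  assumes H: "\<And>e t. sat poly_model e (H t) \<longleftrightarrow> degree (poly_decode (eval_tm poly_model e t)) < k"
    and K: "\<And>e t. sat poly_model e (K t) \<longleftrightarrow> S (poly_decode (eval_tm poly_model e t))"
    and k: "0 < k" "\<And>p. degree p < k \<Longrightarrow> S p" "S (monom 1 k)"
    and \<phi>: "\<phi> \<in> nontrivial_convex_subgroup_axioms H K"
  shows "sat poly_model e \<phi>"
proof -
  have 1: "degree q < k" if "degree p < k" "degree r < k" "p < q" "q < r" for p q r :: "rat poly"
    using degree_convex[OF that(3,4)] that(1,2) by auto
  have 2: "\<exists>p. degree p < k \<and> p \<noteq> (0 :: rat poly)"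
    using k(1) by (intro exI[of _ 1]) auto
  have 3: "\<exists>p. S p \<and> \<not> degree p < k"
    using k(3) by (intro exI[of _ "monom 1 k"]) (simp add: degree_monom_eq)
  have 4: "degree q < k" if "degree p < k" "p + q = 0" for p q :: "rat poly"
    using that by (metis add_eq_0_iff degree_minus)
  have "sat poly_model e (Forall 0 (Imp (H (Var 0)) (K (Var 0))))"
    using k(2) by (simp add: H K)
  moreover have "sat poly_model e (Forall 0 (Imp (Defs.is_zero (Var 0)) (H (Var 0))))"
    using k(1) by (simp add: H Defs.is_zero_def)
  moreover have "sat poly_model e (Forall 0 (Forall 1 (Imp (Conj (H (Var 0)) (H (Var 1)))
      (H (add (Var 0) (Var 1))))))"
    by (simp add: H degree_add_less)
  moreover have "sat poly_model e (Forall 0 (Forall 1 (Imp (Conj (H (Var 0))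
      (Defs.is_zero (add (Var 0) (Var 1)))) (H (Var 1)))))"
    using 4 by (simp add: H Defs.is_zero_def)
  moreover have "sat poly_model e (Forall 0 (Forall 1 (Forall 2 (Imp (Conj (Conj (H (Var 0)) (H (Var 2)))
       (Conj (K (Var 1)) (Conj (lt_fm (Var 0) (Var 1)) (lt_fm (Var 1) (Var 2))))) (H (Var 1))))))"
    by (simp add: H K) (use 1 in blast)
  moreover have "sat poly_model e (Exists 0 (Conj (H (Var 0)) (Neg (Defs.is_zero (Var 0)))))"
    using 2 by (simp add: H Defs.is_zero_def)
  moreover have "sat poly_model e (Exists 0 (Conj (K (Var 0)) (Neg (H (Var 0)))))"
    using 3 by (simp add: H K)
  ultimately show ?thesis
    using \<phi> unfolding nontrivial_convex_subgroup_axioms_def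
    by (elim insertE emptyE) (simp_all only:)
qed

lemma consistent_T: "consistent (lang m) (theory_T m)" if "0 < m"
  unfolding consistent_def is_model_def
proof (intro exI[of _ poly_model] conjI ballI allI impI)
  show "is_struct (lang m) poly_model"
    by (auto simp: is_struct_def lang_def tuples_def numeral_2_eq_2 length_Suc_conv)
  fix \<phi> :: og_fm and e :: "nat \<Rightarrow> nat"
  assume "\<phi> \<in> theory_T m"
  then consider "\<phi> \<in> abelian_group_axioms" | "\<phi> \<in> divisibility_axioms" | "\<phi> \<in> order_axioms"
    | "\<phi> \<in> nontrivial_convex_subgroup_axioms (in_U m) whole"
    | k where "1 < k" "k \<le> m" "\<phi> \<in> nontrivial_convex_subgroup_axioms (in_U (k - 1)) (in_U k)"
    unfolding theory_T_def by auto
  then show "sat poly_model e \<phi>"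
  proof cases
    case 1
    have "\<exists>z :: rat poly. (\<forall>p. p + z = p) \<and> (\<forall>p. \<exists>q. p + q = z)"
      by (rule exI[of _ 0]) (metis add.right_inverse add.right_neutral)
    with 1 show ?thesis
      unfolding abelian_group_axioms_def by (auto simp: algebra_simps)
  next
    case 2
    then obtain n where \<phi>: "\<phi> = Forall 0 (Exists 1 (Eq (mult_tm n (Var 1)) (Var 0)))"
      by (auto simp: divisibility_axioms_def)
    have "\<exists>q. of_nat (Suc n) * q = p" for p :: "rat poly"
      by (intro exI[of _ "smult (1 / of_nat (Suc n)) p"]) (simp add: of_nat_poly del: of_nat_Suc)
    then show ?thesis
      by (simp add: \<phi> eval_mult_tm_poly del: of_nat_Suc)
  next
    case 3
    then show ?thesis
      unfolding order_axioms_def by auto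
  next
    case 4
    show ?thesis
      by (rule poly_model_subgroup[where k = m and S = "\<lambda>_. True", OF _ _ _ _ _ 4]) (use that in auto)
  next
    case (5 k)
    show ?thesis
      by (rule poly_model_subgroup[where k = "k - 1" and S = "\<lambda>p. degree p < k", OF _ _ _ _ _ 5(3)])
         (use 5 in \<open>auto simp: degree_monom_eq\<close>)
  qed
qed

theorem theorem3p26:
  fixes m :: nat
  assumes "m > 0"
  shows "consistent (lang m) (theory_T m) \<and>
    (\<forall>M :: (og_fun, og_rel, 'a) fo_struct. is_model (lang m) (theory_T m) M \<longrightarrow>
       weakly_o_minimal (lang m) Less M \<and> n_dim (lang m) M = m + 1)"
  using assms consistent_T T_model.conclusion by (auto simp: T_model_def)

end
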